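(* Let $A$, $N$, $R_s$, $A_{|\Omega_s}$, $D_s$ ($s=1,\dots,N$) come from the discretized and decomposed linear elasticity problem described in the context, and let $M_s:=D_s^{-1}A_{|\Omega_s}D_s^{-1}$. Let the Neumann-Neumann preconditioner be defined by the choice of local operators $\tilde A_s=M_s$ for every $s\in\{1,\dots,N\}$, which leads to the one-level preconditioner $$H:=\sum_{s=1}^NR_s^\top D_sA_{|\Omega_s}^\dagger D_sR_s,$$ assumed non-singular. Given any threshold $\tau$ with $1>\tau>0$, let the coarse space be defined by $$V_0:=\sum_{s=1}^NR_s^\top\mathcal Y_L(\tau,M_s,R_sAR_s^\top).$$ Let $R_0\in\mathbb R^{\dim(V_0)\times n}$ be a matrix whose rows form a basis of $V_0$, and let $P_0$, $H_{hyb}$ be the two-level operators defined in the context. Then, with $\lambda(B)$ denoting an arbitrary eigenvalue of $B$ and $N^c$ a coloring constant, $$1\le\lambda(HAP_0)\le N^c/\tau\quad\text{if }\lambda(HAP_0)\ne0,$$ $$1\le\lambda(H_{hyb}A)\le N^c/\tau.$$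
   Context: Problem. $\Omega=[0,2]\times[0,1]$, $\partial\Omega_D$ is the left-hand side boundary of $\Omega$, $\mathcal V=\{v\in H^1(\Omega)^2: v=0\text{ on }\partial\Omega_D\}$. The bilinear form is $a_\omega(u,v)=\int_\omega[2\mu\,\varepsilon(u):\varepsilon(v)+L\operatorname{div}(u)\operatorname{div}(v)]\,dx$, with $\varepsilon_{ij}(u)=\frac12(\partial u_i/\partial x_j+\partial u_j/\partial x_i)$, $\mu=\frac{E}{2(1+\nu)}$, $L=\frac{E\nu}{(1+\nu)(1-2\nu)}$, $\nu=0.4$. $\mathcal V_h\subset\mathcal V$ is the space of continuous piecewise linear ($\mathbb P_1$) Lagrange finite elements on a uniform mesh of $\Omega$ with element size $h=1/42$ satisfying the Dirichlet condition, with (nodal) basis $\{\phi_k\}_{k=1}^n$, and $A\in\mathbb R^{n\times n}$ is the symmetric positive definite (spd) matrix $A_{ij}=a_\Omega(\phi_i,\phi_j)$. Decomposition. $\Omega$ is partitioned into $N=8$ non-overlapping, mesh-conforming subdomains $\Omega_s$ (computed by the graph partitioner Metis). Young's modulus $E$ is either $10^5$ in $\Omega_s$ for odd $s$ and $10^8$ for even $s$, or that distribution augmented by $10^9$ where $y\in[1/7,2/7]\cup[3/7,4/7]\cup[5/7,6/7]$. For each $s$, $\{S_s^1,\dots,S_s^{n_s}\}\subset\{1,\dots,n\}$ is the set of degrees of freedom (at the mesh nodes) in $\Omega_s$, including those on its interfaces; $R_s\in\mathbb R^{n_s\times n}$ is the Boolean matrix with $(R_s)_{ij}=1$ if $j=S_s^i$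 and $0$ otherwise. The local Neumann matrix is $A_{|\Omega_s}\in\mathbb R^{n_s\times n_s}$, $(A_{|\Omega_s})_{ij}:=a_{\Omega_s}(\phi_{S_s^i},\phi_{S_s^j})$, so that $A=\sum_{s=1}^NR_s^\top A_{|\Omega_s}R_s$. The partition of unity $(D_s)_{s}$ is either the multiplicity scaling $D_s:=R_s\left(\sum_{t=1}^NR_t^\top R_t\right)^{-1}R_s^\top$ for all $s$, or the $k$-scaling: $D_s$ diagonal with $(D_s)_{ii}:=(A_{|\Omega_s})_{ii}/(R_sAR_s^\top)_{ii}$ for all $s$; in both cases $\sum_sR_s^\top D_sR_s=I$. $\tilde A_s\in\mathbb R^{n_s\times n_s}$ denotes the symmetric positive semi-definite local operator (local solver) chosen for subdomain $s$. $B^\dagger$ is the Moore-Penrose pseudo-inverse of $B$. Two-level operators: $P_0:=I-R_0^\top(R_0AR_0^\top)^{-1}R_0A$ ($A$-orthogonal projection with kernel $V_0$), $H_{hyb}:=P_0HP_0^\top+R_0^\top(R_0AR_0^\top)^{-1}R_0$. Coloring constant: $N^c\in\mathbb N$ is such that there are subsets $\mathcal C_1,\dots,\mathcal C_{N^c}$ of $\{1,\dots,N\}$ with $\{1,\dots,N\}=\bigcup_{j}\mathcal C_j$ and, for each $j$ and all $s,t\in\mathcal C_j$ with $s\ne t$, $R_sAR_t^\top=0$. Space $\mathcal Y_L$: for $M_A\in\mathbb R^{m\times m}$ symmetric positive semi-definite, $M_B\in\mathbb R^{m\times m}$ spd and a scalar $\tau>0$, $\mathcal Y_L(\tau,M_A,M_B):=\operatorname{span}\{y: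 M_Ay=\lambda M_By\text{ with }\lambda<\tau\}$. *)

theory Defs
  imports
    "HOL-Analysis.Analysis"
    "Jordan_Normal_Form.VS_Connect"
    "Jordan_Normal_Form.Char_Poly"
    "Jordan_Normal_Form.Gauss_Jordan_Elimination"
begin

(* Points and displacements live in real^2, matrices and coordinate vectors of varying size
   in the Jordan_Normal_Form types; "$" is kept for real^2 only. *)
no_notation Matrix.vec_index (infixl \<open>$\<close> 100)

section \<open>Geometry and mesh\<close>

definition Omega :: "(real^2) set" where
  "Omega = {x. 0 \<le> x $ 1 \<and> x $ 1 \<le> 2 \<and> 0 \<le> x $ 2 \<and> x $ 2 \<le> 1}"

definition dirichlet_bd :: "(real^2) set" where
  "dirichlet_bd = {x \<in> Omega. x $ 1 = 0}"

definition node :: "nat \<Rightarrow> nat \<Rightarrow> real^2" where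
  "node i j = vector [real i / 42, real j / 42]"

definition mesh_nodes :: "(real^2) set" where
  "mesh_nodes = {node i j | i j. i \<le> 84 \<and> j \<le> 42}"

(* The square cell with lower left corner node i j is cut along one of its two diagonals;
   the flag says which one, and it is the same for all cells of the mesh. *)
definition cell_triangles :: "bool \<Rightarrow> nat \<Rightarrow> nat \<Rightarrow> (real^2) set set" where
  "cell_triangles diag i j =
     (if diag
      then {convex hull {node i j, node (i+1) j, node (i+1) (j+1)},
            convex hull {node i j, node i (j+1), node (i+1) (j+1)}}
      else {convex hull {node i j, node (i+1) j, node i (j+1)},
            convex hull {node (i+1) j, node i (j+1), node (i+1) (j+1)}})"

definition mesh :: "bool \<Rightarrow> (real^2) set set" where
  "mesh diag = (\<Union>i<84. \<Union>j<42. cell_triangles diag i j)"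

(* A mesh-conforming decomposition is given by a labelling of the triangles;
   subdomains are closed sets, so they contain their interfaces. *)
definition subdomain :: "bool \<Rightarrow> ((real^2) set \<Rightarrow> nat) \<Rightarrow> nat \<Rightarrow> (real^2) set" where
  "subdomain diag lab s = \<Union>{T \<in> mesh diag. lab T = s}"

section \<open>P1 finite elements and linear elasticity\<close>

(* Continuous, piecewise affine functions are automatically in H^1.
   Values outside Omega are irrelevant and left unconstrained. *)
definition P1_space :: "bool \<Rightarrow> (real^2 \<Rightarrow> real^2) set" where
  "P1_space diag = {v. continuous_on Omega v
      \<and> (\<forall>T\<in>mesh diag. \<exists>f c. linear f \<and> (\<forall>x\<in>T. v x = f x + c))
      \<and> (\<forall>x\<in>dirichlet_bd. v x = 0)}"

(* A degree of freedom is a mesh node off the Dirichlet boundary together with a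
   displacement component; dof enumerates them in an arbitrary order. *)
definition nodal_basis ::
  "bool \<Rightarrow> nat \<Rightarrow> (nat \<Rightarrow> real^2 \<Rightarrow> real^2) \<Rightarrow> (nat \<Rightarrow> (real^2) \<times> 2) \<Rightarrow> bool" where
  "nodal_basis diag n \<phi> dof \<longleftrightarrow>
     bij_betw dof {..<n} ((mesh_nodes - dirichlet_bd) \<times> UNIV) \<and>
     (\<forall>k<n. \<phi> k \<in> P1_space diag \<and>
        (\<forall>p\<in>mesh_nodes. \<phi> k p = (if p = fst (dof k) then axis (snd (dof k)) 1 else 0)))"

(* The classical derivative of a continuous piecewise affine function exists off the
   triangle edges, a null set, and there agrees with the weak derivative. *)
definition pderiv_at :: "2 \<Rightarrow> (real^2 \<Rightarrow> real^2) \<Rightarrow> real^2 \<Rightarrow> real^2" where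
  "pderiv_at j u x = frechet_derivative u (at x) (axis j 1)"

definition strain :: "(real^2 \<Rightarrow> real^2) \<Rightarrow> real^2 \<Rightarrow> real^2^2" where
  "strain u x = (\<chi> i j. (pderiv_at j u x $ i + pderiv_at i u x $ j) / 2)"

definition divergence :: "(real^2 \<Rightarrow> real^2) \<Rightarrow> real^2 \<Rightarrow> real" where
  "divergence u x = (\<Sum>i\<in>UNIV. pderiv_at i u x $ i)"

definition poisson_ratio :: real where "poisson_ratio = 0.4"

definition lame_mu :: "real \<Rightarrow> real" where
  "lame_mu E = E / (2 * (1 + poisson_ratio))"

definition lame_L :: "real \<Rightarrow> real" where
  "lame_L E = E * poisson_ratio / ((1 + poisson_ratio) * (1 - 2 * poisson_ratio))"

(* On interfaces, a null set, the choice of the value is immaterial. *)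
definition young :: "bool \<Rightarrow> (nat \<Rightarrow> (real^2) set) \<Rightarrow> real^2 \<Rightarrow> real" where
  "young layers Om x =
     (if layers \<and> x $ 2 \<in> {1/7..2/7} \<union> {3/7..4/7} \<union> {5/7..6/7} then 10^9
      else if \<exists>s\<in>{1..8}. odd s \<and> x \<in> Om s then 10^5
      else 10^8)"

definition elast_form ::
  "(real^2 \<Rightarrow> real) \<Rightarrow> (real^2) set \<Rightarrow> (real^2 \<Rightarrow> real^2) \<Rightarrow> (real^2 \<Rightarrow> real^2) \<Rightarrow> real" where
  "elast_form E \<omega> u v = (LINT x:\<omega>|lebesgue.
      2 * lame_mu (E x) * (\<Sum>i\<in>UNIV. \<Sum>j\<in>UNIV. strain u x $ i $ j * strain v x $ i $ j)
      + lame_L (E x) * divergence u x * divergence v x)"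

section \<open>Matrices\<close>

definition is_pinv :: "real mat \<Rightarrow> real mat \<Rightarrow> bool" where
  "is_pinv B X \<longleftrightarrow> X \<in> carrier_mat (dim_col B) (dim_row B)
     \<and> B * X * B = B \<and> X * B * X = X
     \<and> transpose_mat (B * X) = B * X \<and> transpose_mat (X * B) = X * B"

definition pinv :: "real mat \<Rightarrow> real mat" where
  "pinv B = (THE X. is_pinv B X)"

(* Meaningful for invertible matrices only. *)
abbreviation inv_mat :: "real mat \<Rightarrow> real mat" where
  "inv_mat B \<equiv> the (mat_inverse B)"

abbreviation msum :: "nat \<Rightarrow> (nat \<Rightarrow> real mat) \<Rightarrow> nat set \<Rightarrow> real mat" where
  "msum n F I \<equiv> finsum (module_mat TYPE(real) n n) F I"

definition boolean_restriction :: "nat \<Rightarrow> nat \<Rightarrow> (nat \<Rightarrow> nat) \<Rightarrow> real mat" where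
  "boolean_restriction m n S = Matrix.mat m n (\<lambda>(i, j). if j = S i then 1 else 0)"

definition multiplicity_scaling :: "nat \<Rightarrow> (nat \<Rightarrow> real mat) \<Rightarrow> nat \<Rightarrow> real mat" where
  "multiplicity_scaling n R s =
     R s * inv_mat (msum n (\<lambda>t. transpose_mat (R t) * R t) {1..8}) * transpose_mat (R s)"

definition k_scaling ::
  "real mat \<Rightarrow> (nat \<Rightarrow> real mat) \<Rightarrow> (nat \<Rightarrow> real mat) \<Rightarrow> nat \<Rightarrow> real mat" where
  "k_scaling A K R s = Matrix.mat (dim_row (K s)) (dim_row (K s))
     (\<lambda>(i, j). if i = j then K s $$ (i, i) / (R s * A * transpose_mat (R s)) $$ (i, i) else 0)"

definition Y_L :: "real \<Rightarrow> real mat \<Rightarrow> real mat \<Rightarrow> real Matrix.vec set" where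
  "Y_L \<tau> M\<^sub>A M\<^sub>B =
     LinearCombinations.module.span class_ring (module_vec TYPE(real) (dim_row M\<^sub>A))
       {y \<in> carrier_vec (dim_row M\<^sub>A). \<exists>ev<\<tau>. M\<^sub>A *\<^sub>v y = ev \<cdot>\<^sub>v (M\<^sub>B *\<^sub>v y)}"

definition coarse_space ::
  "nat \<Rightarrow> (nat \<Rightarrow> real mat) \<Rightarrow> (nat \<Rightarrow> real Matrix.vec set) \<Rightarrow> real Matrix.vec set" where
  "coarse_space n R Y = {finsum_vec TYPE(real) n (\<lambda>s. transpose_mat (R s) *\<^sub>v y s) {1..8} | y.
     \<forall>s\<in>{1..8}. y s \<in> Y s}"

definition rows_form_basis :: "nat \<Rightarrow> real mat \<Rightarrow> real Matrix.vec set \<Rightarrow> bool" where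
  "rows_form_basis n R\<^sub>0 W \<longleftrightarrow>
     (let V = (module_vec TYPE(real) n)\<lparr>carrier := W\<rparr> in
        R\<^sub>0 \<in> carrier_mat (vectorspace.dim class_ring V) n \<and>
        vectorspace.basis class_ring V (set (rows R\<^sub>0)))"

definition coarse_solve :: "real mat \<Rightarrow> real mat \<Rightarrow> real mat" where
  "coarse_solve A R\<^sub>0 = transpose_mat R\<^sub>0 * inv_mat (R\<^sub>0 * A * transpose_mat R\<^sub>0) * R\<^sub>0"

definition coarse_proj :: "real mat \<Rightarrow> real mat \<Rightarrow> real mat" where
  "coarse_proj A R\<^sub>0 = 1\<^sub>m (dim_row A) - coarse_solve A R\<^sub>0 * A"

definition hybrid :: "real mat \<Rightarrow> real mat \<Rightarrow> real mat \<Rightarrow> real mat" where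
  "hybrid A R\<^sub>0 H =
     coarse_proj A R\<^sub>0 * H * transpose_mat (coarse_proj A R\<^sub>0) + coarse_solve A R\<^sub>0"

definition coloring ::
  "nat \<Rightarrow> (nat \<Rightarrow> nat set) \<Rightarrow> real mat \<Rightarrow> (nat \<Rightarrow> real mat) \<Rightarrow> bool" where
  "coloring Nc C A R \<longleftrightarrow> {1..8} = (\<Union>j\<in>{1..Nc}. C j) \<and>
     (\<forall>j\<in>{1..Nc}. \<forall>s\<in>C j. \<forall>t\<in>C j. s \<noteq> t \<longrightarrow>
        R s * A * transpose_mat (R t) = 0\<^sub>m (dim_row (R s)) (dim_row (R t)))"

(* Eigenvalues are taken over the complex numbers, as the products below need not be
   symmetric matrices. *)
abbreviation cx_eigenvalue :: "real mat \<Rightarrow> complex \<Rightarrow> bool" where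
  "cx_eigenvalue B ev \<equiv> eigenvalue (map_mat complex_of_real B) ev"

end

(* For v in the range of P_0 put r = A v. It is orthogonal to V_0, so R_s r is orthogonal to all
   eigenvectors of the pencil (M_s, R_s A R_s^T) below tau, in particular to the kernel of M_s. Hence
   R_s r = M_s z_s with z_s in the span of the remaining eigenvectors, and there
   tau <z_s, R_s A R_s^T z_s> <= <z_s, M_s z_s>. The sum of <z_s, M_s z_s> over s is h = <r, H r>.
   Comparing z_s with the splitting w_s = D_s R_s v of v, whose M_s-energies add up to <v, A v>, gives
   <v, A v> <= h. As h = <v, A (sum_s R_s^T z_s)>, the Cauchy-Schwarz inequality and the coloring
   give tau h <= N^c <v, A v>. Both two-level operators reduce to the A-selfadjoint operator
   P_0 H P_0^T A, whose spectrum is real; a complex eigenvector is split into its real and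
   imaginary parts.

   The pencil is diagonalized by minimizing Rayleigh quotients on a compact sphere. Definiteness of A
   uses that a strain-free piecewise linear displacement is a rigid motion on each triangle. *)
theory Submission
  imports Defs
begin

section \<open>Symmetric pencils and pseudo-inverses\<close>

text \<open>Apart from the eigenvalue 1 that the hybrid operator may have on the coarse space, the
  eigenvalues in question are values of the quotient of <A v, H A v> and <v, A v> on the range of
  \<open>P\<^sub>0\<close>. The constant 1 is exact accounting: the Neumann energies of the
  restrictions \<open>R s *\<^sub>v v\<close> add up to <v, A v> without loss, and the congruence by
  \<open>D s\<close> in \<open>M s\<close> turns them into energies of the pieces of the partition
  of unity. The obstacle is that Neumann matrices can be singular: a subdomain away from the
  Dirichlet boundary has rigid motions in the kernel of \<open>K s\<close>. The local term of
  \<open>H\<close> equals an \<open>M s\<close>-energy for residuals in the range of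
  \<open>M s\<close>, and positivity of \<tau> is what makes the coarse space keep them there. Two
  prerequisites come from the mesh. The pencil needs a definite right-hand matrix, hence
  definiteness of \<open>A\<close>; and \<open>M s\<close> needs an invertible \<open>D s\<close>,
  which for the k-scaling means that a nodal function has positive energy in every subdomain
  containing its node.\<close>

no_notation inner (infix \<open>\<bullet>\<close> 70)

text \<open>Coordinate vectors are modelled by functions on \<open>nat\<close>, where the product
  topology offers Tychonoff's theorem; the sphere on which Rayleigh quotients are minimized is a
  closed subset of this cube.\<close>

lemma compact_cube: "compact {g::nat \<Rightarrow> real. \<forall>i. g i \<in> {-1..1}}"
proof -
  have "compactin (product_topology (\<lambda>_. euclidean) UNIV) (PiE UNIV (\<lambda>_::nat. {-1..1::real}))"
    by (subst compactin_PiE) (auto simp: compactin_euclidean_iff)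
  moreover have "PiE UNIV (\<lambda>_::nat. {-1..1::real}) = {g. \<forall>i. g i \<in> {-1..1}}" by (auto simp: PiE_def)
  ultimately show ?thesis by (simp add: euclidean_product_topology)
qed

lemma quad_form_vec:
  fixes M :: "real mat"
  assumes "M \<in> carrier_mat m m"
  shows "Matrix.vec m g \<bullet> (M *\<^sub>v Matrix.vec m g) = (\<Sum>i<m. \<Sum>j<m. M $$ (i, j) * g i * g j)"
  using assms
  by (auto simp: scalar_prod_def sum_distrib_left atLeast0LessThan mult_ac intro!: sum.cong)

text \<open>A continuous quotient attains its infimum on a compact sphere, and homogeneity of degree
  zero extends the bound to all admissible vectors; \<open>w0\<close> makes the constrained sphere
  nonempty. The constraints are Euclidean, so that orthogonality in any other inner product can be
  encoded in the choice of \<open>F\<close>.\<close>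

lemma rayleigh_minimizer:
  fixes M B :: "real mat"
  assumes M: "M \<in> carrier_mat m m" and B: "B \<in> carrier_mat m m"
    and pos: "\<And>x. x \<in> carrier_vec m \<Longrightarrow> x \<noteq> 0\<^sub>v m \<Longrightarrow> 0 < x \<bullet> (B *\<^sub>v x)"
    and F: "F \<subseteq> carrier_vec m"
    and w0: "w0 \<in> carrier_vec m" "w0 \<noteq> 0\<^sub>v m" "\<forall>f\<in>F. f \<bullet> w0 = 0"
  obtains x l where "x \<in> carrier_vec m" "x \<noteq> 0\<^sub>v m" "\<forall>f\<in>F. f \<bullet> x = 0"
    "x \<bullet> (M *\<^sub>v x) = l * (x \<bullet> (B *\<^sub>v x))"
    "\<And>w. w \<in> carrier_vec m \<Longrightarrow> \<forall>f\<in>F. f \<bullet> w = 0 \<Longrightarrow> l * (w \<bullet> (B *\<^sub>v w)) \<le> w \<bullet> (M *\<^sub>v w)"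
proof -
  define q where "q X g = (\<Sum>i<m. \<Sum>j<m. X $$ (i, j) * g i * g j)" for X :: "real mat" and g :: "nat \<Rightarrow> real"
  \<comment> \<open>Pinning the coordinates from \<open>m\<close> on to zero embeds the unit sphere
    of the constrained subspace into the compact cube.\<close>
  define S where "S = {g::nat \<Rightarrow> real. (\<forall>i\<in>{m..}. g i = 0) \<and> (\<Sum>i<m. (g i)\<^sup>2) = 1 \<and>
    (\<forall>f\<in>F. (\<Sum>i<m. vec_index f i * g i) = 0)}"
  have qv: "w \<bullet> (X *\<^sub>v w) = q X (vec_index w)" if "w \<in> carrier_vec m" "X \<in> carrier_mat m m" for w X
  proof -
    have "w = Matrix.vec m (vec_index w)" using that by auto
    then show ?thesis using quad_form_vec[OF that(2), of "vec_index w"] by (metis q_def)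
  qed
  have fv: "f \<bullet> w = (\<Sum>i<m. vec_index f i * vec_index w i)" if "w \<in> carrier_vec m" for f w
    using that by (auto simp: scalar_prod_def atLeast0LessThan)
  have cq: "continuous_on T (q X)" for X T unfolding q_def
    by (intro continuous_intros continuous_on_product_coordinates continuous_on_subset[OF continuous_on_product_coordinates]) auto
  have "S \<subseteq> {g. \<forall>i. g i \<in> {-1..1}}"
  proof safe
    fix g i assume g: "g \<in> S"
    show "g i \<in> {-1..1}"
    proof (cases "i < m")
      case True
      have "(g i)\<^sup>2 \<le> (\<Sum>i<m. (g i)\<^sup>2)" using True by (intro member_le_sum) auto
      also have "\<dots> = 1" using g by (simp add: S_def)
      finally show ?thesis using abs_le_square_iff[of "g i" 1] by (simp add: abs_le_iff)
    next
      case False then show ?thesis using g by (auto simp: S_def)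
    qed
  qed
  moreover have "closed S"
  proof -
    have c: "continuous_on UNIV (\<lambda>g::nat\<Rightarrow>real. g i)" for i by (rule continuous_on_product_coordinates)
    have S: "S = (\<Inter>i\<in>{m..}. {g. g i = 0}) \<inter> {g. (\<Sum>i<m. (g i)\<^sup>2) = 1} \<inter>
       (\<Inter>f\<in>F. {g. (\<Sum>i<m. vec_index f i * g i) = 0})" unfolding S_def by auto
    show ?thesis unfolding S by (intro closed_Int closed_INT ballI closed_Collect_eq continuous_intros c)
  qed
  ultimately have cS: "compact S" using compact_cube closed_Int_compact[of S] by (metis inf.absorb1)
  have norm: "(\<Sum>i<m. (vec_index w i)\<^sup>2) > 0" if w: "w \<in> carrier_vec m" "w \<noteq> 0\<^sub>v m" for w :: "real Matrix.vec"
  proof -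
    obtain i where "i < m" "vec_index w i \<noteq> 0" using w by (metis carrier_vecD eq_vecI index_zero_vec(1) zero_carrier_vec)
    then show ?thesis by (intro sum_pos2[of _ i]) auto
  qed
  \<comment> \<open>Scaling to Euclidean length one, padded by zeros; numerator and denominator of
    the quotient change by the same factor.\<close>
  define nrm where "nrm w = (\<lambda>i. if i < m then vec_index w i / sqrt (\<Sum>i<m. (vec_index w i)\<^sup>2) else 0)" for w :: "real Matrix.vec"
  have nS: "nrm w \<in> S" if w: "w \<in> carrier_vec m" "w \<noteq> 0\<^sub>v m" "\<forall>f\<in>F. f \<bullet> w = 0" for w
    unfolding S_def
  proof (intro CollectI conjI ballI)
    show "nrm w i = 0" if "i \<in> {m..}" for i using that by (auto simp: nrm_def)
    have "(\<Sum>i<m. (nrm w i)\<^sup>2) = (\<Sum>i<m. (vec_index w i)\<^sup>2 / (\<Sum>i<m. (vec_index w i)\<^sup>2))"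
      by (intro sum.cong) (auto simp: nrm_def power_divide sum_nonneg)
    then show "(\<Sum>i<m. (nrm w i)\<^sup>2) = 1" using norm[OF w(1,2)] by (simp add: sum_divide_distrib[symmetric])
    fix f assume "f \<in> F"
    have "(\<Sum>i<m. vec_index f i * nrm w i) = (\<Sum>i<m. vec_index f i * vec_index w i / sqrt (\<Sum>i<m. (vec_index w i)\<^sup>2))"
      by (intro sum.cong) (auto simp: nrm_def)
    also have "\<dots> = 0" using w(3) \<open>f \<in> F\<close> fv[OF w(1)] by (simp add: sum_divide_distrib[symmetric])
    finally show "(\<Sum>i<m. vec_index f i * nrm w i) = 0" .
  qed
  have qn: "q X (nrm w) = q X (vec_index w) / (\<Sum>i<m. (vec_index w i)\<^sup>2)" if "w \<in> carrier_vec m" for X w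
    by (auto simp: q_def nrm_def sum_divide_distrib sum_nonneg intro!: sum.cong)
  have vS: "Matrix.vec m g \<noteq> 0\<^sub>v m" "\<forall>f\<in>F. f \<bullet> Matrix.vec m g = 0" if g: "g \<in> S" for g
  proof -
    show "Matrix.vec m g \<noteq> 0\<^sub>v m"
    proof
      assume "Matrix.vec m g = 0\<^sub>v m"
      then have "g i = 0" if "i < m" for i using that by (metis index_vec index_zero_vec(1))
      then show False using g by (simp add: S_def)
    qed
    show "\<forall>f\<in>F. f \<bullet> Matrix.vec m g = 0" using g by (simp add: S_def fv)
  qed
  have qp: "q B g > 0" if g: "g \<in> S" for g
    using pos[OF _ vS(1)[OF g]] quad_form_vec[OF B, of g] by (simp add: q_def)
  have "continuous_on S (\<lambda>g. q M g / q B g)" using qp by (intro continuous_intros cq) force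
  then obtain g where g: "g \<in> S" "\<And>h. h \<in> S \<Longrightarrow> q M g / q B g \<le> q M h / q B h"
    using continuous_attains_inf[OF cS, of "\<lambda>g. q M g / q B g"] nS[OF w0] by blast
  let ?x = "Matrix.vec m g" and ?l = "q M g / q B g"
  show thesis
  proof (rule that[of ?x ?l])
    show "?x \<in> carrier_vec m" "?x \<noteq> 0\<^sub>v m" "\<forall>f\<in>F. f \<bullet> ?x = 0" using vS[OF g(1)] by auto
    show "?x \<bullet> (M *\<^sub>v ?x) = ?l * (?x \<bullet> (B *\<^sub>v ?x))"
      unfolding quad_form_vec[OF M] quad_form_vec[OF B] using qp[OF g(1)] by (simp add: q_def)
    fix w assume w: "w \<in> carrier_vec m" "\<forall>f\<in>F. f \<bullet> w = 0"
    show "?l * (w \<bullet> (B *\<^sub>v w)) \<le> w \<bullet> (M *\<^sub>v w)"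
    proof (cases "w = 0\<^sub>v m")
      case True
      then have "w \<bullet> (B *\<^sub>v w) = 0" "w \<bullet> (M *\<^sub>v w) = 0" using M B by simp_all
      then show ?thesis by simp
    next
      case False
      have "?l \<le> q M (nrm w) / q B (nrm w)" using g(2)[OF nS[OF w(1) False w(2)]] .
      also have "\<dots> = q M (vec_index w) / q B (vec_index w)" using norm[OF w(1) False] by (simp add: qn w(1))
      finally show ?thesis using pos[OF w(1) False] by (simp add: qv w M B pos_le_divide_eq)
    qed
  qed
qed

definition spd :: "nat \<Rightarrow> real mat \<Rightarrow> bool" where
  "spd m B \<longleftrightarrow> B \<in> carrier_mat m m \<and> transpose_mat B = B \<and>
     (\<forall>x\<in>carrier_vec m. x \<noteq> 0\<^sub>v m \<longrightarrow> 0 < x \<bullet> (B *\<^sub>v x))"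

lemma spdD:
  assumes "spd m B"
  shows "B \<in> carrier_mat m m" "transpose_mat B = B"
    "\<And>x. x \<in> carrier_vec m \<Longrightarrow> x \<noteq> 0\<^sub>v m \<Longrightarrow> 0 < x \<bullet> (B *\<^sub>v x)"
  using assms by (auto simp: spd_def)

lemma symmetric_form:
  fixes X :: "'a :: comm_ring_1 mat"
  assumes "X \<in> carrier_mat m m" "transpose_mat X = X" "x \<in> carrier_vec m" "y \<in> carrier_vec m"
  shows "x \<bullet> (X *\<^sub>v y) = y \<bullet> (X *\<^sub>v x)"
  using transpose_vec_mult_scalar[OF assms(1,4,3)] assms
  by (metis comm_scalar_prod mult_mat_vec_carrier)

text \<open>A square matrix with trivial kernel has nonzero determinant, so \<open>the\<close> is
  applied to a genuine inverse and not to \<open>None\<close>.\<close>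

lemma mat_inverse_SomeE:
  fixes B :: "'a :: field mat"
  assumes B: "B \<in> carrier_mat m m" and ker: "\<And>x. x \<in> carrier_vec m \<Longrightarrow> B *\<^sub>v x = 0\<^sub>v m \<Longrightarrow> x = 0\<^sub>v m"
  shows "the (mat_inverse B) \<in> carrier_mat m m" "B * the (mat_inverse B) = 1\<^sub>m m" "the (mat_inverse B) * B = 1\<^sub>m m"
proof -
  have "Determinant.det B \<noteq> 0" using det_0_iff_vec_prod_zero_field[OF B] ker by blast
  then have "B \<in> Units (ring_mat TYPE('a) m ())" by (rule det_non_zero_imp_unit[OF B])
  then obtain X where X: "mat_inverse B = Some X" using mat_inverse(1)[OF B, of "()"] by (cases "mat_inverse B") auto
  from mat_inverse(2)[OF B X] X
  show "the (mat_inverse B) \<in> carrier_mat m m" "B * the (mat_inverse B) = 1\<^sub>m m" "the (mat_inverse B) * B = 1\<^sub>m m" by auto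
qed

lemma spd_kernel:
  assumes "spd m B" "x \<in> carrier_vec m" "B *\<^sub>v x = 0\<^sub>v m"
  shows "x = 0\<^sub>v m"
  using spdD(3)[OF assms(1,2)] assms(2,3) by force

lemma spd_inverse:
  assumes "spd m B"
  shows "the (mat_inverse B) \<in> carrier_mat m m" "B * the (mat_inverse B) = 1\<^sub>m m" "the (mat_inverse B) * B = 1\<^sub>m m"
  using mat_inverse_SomeE[OF spdD(1)[OF assms]] spd_kernel[OF assms] by blast+

text \<open>First-order condition at a minimum: a quadratic that vanishes at \<open>t = 0\<close>
  and is never negative has no linear term. Otherwise the trial value \<open>t = - a / d\<close>
  with \<open>d\<close> larger than the modulus of \<open>c\<close> makes it at most
  \<open>- a\<^sup>2 / d\<close>.\<close>

lemma linear_term_zero: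
  fixes a c :: real
  assumes "\<And>t. 0 \<le> 2 * t * a + t\<^sup>2 * c"
  shows "a = 0"
proof (rule ccontr)
  assume a: "a \<noteq> 0"
  define d where "d = \<bar>c\<bar> + 1"
  have dpos: "d > 0" by (simp add: d_def)
  have "0 \<le> 2 * (- a / d) * a + (- a / d)\<^sup>2 * c" by (rule assms)
  also have "\<dots> \<le> 2 * (- a / d) * a + (- a / d)\<^sup>2 * d"
    by (intro add_left_mono mult_left_mono) (auto simp: d_def)
  also have "\<dots> = - (a\<^sup>2 / d)" using dpos by (simp add: power2_eq_square field_simps)
  also have "\<dots> < 0" using a dpos by simp
  finally show False by simp
qed

text \<open>Padding the \<open>k\<close> conditions with zero rows gives a square matrix whose row
  \<open>k\<close> vanishes because \<open>k < m\<close>. Its transpose kills a unit vector, so the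
  determinant is zero and the matrix itself has a kernel.\<close>

lemma underdetermined_nonzero_solution:
  fixes f :: "nat \<Rightarrow> 'a :: field Matrix.vec"
  assumes "k < m" "\<And>i. i < k \<Longrightarrow> f i \<in> carrier_vec m"
  obtains w where "w \<in> carrier_vec m" "w \<noteq> 0\<^sub>v m" "\<And>i. i < k \<Longrightarrow> f i \<bullet> w = 0"
proof -
  define X where "X = mat_of_rows m (map (\<lambda>i. if i < k then f i else 0\<^sub>v m) [0..<m])"
  have X: "X \<in> carrier_mat m m" by (simp add: X_def carrier_matI)
  have row: "Matrix.row X i = (if i < k then f i else 0\<^sub>v m)" if "i < m" for i
    unfolding X_def using that assms by (subst mat_of_rows_row) auto
  have "transpose_mat X *\<^sub>v unit_vec m k = 0\<^sub>v m"
  proof (rule eq_vecI)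
    fix i assume i: "i < dim_vec (0\<^sub>v m :: 'a Matrix.vec)"
    have "vec_index (transpose_mat X *\<^sub>v unit_vec m k) i = X $$ (k, i)"
      using X i assms(1) by (simp add: scalar_prod_right_unit)
    also have "\<dots> = vec_index (Matrix.row X k) i" using X i assms(1) by simp
    also have "\<dots> = 0" using row[OF assms(1)] i by simp
    finally show "vec_index (transpose_mat X *\<^sub>v unit_vec m k) i = vec_index (0\<^sub>v m) i" using i by simp
  qed (use X in simp)
  then have "Determinant.det (transpose_mat X) = 0"
    using X assms(1) det_0_iff_vec_prod_zero_field[of "transpose_mat X" m]
    by (metis transpose_carrier_mat unit_vec_carrier unit_vec_nonzero)
  then have "Determinant.det X = 0" using det_transpose[OF X] by simp
  then obtain w where w: "w \<in> carrier_vec m" "w \<noteq> 0\<^sub>v m" "X *\<^sub>v w = 0\<^sub>v m"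
    using det_0_iff_vec_prod_zero_field[OF X] by auto
  have "f i \<bullet> w = 0" if "i < k" for i
  proof -
    have "vec_index (X *\<^sub>v w) i = f i \<bullet> w" using that assms(1) X row[of i] by simp
    then show ?thesis using w(3) that assms(1) by simp
  qed
  then show thesis using that w by blast
qed

lemma quadratic_difference: "2 * t * a + t\<^sup>2 * b - c * (2 * t * a' + t\<^sup>2 * b') = 2 * t * (a - c * a') + t\<^sup>2 * (b - c * (b'::real))"
  by (simp add: algebra_simps)

text \<open>Serves three purposes: the first variation of a Rayleigh quotient (\<open>t\<close>
  free), comparison of two energies (\<open>t = -1\<close>), and Cauchy-Schwarz (one well chosen
  \<open>t\<close>).\<close>

lemma quadratic_form_expand:
  fixes X :: "'a :: field mat"
  assumes X: "X \<in> carrier_mat m m" "transpose_mat X = X" and x: "x \<in> carrier_vec m" and w: "w \<in> carrier_vec m"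
  shows "(x + t \<cdot>\<^sub>v w) \<bullet> (X *\<^sub>v (x + t \<cdot>\<^sub>v w)) =
    x \<bullet> (X *\<^sub>v x) + 2 * t * (w \<bullet> (X *\<^sub>v x)) + t\<^sup>2 * (w \<bullet> (X *\<^sub>v w))"
proof -
  have c: "X *\<^sub>v x \<in> carrier_vec m" "X *\<^sub>v w \<in> carrier_vec m" "t \<cdot>\<^sub>v w \<in> carrier_vec m"
    "t \<cdot>\<^sub>v (X *\<^sub>v w) \<in> carrier_vec m" using X x w by auto
  have "X *\<^sub>v (x + t \<cdot>\<^sub>v w) = X *\<^sub>v x + t \<cdot>\<^sub>v (X *\<^sub>v w)"
    using mult_add_distrib_mat_vec[OF X(1) x c(3)] mult_mat_vec[OF X(1) w] by simp
  then have "(x + t \<cdot>\<^sub>v w) \<bullet> (X *\<^sub>v (x + t \<cdot>\<^sub>v w)) =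
      x \<bullet> (X *\<^sub>v x) + t * (x \<bullet> (X *\<^sub>v w)) + t * (w \<bullet> (X *\<^sub>v x)) + t * t * (w \<bullet> (X *\<^sub>v w))"
    using c x w
    by (simp add: add_scalar_prod_distrib[of _ m] scalar_prod_add_distrib[of _ m] distrib_left mult.assoc)
  also have "x \<bullet> (X *\<^sub>v w) = w \<bullet> (X *\<^sub>v x)" by (rule symmetric_form[OF X x w])
  finally show ?thesis by (simp add: power2_eq_square algebra_simps)
qed

text \<open>Deflation: minimizing the Rayleigh quotient over the \<open>B\<close>-orthogonal
  complement of the eigenvectors found so far yields the next one. The variation shows only that the
  residual is orthogonal to admissible directions; symmetry of \<open>M\<close> is what removes this
  restriction.\<close>

lemma pencil_eigenvectors:
  fixes M B :: "real mat"
  assumes M: "M \<in> carrier_mat m m" "transpose_mat M = M" and spd: "spd m B"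
  shows "k \<le> m \<Longrightarrow> \<exists>y l. (\<forall>i<k. y i \<in> carrier_vec m \<and> M *\<^sub>v y i = l i \<cdot>\<^sub>v (B *\<^sub>v y i)) \<and>
    (\<forall>i<k. \<forall>j<k. y i \<bullet> (B *\<^sub>v y j) = (if i = j then 1 else 0))"
proof (induction k)
  case 0 show ?case by simp
next
  case (Suc k)
  then have "k \<le> m" by simp
  from Suc.IH[OF this] obtain y l
    where yl: "\<forall>i<k. y i \<in> carrier_vec m \<and> M *\<^sub>v y i = l i \<cdot>\<^sub>v (B *\<^sub>v y i)"
      "\<forall>i<k. \<forall>j<k. y i \<bullet> (B *\<^sub>v y j) = (if i = j then 1 else 0)"
    by (elim exE conjE)
  have y: "\<And>i. i < k \<Longrightarrow> y i \<in> carrier_vec m"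
    and ev: "\<And>i. i < k \<Longrightarrow> M *\<^sub>v y i = l i \<cdot>\<^sub>v (B *\<^sub>v y i)"
    using yl(1) by blast+
  have orth: "\<And>i j. i < k \<Longrightarrow> j < k \<Longrightarrow> y i \<bullet> (B *\<^sub>v y j) = (if i = j then 1 else 0)"
    using yl(2) by blast
  note B = spdD(1,2)[OF spd] and pos = spdD(3)[OF spd]
  have By: "B *\<^sub>v y i \<in> carrier_vec m" if "i < k" for i using that y B by simp
  obtain w0 where w0: "w0 \<in> carrier_vec m" "w0 \<noteq> 0\<^sub>v m" "\<And>i. i < k \<Longrightarrow> (B *\<^sub>v y i) \<bullet> w0 = 0"
    using underdetermined_nonzero_solution[of k m "\<lambda>i. B *\<^sub>v y i"] Suc.prems By by (metis Suc_le_eq)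
  \<comment> \<open>Euclidean orthogonality to \<open>B *\<^sub>v y i\<close> is
    \<open>B\<close>-orthogonality to \<open>y i\<close>.\<close>
  define F where "F = (\<lambda>i. B *\<^sub>v y i) ` {..<k}"
  obtain x c where x: "x \<in> carrier_vec m" "x \<noteq> 0\<^sub>v m" and xF: "\<forall>f\<in>F. f \<bullet> x = 0"
    and xc: "x \<bullet> (M *\<^sub>v x) = c * (x \<bullet> (B *\<^sub>v x))"
    and min: "\<And>w. w \<in> carrier_vec m \<Longrightarrow> \<forall>f\<in>F. f \<bullet> w = 0 \<Longrightarrow> c * (w \<bullet> (B *\<^sub>v w)) \<le> w \<bullet> (M *\<^sub>v w)"
    using rayleigh_minimizer[OF M(1) B(1) pos, of F w0] w0 By by (auto simp: F_def) blast
  define g where "g = M *\<^sub>v x - c \<cdot>\<^sub>v (B *\<^sub>v x)"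
  have g: "g \<in> carrier_vec m" using M B x by (simp add: g_def)
  have wg: "w \<bullet> g = w \<bullet> (M *\<^sub>v x) - c * (w \<bullet> (B *\<^sub>v x))" if "w \<in> carrier_vec m" for w
    using that M B x by (simp add: g_def scalar_prod_minus_distrib)
  have gW: "w \<bullet> g = 0" if w: "w \<in> carrier_vec m" "\<forall>f\<in>F. f \<bullet> w = 0" for w
  proof (rule linear_term_zero[where c = "w \<bullet> (M *\<^sub>v w) - c * (w \<bullet> (B *\<^sub>v w))"])
    fix t
    note q = quadratic_form_expand[OF _ _ x(1) w(1)]
    have "\<forall>f\<in>F. f \<bullet> (x + t \<cdot>\<^sub>v w) = 0" 
    proof
      fix f assume f: "f \<in> F"
      then have "f \<in> carrier_vec m" using By by (auto simp: F_def)
      then show "f \<bullet> (x + t \<cdot>\<^sub>v w) = 0" using f w xF x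
        by (simp add: scalar_prod_add_distrib[of _ m] scalar_prod_smult_right)
    qed
    then have "c * (x \<bullet> (B *\<^sub>v x) + 2 * t * (w \<bullet> (B *\<^sub>v x)) + t\<^sup>2 * (w \<bullet> (B *\<^sub>v w)))
      \<le> c * (x \<bullet> (B *\<^sub>v x)) + 2 * t * (w \<bullet> (M *\<^sub>v x)) + t\<^sup>2 * (w \<bullet> (M *\<^sub>v w))"
      using min[of "x + t \<cdot>\<^sub>v w"] x w unfolding q[OF M] q[OF B] xc by fastforce
    then have "0 \<le> 2 * t * (w \<bullet> (M *\<^sub>v x)) + t\<^sup>2 * (w \<bullet> (M *\<^sub>v w)) -
        c * (2 * t * (w \<bullet> (B *\<^sub>v x)) + t\<^sup>2 * (w \<bullet> (B *\<^sub>v w)))"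
      unfolding distrib_left by linarith
    also have "\<dots> = 2 * t * (w \<bullet> g) + t\<^sup>2 * (w \<bullet> (M *\<^sub>v w) - c * (w \<bullet> (B *\<^sub>v w)))"
      unfolding wg[OF w(1)] by (rule quadratic_difference)
    finally show "0 \<le> 2 * t * (w \<bullet> g) + t\<^sup>2 * (w \<bullet> (M *\<^sub>v w) - c * (w \<bullet> (B *\<^sub>v w)))" .
  qed
  \<comment> \<open>\<open>h\<close> represents the residual \<open>g\<close> in the
    \<open>B\<close>-inner product. It is itself admissible, since \<open>y i\<close> is an
    eigenvector and \<open>x\<close> is \<open>B\<close>-orthogonal to it; testing \<open>g\<close>
    against \<open>h\<close> therefore gives zero \<open>B\<close>-energy of \<open>h\<close>, and
    so \<open>g\<close> vanishes.\<close>
  define h where "h = the (mat_inverse B) *\<^sub>v g"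
  note inv = spd_inverse[OF spd]
  have h: "h \<in> carrier_vec m" "B *\<^sub>v h = g"
    using g inv B by (auto simp: h_def assoc_mult_mat_vec[symmetric, of _ m m _ m])
  have "\<forall>f\<in>F. f \<bullet> h = 0"
  proof (clarsimp simp: F_def)
    fix i assume i: "i < k"
    have sw: "(B *\<^sub>v y i) \<bullet> x = y i \<bullet> (B *\<^sub>v x)" "(B *\<^sub>v y i) \<bullet> h = y i \<bullet> (B *\<^sub>v h)"
      using symmetric_form[OF B _ y[OF i]] x h By[OF i] by (metis comm_scalar_prod)+
    have "(B *\<^sub>v y i) \<bullet> h = y i \<bullet> g" using sw h by simp
    also have "\<dots> = y i \<bullet> (M *\<^sub>v x)" using wg[OF y[OF i]] xF i sw by (simp add: F_def)
    also have "\<dots> = x \<bullet> (M *\<^sub>v y i)" using symmetric_form[OF M] x y[OF i] by simp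
    also have "\<dots> = l i * (x \<bullet> (B *\<^sub>v y i))" using ev[OF i] x By[OF i] by simp
    also have "\<dots> = 0" using symmetric_form[OF B] x y[OF i] xF i sw by (simp add: F_def)
    finally show "(B *\<^sub>v y i) \<bullet> h = 0" .
  qed
  then have "h \<bullet> (B *\<^sub>v h) = 0" using gW h by simp
  then have "h = 0\<^sub>v m" using pos[OF h(1)] by force
  then have "g = 0\<^sub>v m" using h B by auto
  have Mx: "M *\<^sub>v x = c \<cdot>\<^sub>v (B *\<^sub>v x)"
  proof (rule eq_vecI)
    fix i assume "i < dim_vec (c \<cdot>\<^sub>v (B *\<^sub>v x))"
    then have "vec_index g i = vec_index (M *\<^sub>v x) i - vec_index (c \<cdot>\<^sub>v (B *\<^sub>v x)) i" "i < m"
      using B M by (auto simp: g_def)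
    then show "vec_index (M *\<^sub>v x) i = vec_index (c \<cdot>\<^sub>v (B *\<^sub>v x)) i" using \<open>g = 0\<^sub>v m\<close> by simp
  qed (use M B in auto)
  define r where "r = x \<bullet> (B *\<^sub>v x)"
  have r: "r > 0" using pos x by (simp add: r_def)
  define z where "z = (1 / sqrt r) \<cdot>\<^sub>v x"
  have z: "z \<in> carrier_vec m" using x by (simp add: z_def)
  have Bz: "B *\<^sub>v z = (1 / sqrt r) \<cdot>\<^sub>v (B *\<^sub>v x)" and Mz: "M *\<^sub>v z = (1 / sqrt r) \<cdot>\<^sub>v (M *\<^sub>v x)"
    using B M x by (simp_all add: z_def mult_mat_vec[of _ m m])
  have zz: "z \<bullet> (B *\<^sub>v z) = 1" using r B x unfolding Bz by (simp add: z_def r_def[symmetric])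
  have evz: "M *\<^sub>v z = c \<cdot>\<^sub>v (B *\<^sub>v z)" unfolding Mz Mx Bz by (simp add: smult_smult_assoc mult.commute)
  have zy: "y i \<bullet> (B *\<^sub>v z) = 0" "z \<bullet> (B *\<^sub>v y i) = 0" if i: "i < k" for i
  proof -
    have "x \<bullet> (B *\<^sub>v y i) = 0" using xF i x By[OF i] comm_scalar_prod[of x m "B *\<^sub>v y i"] by (simp add: F_def)
    then show "z \<bullet> (B *\<^sub>v y i) = 0" using x By[OF i] by (simp add: z_def)
    then show "y i \<bullet> (B *\<^sub>v z) = 0" using symmetric_form[OF B] y[OF i] z by metis
  qed
  show ?case
    by (rule exI[of _ "y(k := z)"], rule exI[of _ "l(k := c)"]) (auto simp: less_Suc_eq y ev orth z evz zz zy)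
qed

lemma transpose_form:
  fixes P :: "'a :: comm_ring_1 mat"
  assumes "P \<in> carrier_mat r c" "x \<in> carrier_vec c" "y \<in> carrier_vec r"
  shows "(P *\<^sub>v x) \<bullet> y = x \<bullet> (transpose_mat P *\<^sub>v y)"
  using transpose_vec_mult_scalar[OF assms] assms
  by (metis comm_scalar_prod mult_mat_vec_carrier transpose_carrier_mat)

lemma mat_diag_mult_vec:
  fixes f :: "nat \<Rightarrow> 'a :: semiring_0"
  assumes "v \<in> carrier_vec n"
  shows "mat_diag n f *\<^sub>v v = Matrix.vec n (\<lambda>i. f i * vec_index v i)"
proof (rule eq_vecI)
  fix i assume "i < dim_vec (Matrix.vec n (\<lambda>i. f i * vec_index v i))"
  then have i: "i < n" by simp
  have "vec_index (mat_diag n f *\<^sub>v v) i = (\<Sum>j<n. (if i = j then f j else 0) * vec_index v j)"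
    using i assms by (auto simp: mat_diag_def scalar_prod_def atLeast0LessThan intro!: sum.cong)
  also have "\<dots> = (\<Sum>j<n. if i = j then f j * vec_index v j else 0)" by (intro sum.cong) auto
  finally show "vec_index (mat_diag n f *\<^sub>v v) i = vec_index (Matrix.vec n (\<lambda>i. f i * vec_index v i)) i"
    using i by simp
qed (simp add: mat_diag_def)

lemma transpose_mat_diag: "transpose_mat (mat_diag n f) = mat_diag n f"
  by (rule eq_matI) (auto simp: mat_diag_def)

text \<open>The columns of \<open>P\<close> are the \<open>B\<close>-orthonormal eigenvectors.
  Orthonormality is one inverse relation between square matrices; the reversed one, which holds
  automatically, expresses completeness of the eigenbasis.\<close>

lemma pencil_diagonalization:
  fixes M B :: "real mat"
  assumes M: "M \<in> carrier_mat m m" "transpose_mat M = M" and spd: "spd m B"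
  obtains P l where "P \<in> carrier_mat m m" "transpose_mat P * (B * P) = 1\<^sub>m m" "B * P * transpose_mat P = 1\<^sub>m m"
    "M * P = B * P * mat_diag m l"
    "\<And>k. k < m \<Longrightarrow> M *\<^sub>v col P k = l k \<cdot>\<^sub>v (B *\<^sub>v col P k)"
proof -
  note B = spdD(1,2)[OF spd]
  from pencil_eigenvectors[OF M spd order_refl] obtain y l
    where yl: "\<forall>i<m. y i \<in> carrier_vec m \<and> M *\<^sub>v y i = l i \<cdot>\<^sub>v (B *\<^sub>v y i)"
      and orth: "\<forall>i<m. \<forall>j<m. y i \<bullet> (B *\<^sub>v y j) = (if i = j then 1 else 0)"
    by (elim exE conjE)
  have y: "y i \<in> carrier_vec m" if "i < m" for i using yl that by blast
  define P where "P = Matrix.mat m m (\<lambda>(i, j). vec_index (y j) i)"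
  define L where "L = mat_diag m l"
  have P: "P \<in> carrier_mat m m" by (simp add: P_def)
  have L: "L \<in> carrier_mat m m" by (simp add: L_def)
  have BP: "B * P \<in> carrier_mat m m" using B P by simp
  have colP: "col P j = y j" if "j < m" for j using that y[OF that] by (auto simp: P_def)
  have colBP: "col (B * P) j = B *\<^sub>v y j" if "j < m" for j using col_mult2[OF B(1) P that] colP[OF that] by simp
  have 1: "transpose_mat P * (B * P) = 1\<^sub>m m"
  proof (rule eq_matI)
    fix i j assume ij: "i < dim_row (1\<^sub>m m :: real mat)" "j < dim_col (1\<^sub>m m :: real mat)"
    then have "(transpose_mat P * (B * P)) $$ (i, j) = col P i \<bullet> col (B * P) j" using P BP by simp
    also have "\<dots> = 1\<^sub>m m $$ (i, j)" using ij by (simp add: colP colBP orth)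
    finally show "(transpose_mat P * (B * P)) $$ (i, j) = 1\<^sub>m m $$ (i, j)" .
  qed (use P BP in auto)
  have 2: "B * P * transpose_mat P = 1\<^sub>m m" using mat_mult_left_right_inverse[OF _ BP 1] P by simp
  have 3: "M * P = B * P * L"
  proof (rule eq_matI)
    fix i j assume "i < dim_row (B * P * L)" "j < dim_col (B * P * L)"
    then have ij: "i < m" "j < m" using B L by auto
    have "(M * P) $$ (i, j) = vec_index (M *\<^sub>v y j) i" using ij M P colP by simp
    also have "\<dots> = l j * vec_index (B *\<^sub>v y j) i" using yl ij B by simp
    also have "\<dots> = (B * P) $$ (i, j) * l j" using ij B P colP by simp
    also have "\<dots> = (B * P * L) $$ (i, j)" unfolding L_def mat_diag_mult_right[OF BP] using ij by simp
    finally show "(M * P) $$ (i, j) = (B * P * L) $$ (i, j)" .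
  qed (use M B P L in auto)
  show thesis
    by (rule that[OF P 1 2 3[unfolded L_def]]) (use yl colP in simp)
qed

text \<open>In eigencoordinates the orthogonality hypothesis removes every component of
  \<open>r\<close> below \<tau>. On the remaining ones division by an eigenvalue that is at least
  \<tau> both solves the equation and gives the energy comparison term by term.\<close>

lemma high_frequency_solution:
  fixes M B :: "real mat"
  assumes M: "M \<in> carrier_mat m m" "transpose_mat M = M" and spd: "spd m B"
    and \<tau>: "0 < \<tau>" and r: "r \<in> carrier_vec m"
    and orth: "\<And>y ev. y \<in> carrier_vec m \<Longrightarrow> ev < \<tau> \<Longrightarrow> M *\<^sub>v y = ev \<cdot>\<^sub>v (B *\<^sub>v y) \<Longrightarrow> y \<bullet> r = 0"
  obtains z where "z \<in> carrier_vec m" "M *\<^sub>v z = r" "\<tau> * (z \<bullet> (B *\<^sub>v z)) \<le> z \<bullet> (M *\<^sub>v z)"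
proof -
  note B = spdD(1,2)[OF spd]
  obtain P l where P: "P \<in> carrier_mat m m" and PBP: "transpose_mat P * (B * P) = 1\<^sub>m m"
    and BPP: "B * P * transpose_mat P = 1\<^sub>m m"
    and MP: "M * P = B * P * mat_diag m l"
    and ev: "\<And>k. k < m \<Longrightarrow> M *\<^sub>v col P k = l k \<cdot>\<^sub>v (B *\<^sub>v col P k)"
    using pencil_diagonalization[OF M spd] by blast
  define L where "L = mat_diag m l"
  define c where "c = transpose_mat P *\<^sub>v r"
  \<comment> \<open>For \<open>l k = 0\<close> the division returns 0. This is the right value: such
    a \<open>k\<close> lies below \<tau>, where the coordinate \<open>c\<close> of \<open>r\<close>
    is zero.\<close>
  define d where "d = Matrix.vec m (\<lambda>k. vec_index c k / l k)"
  define z where "z = P *\<^sub>v d"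
  have car: "L \<in> carrier_mat m m" "B * P \<in> carrier_mat m m" "c \<in> carrier_vec m" "d \<in> carrier_vec m" "z \<in> carrier_vec m"
    "transpose_mat P \<in> carrier_mat m m" "B *\<^sub>v z \<in> carrier_vec m" "M *\<^sub>v z \<in> carrier_vec m"
    using P B M r by (auto simp: L_def c_def d_def z_def)
  have c0: "vec_index c k = 0" if "k < m" "l k < \<tau>" for k
  proof -
    have "col P k \<bullet> r = 0" using orth[OF _ that(2) ev[OF that(1)]] P that by auto
    then show ?thesis using that P by (simp add: c_def)
  qed
  have Ld: "L *\<^sub>v d = c"
  proof (rule eq_vecI)
    fix k assume "k < dim_vec c"
    then have k: "k < m" using car by simp
    have "vec_index (L *\<^sub>v d) k = l k * vec_index d k"
      using k car by (simp add: L_def mat_diag_mult_vec)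
    also have "\<dots> = vec_index c k" using k c0[of k] \<tau> by (cases "l k = 0") (auto simp: d_def)
    finally show "vec_index (L *\<^sub>v d) k = vec_index c k" .
  qed (use car in auto)
  have Bz: "B *\<^sub>v z = (B * P) *\<^sub>v d" using B P car by (simp add: z_def)
  have "M *\<^sub>v z = (M * P) *\<^sub>v d" using M P car by (simp add: z_def)
  also have "\<dots> = (B * P) *\<^sub>v (L *\<^sub>v d)" unfolding MP L_def[symmetric] using car by simp
  finally have Mz: "M *\<^sub>v z = (B * P) *\<^sub>v c" unfolding Ld .
  have "(B * P) *\<^sub>v c = (B * P * transpose_mat P) *\<^sub>v r" using car r by (simp add: c_def)
  then have Mzr: "M *\<^sub>v z = r" using Mz r by (simp add: BPP)
  \<comment> \<open>Pairings with \<open>z\<close> become dot products of coordinates;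
    \<open>e = d\<close> gives the \<open>B\<close>-energy and \<open>e = c\<close> the
    \<open>M\<close>-energy.\<close>
  have form: "z \<bullet> ((B * P) *\<^sub>v e) = (\<Sum>k<m. vec_index d k * vec_index e k)" if e: "e \<in> carrier_vec m" for e
  proof -
    have "z \<bullet> ((B * P) *\<^sub>v e) = d \<bullet> (transpose_mat P *\<^sub>v ((B * P) *\<^sub>v e))"
      unfolding z_def by (rule transpose_form[OF P]) (use car e in auto)
    also have "transpose_mat P *\<^sub>v ((B * P) *\<^sub>v e) = (transpose_mat P * (B * P)) *\<^sub>v e" using car e by simp
    finally show ?thesis using e by (simp add: PBP scalar_prod_def atLeast0LessThan)
  qed
  have "\<tau> * (z \<bullet> (B *\<^sub>v z)) = (\<Sum>k<m. \<tau> * (vec_index d k * vec_index d k))"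
    unfolding Bz form[OF car(4)] by (simp add: sum_distrib_left)
  also have "\<dots> \<le> (\<Sum>k<m. vec_index d k * vec_index c k)"
  proof (rule sum_mono)
    fix k assume "k \<in> {..<m}"
    then have k: "k < m" by simp
    show "\<tau> * (vec_index d k * vec_index d k) \<le> vec_index d k * vec_index c k"
    proof (cases "l k < \<tau>")
      case True then show ?thesis using c0[OF k] k by (simp add: d_def)
    next
      case False
      then have "vec_index c k = l k * vec_index d k" using \<tau> k by (simp add: d_def)
      moreover have "\<tau> * (vec_index d k * vec_index d k) \<le> l k * (vec_index d k * vec_index d k)"
        using False by (intro mult_right_mono) auto
      ultimately show ?thesis by (simp add: mult_ac)
    qed
  qed
  also have "\<dots> = z \<bullet> (M *\<^sub>v z)" unfolding Mz form[OF car(3)] ..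
  finally show thesis using that car(5) Mzr by blast
qed

section \<open>The Moore-Penrose inverse of a symmetric matrix\<close>

lemma is_pinvD:
  assumes "is_pinv B X"
  shows "X \<in> carrier_mat (dim_col B) (dim_row B)" "B * X * B = B" "X * B * X = X"
    "transpose_mat (B * X) = B * X" "transpose_mat (X * B) = X * B"
  using assms unfolding is_pinv_def by blast+

text \<open>For any Penrose inverse \<open>X\<close>, \<open>B * X\<close> is the orthogonal
  projection onto the range of \<open>B\<close>, so it does not depend on \<open>X\<close>; likewise
  for \<open>X * B\<close>. Then X = X B X = X B Y = Y B Y = Y.\<close>

lemma is_pinv_unique:
  assumes X: "is_pinv B X" and Y: "is_pinv B Y"
  shows "X = Y"
proof -
  define r c where "r = dim_row B" and "c = dim_col B"
  have B: "B \<in> carrier_mat r c" by (simp add: r_def c_def)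
  have Xc: "X \<in> carrier_mat c r" and Yc: "Y \<in> carrier_mat c r" using is_pinvD(1)[OF X] is_pinvD(1)[OF Y] by (simp_all add: r_def c_def)
  have half: "B * X = B * Y" if "is_pinv B X" "is_pinv B Y" for X Y
  proof -
    have car: "X \<in> carrier_mat c r" "Y \<in> carrier_mat c r"
      using that[THEN is_pinvD(1)] by (simp_all add: r_def c_def)
    have car': "B * X \<in> carrier_mat r r" "B * Y \<in> carrier_mat r r"
      using B car by (auto intro: mult_carrier_mat)
    have "B * X = (B * Y * B) * X" by (simp only: that[THEN is_pinvD(2)] that[THEN is_pinvD(4)])
    also have "\<dots> = (B * Y) * (B * X)" by (rule assoc_mult_mat[OF car'(2) B car(1)])
    also have "\<dots> = transpose_mat (B * Y) * transpose_mat (B * X)" by (simp only: that[THEN is_pinvD(2)] that[THEN is_pinvD(4)])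
    also have "\<dots> = transpose_mat ((B * X) * (B * Y))" by (rule transpose_mult[OF car'(1,2), symmetric])
    also have "(B * X) * (B * Y) = (B * X * B) * Y" by (rule assoc_mult_mat[OF car'(1) B car(2), symmetric])
    also have "\<dots> = B * Y" by (simp only: that[THEN is_pinvD(2)] that[THEN is_pinvD(4)])
    also have "transpose_mat \<dots> = \<dots>" by (rule is_pinvD(4)[OF that(2)])
    finally show ?thesis .
  qed
  have BX: "B * X = B * Y" by (rule half[OF X Y])
  have XBc: "X * B \<in> carrier_mat c c" "Y * B \<in> carrier_mat c c" using B Xc Yc by auto
  have "X * B = X * (B * Y * B)" by (simp only: is_pinvD(2)[OF Y])
  also have "B * Y * B = B * (Y * B)" by (rule assoc_mult_mat[OF B Yc B])
  also have "X * (B * (Y * B)) = (X * B) * (Y * B)" by (rule assoc_mult_mat[OF Xc B XBc(2), symmetric])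
  also have "\<dots> = transpose_mat (X * B) * transpose_mat (Y * B)" by (simp only: is_pinvD(5)[OF X] is_pinvD(5)[OF Y])
  also have "\<dots> = transpose_mat ((Y * B) * (X * B))" by (rule transpose_mult[OF XBc(2,1), symmetric])
  also have "(Y * B) * (X * B) = Y * (B * (X * B))" by (rule assoc_mult_mat[OF Yc B XBc(1)])
  also have "B * (X * B) = B * X * B" by (rule assoc_mult_mat[OF B Xc B, symmetric])
  also have "Y * (B * X * B) = Y * B" by (simp only: is_pinvD(2)[OF X])
  also have "transpose_mat (Y * B) = Y * B" by (rule is_pinvD(5)[OF Y])
  finally have XB: "X * B = Y * B" .
  have "X = X * B * X" by (rule is_pinvD(3)[OF X, symmetric])
  also have "\<dots> = X * (B * Y)" unfolding BX[symmetric] by (rule assoc_mult_mat[OF Xc B Xc])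
  also have "\<dots> = X * B * Y" by (rule assoc_mult_mat[OF Xc B Yc, symmetric])
  also have "\<dots> = Y" unfolding XB by (rule is_pinvD(3)[OF Y])
  finally show ?thesis .
qed

text \<open>The pencil with the identity is the ordinary spectral theorem. Inverting the nonzero
  eigenvalues exhibits a Penrose inverse, so that the definite description in \<open>pinv\<close>
  denotes it and its symmetry can be read off.\<close>

lemma pinv_symmetric:
  fixes K :: "real mat"
  assumes K: "K \<in> carrier_mat m m" "transpose_mat K = K"
  shows "pinv K \<in> carrier_mat m m" "K * pinv K * K = K" "transpose_mat (pinv K) = pinv K"
proof -
  have pos: "0 < x \<bullet> (1\<^sub>m m *\<^sub>v x)" if x: "x \<in> carrier_vec m" "x \<noteq> 0\<^sub>v m" for x :: "real Matrix.vec"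
  proof -
    obtain i where "i < m" "vec_index x i \<noteq> 0" using x by (metis carrier_vecD eq_vecI index_zero_vec(1) zero_carrier_vec)
    then have "0 < (\<Sum>i<m. vec_index x i * vec_index x i)"
      by (intro sum_pos2[of _ i]) (auto simp: zero_less_mult_iff linorder_neq_iff)
    then show ?thesis using x by (simp add: scalar_prod_def atLeast0LessThan)
  qed
  then have one: "spd m (1\<^sub>m m)" by (simp add: spd_def)
  obtain P l where P: "P \<in> carrier_mat m m" and PP: "transpose_mat P * (1\<^sub>m m * P) = 1\<^sub>m m"
    and PP': "1\<^sub>m m * P * transpose_mat P = 1\<^sub>m m"
    and KP: "K * P = 1\<^sub>m m * P * mat_diag m l"
    and "\<And>k. k < m \<Longrightarrow> K *\<^sub>v col P k = l k \<cdot>\<^sub>v (1\<^sub>m m *\<^sub>v col P k)"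
    by (rule pencil_diagonalization[OF K one]) (rule that; assumption)
  define dg where "dg g = mat_diag m g" for g :: "nat \<Rightarrow> real"
  define Q where "Q = transpose_mat P"
  \<comment> \<open>Functional calculus: since \<open>P\<close> is orthogonal, products of such
    matrices correspond to pointwise products of eigenvalue functions.\<close>
  define cj where "cj g = P * (dg g * Q)" for g
  have dg: "dg g \<in> carrier_mat m m" for g by (simp add: dg_def)
  have Q: "Q \<in> carrier_mat m m" using P by (simp add: Q_def)
  have QP: "Q * P = 1\<^sub>m m" and PQ: "P * Q = 1\<^sub>m m" using PP PP' P by (simp_all add: Q_def)
  have cj: "cj g \<in> carrier_mat m m" for g using P Q dg[of g] by (simp add: cj_def)
  have dg_mult: "dg g * dg h = dg (\<lambda>i. g i * h i)" for g h by (simp add: dg_def)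
  have dgt: "transpose_mat (dg g) = dg g" for g by (simp add: dg_def transpose_mat_diag)
  have cjt: "transpose_mat (cj g) = cj g" for g
  proof -
    have "transpose_mat (cj g) = transpose_mat (dg g * Q) * Q"
      using transpose_mult[of P m m "dg g * Q" m] P Q dg[of g] by (simp add: cj_def Q_def)
    also have "transpose_mat (dg g * Q) = P * dg g"
      using transpose_mult[OF dg[of g] Q] by (simp add: Q_def dgt)
    finally show ?thesis using assoc_mult_mat[OF P dg[of g] Q] by (simp add: cj_def)
  qed
  have cjm: "cj g * cj h = cj (\<lambda>i. g i * h i)" for g h
  proof -
    have a: "dg h * Q \<in> carrier_mat m m" "dg g * Q \<in> carrier_mat m m" using mult_carrier_mat[OF dg Q] by auto
    have PQ': "P * (dg h * Q) \<in> carrier_mat m m" using mult_carrier_mat[OF P a(1)] .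
    have "cj g * cj h = P * ((dg g * Q) * (P * (dg h * Q)))"
      unfolding cj_def by (rule assoc_mult_mat[OF P a(2) PQ'])
    also have "(dg g * Q) * (P * (dg h * Q)) = dg g * (Q * (P * (dg h * Q)))"
      by (rule assoc_mult_mat[OF dg Q PQ'])
    also have "Q * (P * (dg h * Q)) = (Q * P) * (dg h * Q)"
      by (rule assoc_mult_mat[OF Q P a(1), symmetric])
    also have "\<dots> = dg h * Q" unfolding QP by (rule left_mult_one_mat[OF a(1)])
    also have "dg g * (dg h * Q) = (dg g * dg h) * Q"
      by (rule assoc_mult_mat[OF dg dg Q, symmetric])
    finally show ?thesis by (simp add: dg_mult cj_def)
  qed
  have Kcj: "K = cj l"
  proof -
    have "K = K * (P * Q)" using K by (simp add: PQ)
    also have "\<dots> = (K * P) * Q" by (rule assoc_mult_mat[OF K(1) P Q, symmetric])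
    also have "K * P = P * dg l" using KP P by (simp add: dg_def)
    also have "P * dg l * Q = cj l" using assoc_mult_mat[OF P dg[of l] Q] by (simp add: cj_def)
    finally show ?thesis .
  qed
  \<comment> \<open>With \<open>inverse 0 = 0\<close> the Penrose identities hold at zero
    eigenvalues as well.\<close>
  have "x * inverse x * x = x" "inverse x * x * inverse x = inverse x" for x :: real by (cases "x = 0"; simp)+
  then have l: "(\<lambda>i. l i * inverse (l i) * l i) = l" "(\<lambda>i. inverse (l i) * l i * inverse (l i)) = (\<lambda>i. inverse (l i))"
    by blast+
  have pinvK: "is_pinv K (cj (\<lambda>i. inverse (l i)))"
    unfolding is_pinv_def Kcj cjm cjt l using cj[of l] cj[of "\<lambda>i. inverse (l i)"] by auto
  then have "\<exists>!X. is_pinv K X" using is_pinv_unique by blast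
  then have pK: "is_pinv K (pinv K)" unfolding pinv_def by (rule theI')
  show c: "pinv K \<in> carrier_mat m m" and KXK: "K * pinv K * K = K" using is_pinvD(1,2)[OF pK] K by simp_all
  have "pinv K = cj (\<lambda>i. inverse (l i))" using is_pinv_unique pK pinvK by blast
  then show "transpose_mat (pinv K) = pinv K" by (simp add: cjt)
qed

section \<open>The abstract Neumann-Neumann preconditioner\<close>

definition vsum :: "nat \<Rightarrow> ('b \<Rightarrow> real Matrix.vec) \<Rightarrow> 'b set \<Rightarrow> real Matrix.vec" where
  "vsum n f I = Matrix.vec n (\<lambda>i. \<Sum>s\<in>I. vec_index (f s) i)"

lemma vsum_carrier [simp]: "vsum n f I \<in> carrier_vec n"
  by (simp add: vsum_def)

lemma scalar_prod_vsum:
  assumes "x \<in> carrier_vec n" "\<And>s. s \<in> I \<Longrightarrow> f s \<in> carrier_vec n"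
  shows "x \<bullet> vsum n f I = (\<Sum>s\<in>I. x \<bullet> f s)"
proof -
  have "x \<bullet> vsum n f I = (\<Sum>i<n. \<Sum>s\<in>I. vec_index x i * vec_index (f s) i)"
    by (simp add: vsum_def scalar_prod_def atLeast0LessThan sum_distrib_left)
  also have "\<dots> = (\<Sum>s\<in>I. \<Sum>i<n. vec_index x i * vec_index (f s) i)" by (rule sum.swap)
  also have "\<dots> = (\<Sum>s\<in>I. x \<bullet> f s)"
    using assms(2)[THEN carrier_vecD] by (simp add: scalar_prod_def atLeast0LessThan)
  finally show ?thesis .
qed

lemma form_vsum:
  fixes A :: "real mat"
  assumes A: "A \<in> carrier_mat n n" "transpose_mat A = A"
    and f: "\<And>s. s \<in> I \<Longrightarrow> f s \<in> carrier_vec n" and g: "\<And>s. s \<in> J \<Longrightarrow> g s \<in> carrier_vec n"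
  shows "vsum n f I \<bullet> (A *\<^sub>v vsum n g J) = (\<Sum>s\<in>I. \<Sum>t\<in>J. f s \<bullet> (A *\<^sub>v g t))"
proof -
  have "vsum n f I \<bullet> (A *\<^sub>v vsum n g J) = (A *\<^sub>v vsum n g J) \<bullet> vsum n f I"
    by (rule comm_scalar_prod[of _ n]) (use A in auto)
  also have "\<dots> = (\<Sum>s\<in>I. (A *\<^sub>v vsum n g J) \<bullet> f s)"
    by (rule scalar_prod_vsum) (use A f in auto)
  also have "\<dots> = (\<Sum>s\<in>I. \<Sum>t\<in>J. f s \<bullet> (A *\<^sub>v g t))"
  proof (rule sum.cong[OF refl])
    fix s assume s: "s \<in> I"
    have "(A *\<^sub>v vsum n g J) \<bullet> f s = f s \<bullet> (A *\<^sub>v vsum n g J)"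
      by (rule comm_scalar_prod[of _ n]) (use A f s in auto)
    also have "\<dots> = vsum n g J \<bullet> (A *\<^sub>v f s)"
      by (rule symmetric_form[OF A]) (use f s in auto)
    also have "\<dots> = (A *\<^sub>v f s) \<bullet> vsum n g J"
      by (rule comm_scalar_prod[of _ n]) (use A f s in auto)
    also have "\<dots> = (\<Sum>t\<in>J. (A *\<^sub>v f s) \<bullet> g t)"
      by (rule scalar_prod_vsum) (use A f g s in auto)
    also have "\<dots> = (\<Sum>t\<in>J. f s \<bullet> (A *\<^sub>v g t))"
    proof (rule sum.cong[OF refl])
      fix t assume t: "t \<in> J"
      have "(A *\<^sub>v f s) \<bullet> g t = g t \<bullet> (A *\<^sub>v f s)"
        by (rule comm_scalar_prod[of _ n]) (use A f g s t in auto)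
      also have "\<dots> = f s \<bullet> (A *\<^sub>v g t)"
        by (rule symmetric_form[OF A]) (use f g s t in auto)
      finally show "(A *\<^sub>v f s) \<bullet> g t = f s \<bullet> (A *\<^sub>v g t)" .
    qed
    finally show "(A *\<^sub>v vsum n g J) \<bullet> f s = (\<Sum>t\<in>J. f s \<bullet> (A *\<^sub>v g t))" .
  qed
  finally show ?thesis .
qed

text \<open>Within a color all cross terms vanish, so the energy of a color sum is the sum of the
  energies. Between colors the semi-definite form costs at most the number of colors. The function
  \<open>c\<close> assigns one color to each index, which makes the classes disjoint.\<close>

lemma coloring_bound:
  fixes A :: "real mat"
  assumes A: "A \<in> carrier_mat n n" "transpose_mat A = A"
    and psd: "\<And>x. x \<in> carrier_vec n \<Longrightarrow> 0 \<le> x \<bullet> (A *\<^sub>v x)"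
    and fin: "finite I" and f: "\<And>s. s \<in> I \<Longrightarrow> f s \<in> carrier_vec n"
    and c: "\<And>s. s \<in> I \<Longrightarrow> c s \<in> {1..Nc}"
    and orth: "\<And>s t. s \<in> I \<Longrightarrow> t \<in> I \<Longrightarrow> s \<noteq> t \<Longrightarrow> c s = c t \<Longrightarrow> f s \<bullet> (A *\<^sub>v f t) = 0"
  shows "vsum n f I \<bullet> (A *\<^sub>v vsum n f I) \<le> real Nc * (\<Sum>s\<in>I. f s \<bullet> (A *\<^sub>v f s))"
proof -
  define J where "J i = {s \<in> I. c s = i}" for i
  define F where "F i = vsum n f (J i)" for i
  define G where "G i j = F i \<bullet> (A *\<^sub>v F j)" for i j
  have Fc: "F i \<in> carrier_vec n" for i by (simp add: F_def)
  have Geq: "G i j = (\<Sum>s\<in>J i. \<Sum>t\<in>J j. f s \<bullet> (A *\<^sub>v f t))" for i j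
    unfolding G_def F_def by (rule form_vsum[OF A]) (auto simp: J_def f)
  have Gsym: "G i j = G j i" for i j unfolding G_def by (rule symmetric_form[OF A Fc Fc])
  have group: "(\<Sum>i\<in>{1..Nc}. sum h (J i)) = sum h I" for h :: "'a \<Rightarrow> real"
    unfolding J_def by (rule sum.group[OF fin]) (use c in auto)
  have Gle: "2 * G i j \<le> G i i + G j j" for i j
  proof -
    have "0 \<le> (F i + (-1) \<cdot>\<^sub>v F j) \<bullet> (A *\<^sub>v (F i + (-1) \<cdot>\<^sub>v F j))" by (rule psd) (use Fc in auto)
    also have "\<dots> = G i i + 2 * (-1) * G j i + (-1)\<^sup>2 * G j j"
      unfolding G_def by (rule quadratic_form_expand[OF A Fc Fc])
    finally show ?thesis using Gsym[of i j] by simp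
  qed
  have Gii: "G i i = (\<Sum>s\<in>J i. f s \<bullet> (A *\<^sub>v f s))" for i
    unfolding Geq
  proof (rule sum.cong[OF refl])
    fix s assume s: "s \<in> J i"
    have "(\<Sum>t\<in>J i. f s \<bullet> (A *\<^sub>v f t)) = (\<Sum>t\<in>J i. if t = s then f s \<bullet> (A *\<^sub>v f s) else 0)"
      using s by (intro sum.cong) (auto simp: J_def orth)
    then show "(\<Sum>t\<in>J i. f s \<bullet> (A *\<^sub>v f t)) = f s \<bullet> (A *\<^sub>v f s)" using s fin by (simp add: J_def)
  qed
  have "vsum n f I \<bullet> (A *\<^sub>v vsum n f I) = (\<Sum>s\<in>I. \<Sum>t\<in>I. f s \<bullet> (A *\<^sub>v f t))"
    by (rule form_vsum[OF A f f])
  also have "\<dots> = (\<Sum>i\<in>{1..Nc}. \<Sum>s\<in>J i. \<Sum>t\<in>I. f s \<bullet> (A *\<^sub>v f t))" by (rule group[symmetric])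
  also have "\<dots> = (\<Sum>i\<in>{1..Nc}. \<Sum>s\<in>J i. \<Sum>j\<in>{1..Nc}. \<Sum>t\<in>J j. f s \<bullet> (A *\<^sub>v f t))" by (simp only: group)
  also have "\<dots> = (\<Sum>i\<in>{1..Nc}. \<Sum>j\<in>{1..Nc}. G i j)"
    unfolding Geq by (rule sum.cong[OF refl], rule sum.swap)
  \<comment> \<open>Averaging the two diagonal energies over all ordered pairs of colors counts each
    energy \<open>Nc\<close> times; this is the origin of the factor.\<close>
  also have "\<dots> \<le> (\<Sum>i\<in>{1..Nc}. \<Sum>j\<in>{1..Nc}. (G i i + G j j) / 2)"
    using Gle by (intro sum_mono) (simp add: mult.commute)
  also have "\<dots> = real Nc * (\<Sum>i\<in>{1..Nc}. G i i)"
    by (simp add: sum.distrib add_divide_distrib sum_divide_distrib[symmetric] sum_distrib_left[symmetric])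
  also have "(\<Sum>i\<in>{1..Nc}. G i i) = (\<Sum>s\<in>I. f s \<bullet> (A *\<^sub>v f s))" unfolding Gii by (rule group)
  finally show ?thesis .
qed

section \<open>Diagonal scalings and finite sums of matrices\<close>

lemma inv_mat_diag:
  fixes f :: "nat \<Rightarrow> real"
  assumes "\<And>i. i < m \<Longrightarrow> f i \<noteq> 0"
  shows "inv_mat (mat_diag m f) = mat_diag m (\<lambda>i. inverse (f i))"
proof -
  let ?X = "mat_diag m (\<lambda>i. inverse (f i))" and ?D = "mat_diag m f"
  have X: "?X * ?D = 1\<^sub>m m" unfolding mat_diag_diag by (rule eq_matI) (auto simp: mat_diag_def assms)
  have ker: "x = 0\<^sub>v m" if x: "x \<in> carrier_vec m" "?D *\<^sub>v x = 0\<^sub>v m" for x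
  proof -
    have "x = (?X * ?D) *\<^sub>v x" unfolding X using x by simp
    also have "\<dots> = ?X *\<^sub>v (?D *\<^sub>v x)" by (rule assoc_mult_mat_vec[OF mat_diag_dim mat_diag_dim x(1)])
    also have "\<dots> = 0\<^sub>v m" unfolding x(2) mat_diag_mult_vec[OF zero_carrier_vec] by (rule eq_vecI) auto
    finally show ?thesis .
  qed
  have inv: "inv_mat ?D \<in> carrier_mat m m" "?D * inv_mat ?D = 1\<^sub>m m"
    by (rule mat_inverse_SomeE[of ?D m], rule mat_diag_dim, rule ker, assumption+)+
  have "inv_mat ?D = (?X * ?D) * inv_mat ?D" unfolding X using inv(1) by simp
  also have "\<dots> = ?X * (?D * inv_mat ?D)" by (rule assoc_mult_mat[OF mat_diag_dim mat_diag_dim inv(1)])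
  also have "\<dots> = ?X" by (simp only: inv(2) right_mult_one_mat[OF mat_diag_dim])
  finally show ?thesis .
qed

text \<open>Bridge from the algebraic \<open>finsum\<close> in the group of matrices to ordinary
  sums of reals.\<close>

lemma msum_entries:
  fixes F :: "nat \<Rightarrow> real mat"
  assumes "finite I" "\<And>s. s \<in> I \<Longrightarrow> F s \<in> carrier_mat n n"
  shows "msum n F I \<in> carrier_mat n n \<and> (\<forall>i<n. \<forall>j<n. msum n F I $$ (i, j) = (\<Sum>s\<in>I. F s $$ (i, j)))"
  using assms
proof (induction I)
  interpret V: abelian_group "module_mat TYPE(real) n n" by (rule abelian_group_mat)
  case empty
  show ?case using V.finsum_empty by (simp add: module_mat_simps)
next
  interpret V: abelian_group "module_mat TYPE(real) n n" by (rule abelian_group_mat)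
  case (insert x I)
  have "msum n F (insert x I) = F x + msum n F I"
    using insert V.finsum_insert[of I x F] by (simp add: module_mat_simps Pi_def)
  moreover have "F x \<in> carrier_mat n n" using insert by auto
  ultimately show ?case using insert by auto
qed

lemma form_double_sum:
  fixes X :: "'a :: comm_ring_1 mat"
  assumes "X \<in> carrier_mat m k" "x \<in> carrier_vec m" "y \<in> carrier_vec k"
  shows "x \<bullet> (X *\<^sub>v y) = (\<Sum>i<m. \<Sum>j<k. vec_index x i * X $$ (i, j) * vec_index y j)"
  using assms by (auto simp: scalar_prod_def sum_distrib_left atLeast0LessThan mult_ac intro!: sum.cong)

lemma msum_form:
  fixes F :: "nat \<Rightarrow> real mat"
  assumes I: "finite I" and F: "\<And>s. s \<in> I \<Longrightarrow> F s \<in> carrier_mat n n" and x: "x \<in> carrier_vec n" and y: "y \<in> carrier_vec n"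
  shows "x \<bullet> (msum n F I *\<^sub>v y) = (\<Sum>s\<in>I. x \<bullet> (F s *\<^sub>v y))"
proof -
  have S: "msum n F I \<in> carrier_mat n n" and e: "\<And>i j. i < n \<Longrightarrow> j < n \<Longrightarrow> msum n F I $$ (i, j) = (\<Sum>s\<in>I. F s $$ (i, j))"
    using msum_entries[of I F n, OF I F] by auto
  have "x \<bullet> (msum n F I *\<^sub>v y) = (\<Sum>i<n. \<Sum>j<n. \<Sum>s\<in>I. vec_index x i * F s $$ (i, j) * vec_index y j)"
    unfolding form_double_sum[OF S x y] by (simp add: e sum_distrib_left sum_distrib_right)
  also have "\<dots> = (\<Sum>i<n. \<Sum>s\<in>I. \<Sum>j<n. vec_index x i * F s $$ (i, j) * vec_index y j)"
    by (rule sum.cong[OF refl], rule sum.swap)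
  also have "\<dots> = (\<Sum>s\<in>I. \<Sum>i<n. \<Sum>j<n. vec_index x i * F s $$ (i, j) * vec_index y j)"
    by (rule sum.swap)
  also have "\<dots> = (\<Sum>s\<in>I. x \<bullet> (F s *\<^sub>v y))"
    using form_double_sum[OF F x y] by simp
  finally show ?thesis .
qed

text \<open>The interface between the finite elements and the spectral argument. Semi-definiteness
  of \<open>K s\<close> leaves room for subdomains with rigid motions. \<open>splitting\<close> is
  the assembly of \<open>A\<close> from Neumann matrices and \<open>pou\<close> the partition of
  unity, both tested with vectors, which is the form in which energies are summed.\<close>

locale neumann_neumann =
  fixes n :: nat and I :: "nat set" and m :: "nat \<Rightarrow> nat"
    and A :: "real mat" and R K D :: "nat \<Rightarrow> real mat" and d :: "nat \<Rightarrow> nat \<Rightarrow> real"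
  assumes fin: "finite I"
    and A: "spd n A"
    and R: "\<And>s. s \<in> I \<Longrightarrow> R s \<in> carrier_mat (m s) n"
    and K: "\<And>s. s \<in> I \<Longrightarrow> K s \<in> carrier_mat (m s) (m s)" "\<And>s. s \<in> I \<Longrightarrow> transpose_mat (K s) = K s"
    and Kpsd: "\<And>s x. s \<in> I \<Longrightarrow> x \<in> carrier_vec (m s) \<Longrightarrow> 0 \<le> x \<bullet> (K s *\<^sub>v x)"
    and D: "\<And>s. s \<in> I \<Longrightarrow> D s = mat_diag (m s) (d s)"
    and d: "\<And>s i. s \<in> I \<Longrightarrow> i < m s \<Longrightarrow> d s i \<noteq> 0"
    and L: "\<And>s. s \<in> I \<Longrightarrow> spd (m s) (R s * A * (R s)\<^sup>T)"
    and splitting: "\<And>x y. x \<in> carrier_vec n \<Longrightarrow> y \<in> carrier_vec n \<Longrightarrow>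
      x \<bullet> (A *\<^sub>v y) = (\<Sum>s\<in>I. (R s *\<^sub>v x) \<bullet> (K s *\<^sub>v (R s *\<^sub>v y)))"
    and pou: "\<And>x y. x \<in> carrier_vec n \<Longrightarrow> y \<in> carrier_vec n \<Longrightarrow>
      x \<bullet> y = (\<Sum>s\<in>I. (R s *\<^sub>v x) \<bullet> (D s *\<^sub>v (R s *\<^sub>v y)))"
begin

abbreviation "M s \<equiv> inv_mat (D s) * K s * inv_mat (D s)"
abbreviation "B s \<equiv> D s * pinv (K s) * D s"

lemma D_carrier: "s \<in> I \<Longrightarrow> D s \<in> carrier_mat (m s) (m s)"
  using D by simp

lemma D_inverse:
  assumes s: "s \<in> I"
  shows "inv_mat (D s) \<in> carrier_mat (m s) (m s)" "D s * inv_mat (D s) = 1\<^sub>m (m s)"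
    "inv_mat (D s) * D s = 1\<^sub>m (m s)" "transpose_mat (inv_mat (D s)) = inv_mat (D s)"
proof -
  have X: "inv_mat (D s) = mat_diag (m s) (\<lambda>i. inverse (d s i))"
    unfolding D[OF s] by (rule inv_mat_diag) (rule d[OF s])
  show "inv_mat (D s) \<in> carrier_mat (m s) (m s)" "transpose_mat (inv_mat (D s)) = inv_mat (D s)"
    by (simp_all add: X transpose_mat_diag)
  show "D s * inv_mat (D s) = 1\<^sub>m (m s)" "inv_mat (D s) * D s = 1\<^sub>m (m s)"
    unfolding X unfolding D[OF s] mat_diag_diag
    by (rule eq_matI, auto simp: mat_diag_def d[OF s])+
qed

lemma M_symmetric:
  assumes s: "s \<in> I"
  shows "M s \<in> carrier_mat (m s) (m s)" "transpose_mat (M s) = M s"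
proof -
  note Di = D_inverse[OF s]
  have KD: "K s * inv_mat (D s) \<in> carrier_mat (m s) (m s)" "inv_mat (D s) * K s \<in> carrier_mat (m s) (m s)"
    using K(1)[OF s] Di(1) by auto
  then show "M s \<in> carrier_mat (m s) (m s)" using Di(1) by auto
  have "transpose_mat (M s) = inv_mat (D s) * transpose_mat (inv_mat (D s) * K s)"
    using transpose_mult[OF KD(2) Di(1)] Di(4) by simp
  also have "transpose_mat (inv_mat (D s) * K s) = K s * inv_mat (D s)"
    using transpose_mult[OF Di(1) K(1)[OF s]] Di(4) K(2)[OF s] by simp
  also have "inv_mat (D s) * (K s * inv_mat (D s)) = M s"
    by (rule assoc_mult_mat[OF Di(1) K(1)[OF s] Di(1), symmetric])
  finally show "transpose_mat (M s) = M s" .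
qed

lemma M_vec:
  assumes s: "s \<in> I" and y: "y \<in> carrier_vec (m s)"
  shows "M s *\<^sub>v y = inv_mat (D s) *\<^sub>v (K s *\<^sub>v (inv_mat (D s) *\<^sub>v y))"
proof -
  note Di = D_inverse[OF s]
  have KD: "inv_mat (D s) * K s \<in> carrier_mat (m s) (m s)" using K(1)[OF s] Di(1) by auto
  have Dy: "inv_mat (D s) *\<^sub>v y \<in> carrier_vec (m s)" using Di(1) y by auto
  show ?thesis
    by (simp only: assoc_mult_mat_vec[OF KD Di(1) y] assoc_mult_mat_vec[OF Di(1) K(1)[OF s] Dy])
qed

lemma M_psd:
  assumes s: "s \<in> I" and y: "y \<in> carrier_vec (m s)"
  shows "0 \<le> y \<bullet> (M s *\<^sub>v y)"
proof -
  note Di = D_inverse[OF s]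
  have Dy: "inv_mat (D s) *\<^sub>v y \<in> carrier_vec (m s)" using Di(1) y by auto
  have KDy: "K s *\<^sub>v (inv_mat (D s) *\<^sub>v y) \<in> carrier_vec (m s)" using K(1)[OF s] Dy by auto
  have "y \<bullet> (M s *\<^sub>v y) = (inv_mat (D s) *\<^sub>v y) \<bullet> (K s *\<^sub>v (inv_mat (D s) *\<^sub>v y))"
    unfolding M_vec[OF s y] using transpose_form[OF Di(1) y KDy] Di(4) by simp
  then show ?thesis using Kpsd[OF s Dy] by simp
qed

lemma inv_D_vec:
  assumes s: "s \<in> I" and y: "y \<in> carrier_vec (m s)"
  shows "inv_mat (D s) *\<^sub>v (D s *\<^sub>v y) = y" "D s *\<^sub>v (inv_mat (D s) *\<^sub>v y) = y"
  using assoc_mult_mat_vec[OF D_inverse(1)[OF s] D_carrier[OF s] y] assoc_mult_mat_vec[OF D_carrier[OF s] D_inverse(1)[OF s] y]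
    D_inverse(2,3)[OF s] y by auto

text \<open>\<open>B s\<close> is not the pseudo-inverse of \<open>M s\<close>, but it acts as a generalized inverse on the range.\<close>

lemma B_form_on_range:
  assumes s: "s \<in> I" and z: "z \<in> carrier_vec (m s)"
  shows "(M s *\<^sub>v z) \<bullet> (B s *\<^sub>v (M s *\<^sub>v z)) = z \<bullet> (M s *\<^sub>v z)"
proof -
  note Di = D_inverse[OF s] and Kc = K(1)[OF s] and Dc = D_carrier[OF s]
  note X = pinv_symmetric[OF Kc K(2)[OF s]]
  let ?q = "inv_mat (D s) *\<^sub>v z" and ?r = "M s *\<^sub>v z"
  have q: "?q \<in> carrier_vec (m s)" using Di(1) z by auto
  have Kq: "K s *\<^sub>v ?q \<in> carrier_vec (m s)" using Kc q by auto
  have r: "?r \<in> carrier_vec (m s)" using M_symmetric(1)[OF s] z by auto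
  have Dr: "D s *\<^sub>v ?r = K s *\<^sub>v ?q" unfolding M_vec[OF s z] by (rule inv_D_vec(2)[OF s Kq])
  have DX: "D s * pinv (K s) \<in> carrier_mat (m s) (m s)" using Dc X(1) by auto
  let ?u = "B s *\<^sub>v ?r"
  have XKq: "pinv (K s) *\<^sub>v (K s *\<^sub>v ?q) \<in> carrier_vec (m s)" using X(1) Kq by auto
  have u: "?u = D s *\<^sub>v (pinv (K s) *\<^sub>v (K s *\<^sub>v ?q))"
    by (simp only: assoc_mult_mat_vec[OF DX Dc r] Dr assoc_mult_mat_vec[OF Dc X(1) Kq])
  have uc: "?u \<in> carrier_vec (m s)" unfolding u using Dc XKq by auto
  \<comment> \<open>The identity \<open>K s * pinv (K s) * K s = K s\<close>, conjugated by
    \<open>D s\<close>, makes \<open>?u\<close> a preimage of \<open>?r\<close>. It may differ from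
    \<open>z\<close>, but only by a kernel vector of \<open>M s\<close>, which the symmetric form
    does not see.\<close>
  have "M s *\<^sub>v ?u = inv_mat (D s) *\<^sub>v (K s *\<^sub>v (pinv (K s) *\<^sub>v (K s *\<^sub>v ?q)))"
    unfolding M_vec[OF s uc] by (simp only: u inv_D_vec(1)[OF s XKq])
  also have "K s *\<^sub>v (pinv (K s) *\<^sub>v (K s *\<^sub>v ?q)) = (K s * pinv (K s)) *\<^sub>v (K s *\<^sub>v ?q)"
    by (rule assoc_mult_mat_vec[OF Kc X(1) Kq, symmetric])
  also have "\<dots> = (K s * pinv (K s) * K s) *\<^sub>v ?q"
    by (rule assoc_mult_mat_vec[OF mult_carrier_mat[OF Kc X(1)] Kc q, symmetric])
  also have "inv_mat (D s) *\<^sub>v ((K s * pinv (K s) * K s) *\<^sub>v ?q) = ?r"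
    unfolding X(2) by (rule M_vec[OF s z, symmetric])
  finally have Mu: "M s *\<^sub>v ?u = ?r" .
  have "?r \<bullet> ?u = ?u \<bullet> ?r" by (rule comm_scalar_prod[OF r uc])
  also have "\<dots> = z \<bullet> (M s *\<^sub>v ?u)" by (rule symmetric_form[OF M_symmetric[OF s] uc z])
  finally show ?thesis unfolding Mu .
qed

lemma two_sided_bound:
  assumes \<tau>: "0 < \<tau>" and v: "v \<in> carrier_vec n"
    and orth: "\<And>s y ev. s \<in> I \<Longrightarrow> y \<in> carrier_vec (m s) \<Longrightarrow> ev < \<tau> \<Longrightarrow>
      M s *\<^sub>v y = ev \<cdot>\<^sub>v ((R s * A * (R s)\<^sup>T) *\<^sub>v y) \<Longrightarrow> ((R s)\<^sup>T *\<^sub>v y) \<bullet> (A *\<^sub>v v) = 0"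
    and color: "\<And>s. s \<in> I \<Longrightarrow> c s \<in> {1..Nc}"
      "\<And>s t. s \<in> I \<Longrightarrow> t \<in> I \<Longrightarrow> s \<noteq> t \<Longrightarrow> c s = c t \<Longrightarrow> R s * A * (R t)\<^sup>T = 0\<^sub>m (m s) (m t)"
  defines "h \<equiv> \<Sum>s\<in>I. (R s *\<^sub>v (A *\<^sub>v v)) \<bullet> (B s *\<^sub>v (R s *\<^sub>v (A *\<^sub>v v)))"
  shows "v \<bullet> (A *\<^sub>v v) \<le> h" "\<tau> * h \<le> real Nc * (v \<bullet> (A *\<^sub>v v))"
proof -
  note Ac = spdD(1,2)[OF A]
  have Apsd: "0 \<le> x \<bullet> (A *\<^sub>v x)" if "x \<in> carrier_vec n" for x
    using spdD(3)[OF A that] Ac(1) that by (cases "x = 0\<^sub>v n") (auto simp: less_imp_le)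
  let ?L = "\<lambda>s. R s * A * (R s)\<^sup>T"
  let ?a = "v \<bullet> (A *\<^sub>v v)"
  define r where "r = A *\<^sub>v v"
  have r: "r \<in> carrier_vec n" using Ac v by (simp add: r_def)
  have rs: "R s *\<^sub>v r \<in> carrier_vec (m s)" if "s \<in> I" for s using R[OF that] r by auto
  \<comment> \<open>The residual is tested against local eigenvectors by moving \<open>R s\<close>
    to the other side: orthogonality of \<open>r\<close> to the prolongated eigenvectors is
    orthogonality of \<open>R s *\<^sub>v r\<close> to the local ones.\<close>
  have "\<exists>z. z \<in> carrier_vec (m s) \<and> M s *\<^sub>v z = R s *\<^sub>v r \<and> \<tau> * (z \<bullet> (?L s *\<^sub>v z)) \<le> z \<bullet> (M s *\<^sub>v z)" if s: "s \<in> I" for s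
  proof (rule high_frequency_solution[OF M_symmetric[OF s] L[OF s] \<tau> rs[OF s]])
    fix y ev assume y: "y \<in> carrier_vec (m s)" "ev < \<tau>" "M s *\<^sub>v y = ev \<cdot>\<^sub>v (?L s *\<^sub>v y)"
    have "y \<bullet> (R s *\<^sub>v r) = ((R s)\<^sup>T *\<^sub>v y) \<bullet> r"
      using transpose_form[of "(R s)\<^sup>T" n "m s" y r] R[OF s] y r by simp
    then show "y \<bullet> (R s *\<^sub>v r) = 0" using orth[OF s y] by (simp add: r_def)
  qed blast
  then obtain z where z: "\<And>s. s \<in> I \<Longrightarrow> z s \<in> carrier_vec (m s)"
    and Mz: "\<And>s. s \<in> I \<Longrightarrow> M s *\<^sub>v z s = R s *\<^sub>v r"
    and zL: "\<And>s. s \<in> I \<Longrightarrow> \<tau> * (z s \<bullet> (?L s *\<^sub>v z s)) \<le> z s \<bullet> (M s *\<^sub>v z s)"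
    by metis
  have h: "h = (\<Sum>s\<in>I. z s \<bullet> (M s *\<^sub>v z s))"
    unfolding h_def r_def[symmetric] using B_form_on_range[OF _ z] Mz by (intro sum.cong) auto
  define w where "w s = D s *\<^sub>v (R s *\<^sub>v v)" for s
  have Rv: "R s *\<^sub>v v \<in> carrier_vec (m s)" if "s \<in> I" for s using R[OF that] v by auto
  have w: "w s \<in> carrier_vec (m s)" if "s \<in> I" for s using D_carrier[OF that] Rv[OF that] by (auto simp: w_def)
  have "?a = v \<bullet> r" by (simp add: r_def)
  \<comment> \<open>Inserting the partition of unity between \<open>v\<close> and \<open>r\<close>
    produces the mixed form of the splitting \<open>w\<close> and the representers
    \<open>z\<close>.\<close>
  also have "\<dots> = (\<Sum>s\<in>I. (R s *\<^sub>v v) \<bullet> (D s *\<^sub>v (R s *\<^sub>v r)))" by (rule pou[OF v r])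
  also have "\<dots> = (\<Sum>s\<in>I. z s \<bullet> (M s *\<^sub>v w s))"
  proof (rule sum.cong[OF refl])
    fix s assume s: "s \<in> I"
    have "(R s *\<^sub>v v) \<bullet> (D s *\<^sub>v (R s *\<^sub>v r)) = w s \<bullet> (M s *\<^sub>v z s)"
      unfolding Mz[OF s] w_def using transpose_form[OF D_carrier[OF s] Rv[OF s] rs[OF s]] by (simp add: D[OF s] transpose_mat_diag)
    also have "\<dots> = z s \<bullet> (M s *\<^sub>v w s)" by (rule symmetric_form[OF M_symmetric[OF s] w[OF s] z[OF s]])
    finally show "(R s *\<^sub>v v) \<bullet> (D s *\<^sub>v (R s *\<^sub>v r)) = z s \<bullet> (M s *\<^sub>v w s)" .
  qed
  finally have a1: "?a = (\<Sum>s\<in>I. z s \<bullet> (M s *\<^sub>v w s))" .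
  have "?a = (\<Sum>s\<in>I. (R s *\<^sub>v v) \<bullet> (K s *\<^sub>v (R s *\<^sub>v v)))" by (rule splitting[OF v v])
  also have "\<dots> = (\<Sum>s\<in>I. w s \<bullet> (M s *\<^sub>v w s))"
  proof (rule sum.cong[OF refl])
    fix s assume s: "s \<in> I"
    note Di = D_inverse[OF s]
    have KRv: "K s *\<^sub>v (R s *\<^sub>v v) \<in> carrier_vec (m s)" using K(1)[OF s] Rv[OF s] by auto
    have Dw: "inv_mat (D s) *\<^sub>v w s = R s *\<^sub>v v" unfolding w_def by (rule inv_D_vec(1)[OF s Rv[OF s]])
    have "w s \<bullet> (M s *\<^sub>v w s) = w s \<bullet> (inv_mat (D s) *\<^sub>v (K s *\<^sub>v (R s *\<^sub>v v)))"
      unfolding M_vec[OF s w[OF s]] Dw ..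
    also have "\<dots> = (inv_mat (D s) *\<^sub>v w s) \<bullet> (K s *\<^sub>v (R s *\<^sub>v v))"
      using transpose_form[OF Di(1) w[OF s] KRv] Di(4) by simp
    finally show "(R s *\<^sub>v v) \<bullet> (K s *\<^sub>v (R s *\<^sub>v v)) = w s \<bullet> (M s *\<^sub>v w s)" unfolding Dw ..
  qed
  finally have a2: "?a = (\<Sum>s\<in>I. w s \<bullet> (M s *\<^sub>v w s))" .
  \<comment> \<open>The squared \<open>M\<close>-distance between \<open>w\<close> and
    \<open>z\<close>: the square of \<open>w\<close> and the mixed term both equal
    \<open>?a\<close>, and the square of \<open>z\<close> is \<open>h\<close>.\<close>
  have "0 \<le> (\<Sum>s\<in>I. (w s + (-1) \<cdot>\<^sub>v z s) \<bullet> (M s *\<^sub>v (w s + (-1) \<cdot>\<^sub>v z s)))"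
    by (intro sum_nonneg M_psd) (use w z in auto)
  also have "\<dots> = (\<Sum>s\<in>I. w s \<bullet> (M s *\<^sub>v w s) + 2 * (-1) * (z s \<bullet> (M s *\<^sub>v w s)) + (-1)\<^sup>2 * (z s \<bullet> (M s *\<^sub>v z s)))"
    by (rule sum.cong[OF refl], rule quadratic_form_expand[OF M_symmetric]) (use w z in auto)
  also have "\<dots> = ?a - 2 * ?a + h"
    by (simp add: sum.distrib sum_subtractf sum_distrib_left[symmetric] a1[symmetric] a2[symmetric] h)
  finally show "?a \<le> h" by simp
  define f where "f s = (R s)\<^sup>T *\<^sub>v z s" for s
  have f: "f s \<in> carrier_vec n" if "s \<in> I" for s using R[OF that] z[OF that] by (auto simp: f_def)
  define g where "g = vsum n f I"
  have g: "g \<in> carrier_vec n" by (simp add: g_def)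
  have RAR: "f s \<bullet> (A *\<^sub>v f t) = z s \<bullet> ((R s * A * (R t)\<^sup>T) *\<^sub>v z t)" if s: "s \<in> I" and t: "t \<in> I" for s t
  proof -
    have Aft: "A *\<^sub>v f t \<in> carrier_vec n" using Ac f[OF t] by auto
    have "f s \<bullet> (A *\<^sub>v f t) = z s \<bullet> (R s *\<^sub>v (A *\<^sub>v f t))"
      unfolding f_def[of s] using transpose_form[of "(R s)\<^sup>T" n "m s" "z s" "A *\<^sub>v f t"] R[OF s] z[OF s] Aft by simp
    also have "R s *\<^sub>v (A *\<^sub>v f t) = (R s * A) *\<^sub>v f t"
      by (rule assoc_mult_mat_vec[OF R[OF s] Ac(1) f[OF t], symmetric])
    also have "\<dots> = (R s * A * (R t)\<^sup>T) *\<^sub>v z t"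
      unfolding f_def by (rule assoc_mult_mat_vec[OF mult_carrier_mat[OF R[OF s] Ac(1)] _ z[OF t], symmetric]) (use R[OF t] in auto)
    finally show ?thesis .
  qed
  have "h = (\<Sum>s\<in>I. r \<bullet> f s)"
    unfolding h
  proof (rule sum.cong[OF refl])
    fix s assume s: "s \<in> I"
    have "z s \<bullet> (M s *\<^sub>v z s) = z s \<bullet> (R s *\<^sub>v r)" using Mz[OF s] by simp
    also have "\<dots> = f s \<bullet> r"
      unfolding f_def using transpose_form[of "(R s)\<^sup>T" n "m s" "z s" r] R[OF s] z[OF s] r by simp
    also have "\<dots> = r \<bullet> f s" by (rule comm_scalar_prod[OF f[OF s] r])
    finally show "z s \<bullet> (M s *\<^sub>v z s) = r \<bullet> f s" .
  qed
  also have "\<dots> = r \<bullet> g" unfolding g_def by (rule scalar_prod_vsum[OF r f, symmetric])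
  also have "\<dots> = g \<bullet> (A *\<^sub>v v)" unfolding r_def[symmetric] by (rule comm_scalar_prod[OF r g])
  finally have hg: "h = g \<bullet> (A *\<^sub>v v)" .
  have "g \<bullet> (A *\<^sub>v g) \<le> real Nc * (\<Sum>s\<in>I. f s \<bullet> (A *\<^sub>v f s))"
    unfolding g_def
  proof (rule coloring_bound[OF Ac Apsd fin f color(1)])
    fix s t assume st: "s \<in> I" "t \<in> I" "s \<noteq> t" "c s = c t"
    show "f s \<bullet> (A *\<^sub>v f t) = 0" 
      unfolding RAR[OF st(1,2)] color(2)[OF st] using z[OF st(1)] z[OF st(2)]
      by (simp add: scalar_prod_def)
  qed
  then have "\<tau> * (g \<bullet> (A *\<^sub>v g)) \<le> \<tau> * (real Nc * (\<Sum>s\<in>I. f s \<bullet> (A *\<^sub>v f s)))"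
    using \<tau> by (intro mult_left_mono) auto
  also have "\<dots> = real Nc * (\<Sum>s\<in>I. \<tau> * (z s \<bullet> (?L s *\<^sub>v z s)))"
    by (simp add: RAR sum_distrib_left mult_ac)
  also have "\<dots> \<le> real Nc * h"
    unfolding h using zL by (intro mult_left_mono sum_mono) auto
  finally have gg: "\<tau> * (g \<bullet> (A *\<^sub>v g)) \<le> real Nc * h" .
  show "\<tau> * h \<le> real Nc * ?a"
  proof (cases "Nc = 0")
    case True
    then have "I = {}" using color(1) by force
    then show ?thesis using True h by simp
  next
    case False
    \<comment> \<open>Cauchy-Schwarz at a single point: this \<open>t\<close> makes the quadratic
      term of the energy of \<open>v - t g\<close> at most \<open>t * h\<close>, which halves the
      linear term \<open>2 * t * h\<close> and leaves the claim, with no square root taken.\<close>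
    define t where "t = \<tau> / real Nc"
    have t: "t > 0" using \<tau> False by (simp add: t_def)
    have "0 \<le> (v + (-t) \<cdot>\<^sub>v g) \<bullet> (A *\<^sub>v (v + (-t) \<cdot>\<^sub>v g))" by (rule Apsd) (use v g in auto)
    also have "\<dots> = ?a + 2 * (-t) * h + (-t)\<^sup>2 * (g \<bullet> (A *\<^sub>v g))"
      unfolding hg by (rule quadratic_form_expand[OF Ac v g])
    also have "(-t)\<^sup>2 * (g \<bullet> (A *\<^sub>v g)) = t * (\<tau> * (g \<bullet> (A *\<^sub>v g)) / real Nc)"
      by (simp add: t_def power2_eq_square)
    also have "\<dots> \<le> t * h" using gg t False by (intro mult_left_mono) (auto simp: divide_le_eq mult.commute)
    finally have "t * h \<le> ?a" by (simp add: mult.commute)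
    then show ?thesis using False by (simp add: t_def field_simps)
  qed
qed

abbreviation "prec_local s \<equiv> (R s)\<^sup>T * D s * pinv (K s) * D s * R s"
abbreviation "prec \<equiv> msum n prec_local I"

lemma local_prec:
  assumes s: "s \<in> I"
  shows "prec_local s \<in> carrier_mat n n"
    and "transpose_mat (prec_local s) = prec_local s"
    and "\<And>x y. x \<in> carrier_vec n \<Longrightarrow> y \<in> carrier_vec n \<Longrightarrow>
      x \<bullet> (prec_local s *\<^sub>v y) = (R s *\<^sub>v x) \<bullet> (B s *\<^sub>v (R s *\<^sub>v y))"
proof -
  note Rc = R[OF s] and Dc = D_carrier[OF s] and X = pinv_symmetric[OF K(1)[OF s] K(2)[OF s]]
  have Rt: "(R s)\<^sup>T \<in> carrier_mat n (m s)" using Rc by simp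
  have DX: "D s * pinv (K s) \<in> carrier_mat (m s) (m s)" using Dc X(1) by auto
  have Bc: "B s \<in> carrier_mat (m s) (m s)" using DX Dc by auto
  have Dt: "transpose_mat (D s) = D s" by (simp add: D[OF s] transpose_mat_diag)
  have RB: "(R s)\<^sup>T * B s \<in> carrier_mat n (m s)" using Rt Bc by auto
  have eq: "prec_local s = (R s)\<^sup>T * B s * R s"
    using assoc_mult_mat[OF Rt Dc X(1)] assoc_mult_mat[OF Rt DX Dc] by simp
  show "prec_local s \<in> carrier_mat n n"
    unfolding eq using RB Rc by auto
  have Bt: "transpose_mat (B s) = B s"
    using transpose_mult[OF DX Dc] transpose_mult[OF Dc X(1)] Dt X(3) assoc_mult_mat[OF Dc X(1) Dc] by simp
  show "transpose_mat (prec_local s) = prec_local s"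
    unfolding eq using transpose_mult[OF RB Rc] transpose_mult[OF Rt Bc] Bt assoc_mult_mat[OF Rt Bc Rc] by simp
  fix x y :: "real Matrix.vec" assume x: "x \<in> carrier_vec n" and y: "y \<in> carrier_vec n"
  have Ry: "R s *\<^sub>v y \<in> carrier_vec (m s)" using Rc y by auto
  have BRy: "B s *\<^sub>v (R s *\<^sub>v y) \<in> carrier_vec (m s)" using Bc Ry by auto
  have "((R s)\<^sup>T * B s * R s) *\<^sub>v y = (R s)\<^sup>T *\<^sub>v (B s *\<^sub>v (R s *\<^sub>v y))"
    by (simp only: assoc_mult_mat_vec[OF RB Rc y] assoc_mult_mat_vec[OF Rt Bc Ry])
  then show "x \<bullet> (prec_local s *\<^sub>v y) = (R s *\<^sub>v x) \<bullet> (B s *\<^sub>v (R s *\<^sub>v y))"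
    unfolding eq using transpose_form[OF Rc x BRy] by simp
qed

lemma prec_symmetric: "prec \<in> carrier_mat n n" "transpose_mat prec = prec"
proof -
  have e: "prec \<in> carrier_mat n n \<and> (\<forall>i<n. \<forall>j<n. prec $$ (i, j) = (\<Sum>s\<in>I. prec_local s $$ (i, j)))"
    by (rule msum_entries[OF fin]) (rule local_prec(1))
  then show c: "prec \<in> carrier_mat n n" by (rule conjunct1)
  have en: "prec $$ (i, j) = (\<Sum>s\<in>I. prec_local s $$ (i, j))" if "i < n" "j < n" for i j
    using e that by blast
  have sym: "F $$ (i, j) = F $$ (j, i)" if "F \<in> carrier_mat n n" "transpose_mat F = F" "i < n" "j < n" for F :: "real mat" and i j
    using index_transpose_mat(1)[of j F i] that by simp
  show "transpose_mat prec = prec"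
  proof (rule eq_matI)
    fix i j assume "i < dim_row prec" "j < dim_col prec"
    then have ij: "i < n" "j < n" using c by auto
    have loc: "prec_local s $$ (j, i) = prec_local s $$ (i, j)" if s: "s \<in> I" for s
      by (rule sym[OF local_prec(1)[OF s] local_prec(2)[OF s] ij(2,1)])
    have "prec $$ (j, i) = (\<Sum>s\<in>I. prec_local s $$ (j, i))" by (rule en[OF ij(2,1)])
    also have "\<dots> = (\<Sum>s\<in>I. prec_local s $$ (i, j))" by (rule sum.cong[OF refl loc])
    also have "\<dots> = prec $$ (i, j)" by (rule en[OF ij, symmetric])
    finally show "transpose_mat prec $$ (i, j) = prec $$ (i, j)" using c ij by simp
  qed (use c in auto)
qed

lemma prec_form:
  assumes "x \<in> carrier_vec n"
  shows "x \<bullet> (prec *\<^sub>v x) = (\<Sum>s\<in>I. (R s *\<^sub>v x) \<bullet> (B s *\<^sub>v (R s *\<^sub>v x)))"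
proof -
  have "x \<bullet> (prec *\<^sub>v x) = (\<Sum>s\<in>I. x \<bullet> (prec_local s *\<^sub>v x))"
    by (rule msum_form[OF fin _ assms assms]) (rule local_prec(1))
  also have "\<dots> = (\<Sum>s\<in>I. (R s *\<^sub>v x) \<bullet> (B s *\<^sub>v (R s *\<^sub>v x)))"
    by (rule sum.cong[OF refl]) (rule local_prec(3)[OF _ assms assms])
  finally show ?thesis .
qed

end

section \<open>Coarse space correction and complex eigenvalues\<close>

lemma vec_eq_by_forms:
  fixes u w :: "real Matrix.vec"
  assumes "u \<in> carrier_vec n" "w \<in> carrier_vec n" "\<And>y. y \<in> carrier_vec n \<Longrightarrow> y \<bullet> u = y \<bullet> w"
  shows "u = w"
proof (rule eq_vecI)
  fix i assume "i < dim_vec w"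
  then have i: "i < n" using assms by simp
  show "vec_index u i = vec_index w i"
    using assms(3)[of "unit_vec n i"] scalar_prod_left_unit[OF assms(1) i] scalar_prod_left_unit[OF assms(2) i] by simp
qed (use assms in simp)

text \<open>With the eigenvector written as a + i b, a real matrix acts on the pair (a, b) as
  multiplication by the complex number \<open>ev\<close>. One of the two parts may be zero.\<close>

lemma cx_eigenvalue_real_parts:
  fixes B :: "real mat"
  assumes B: "B \<in> carrier_mat n n" and ev: "cx_eigenvalue B ev"
  obtains a b where "a \<in> carrier_vec n" "b \<in> carrier_vec n" "a \<noteq> 0\<^sub>v n \<or> b \<noteq> 0\<^sub>v n"
    "B *\<^sub>v a = Re ev \<cdot>\<^sub>v a + (- Im ev) \<cdot>\<^sub>v b" "B *\<^sub>v b = Im ev \<cdot>\<^sub>v a + Re ev \<cdot>\<^sub>v b"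
proof -
  let ?B = "map_mat complex_of_real B"
  from ev B obtain x where x: "x \<in> carrier_vec n" "x \<noteq> 0\<^sub>v n" and Bx: "?B *\<^sub>v x = ev \<cdot>\<^sub>v x"
    by (auto simp: eigenvalue_def eigenvector_def)
  define a b where "a = map_vec Re x" and "b = map_vec Im x"
  have ab: "a \<in> carrier_vec n" "b \<in> carrier_vec n" using x by (auto simp: a_def b_def)
  have row: "(\<Sum>j<n. complex_of_real (B $$ (i, j)) * vec_index x j) = ev * vec_index x i" if i: "i < n" for i
  proof -
    have "(\<Sum>j<n. complex_of_real (B $$ (i, j)) * vec_index x j) = vec_index (?B *\<^sub>v x) i"
      using i B x by (simp add: scalar_prod_def atLeast0LessThan)
    then show ?thesis using Bx i x by simp
  qed
  have Ba: "B *\<^sub>v a = Re ev \<cdot>\<^sub>v a + (- Im ev) \<cdot>\<^sub>v b"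
  proof (rule eq_vecI)
    fix i assume "i < dim_vec (Re ev \<cdot>\<^sub>v a + (- Im ev) \<cdot>\<^sub>v b)"
    then have i: "i < n" using ab by simp
    have "vec_index (B *\<^sub>v a) i = (\<Sum>j<n. B $$ (i, j) * Re (vec_index x j))"
      using i B x by (simp add: a_def scalar_prod_def atLeast0LessThan)
    also have "\<dots> = Re (\<Sum>j<n. complex_of_real (B $$ (i, j)) * vec_index x j)" by simp
    also have "\<dots> = Re (ev * vec_index x i)" by (simp only: row[OF i])
    finally show "vec_index (B *\<^sub>v a) i = vec_index (Re ev \<cdot>\<^sub>v a + (- Im ev) \<cdot>\<^sub>v b) i"
      using i x by (simp add: a_def b_def)
  qed (use B ab in auto)
  have Bb: "B *\<^sub>v b = Im ev \<cdot>\<^sub>v a + Re ev \<cdot>\<^sub>v b"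
  proof (rule eq_vecI)
    fix i assume "i < dim_vec (Im ev \<cdot>\<^sub>v a + Re ev \<cdot>\<^sub>v b)"
    then have i: "i < n" using ab by simp
    have "vec_index (B *\<^sub>v b) i = (\<Sum>j<n. B $$ (i, j) * Im (vec_index x j))"
      using i B x by (simp add: b_def scalar_prod_def atLeast0LessThan)
    also have "\<dots> = Im (\<Sum>j<n. complex_of_real (B $$ (i, j)) * vec_index x j)" by simp
    also have "\<dots> = Im (ev * vec_index x i)" by (simp only: row[OF i])
    finally show "vec_index (B *\<^sub>v b) i = vec_index (Im ev \<cdot>\<^sub>v a + Re ev \<cdot>\<^sub>v b) i"
      using i x by (simp add: a_def b_def)
  qed (use B ab in auto)
  have "a \<noteq> 0\<^sub>v n \<or> b \<noteq> 0\<^sub>v n"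
  proof (rule ccontr)
    assume "\<not> (a \<noteq> 0\<^sub>v n \<or> b \<noteq> 0\<^sub>v n)"
    then have 0: "a = 0\<^sub>v n" "b = 0\<^sub>v n" by auto
    have "x = 0\<^sub>v n"
    proof (rule eq_vecI)
      fix i assume "i < dim_vec (0\<^sub>v n :: complex Matrix.vec)"
      then have i: "i < n" by simp
      have "Re (vec_index x i) = vec_index a i" "Im (vec_index x i) = vec_index b i"
        using i x by (simp_all add: a_def b_def)
      then show "vec_index x i = vec_index (0\<^sub>v n) i" using i by (simp add: 0 complex_eq_iff)
    qed (use x in simp)
    then show False using x by simp
  qed
  then show thesis using that ab Ba Bb by blast
qed

text \<open>The hypotheses say that (\<alpha> + i \<beta>)(a + i b) = 0. The squared modulus is
  multiplicative, so a coordinate where a + i b does not vanish decides.\<close>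

lemma rotation_zero:
  fixes a b :: "real Matrix.vec"
  assumes ab: "a \<in> carrier_vec n" "b \<in> carrier_vec n"
    and 1: "\<alpha> \<cdot>\<^sub>v a + (- \<beta>) \<cdot>\<^sub>v b = 0\<^sub>v n" and 2: "\<beta> \<cdot>\<^sub>v a + \<alpha> \<cdot>\<^sub>v b = 0\<^sub>v n"
    and ne: "a \<noteq> 0\<^sub>v n \<or> b \<noteq> 0\<^sub>v n"
  shows "\<alpha> = 0 \<and> \<beta> = 0"
proof -
  obtain i where i: "i < n" and nz: "vec_index a i \<noteq> 0 \<or> vec_index b i \<noteq> 0"
    using ne ab by (metis carrier_vecD eq_vecI index_zero_vec)
  let ?x = "vec_index a i" and ?y = "vec_index b i"
  have "vec_index (\<alpha> \<cdot>\<^sub>v a + (- \<beta>) \<cdot>\<^sub>v b) i = 0" "vec_index (\<beta> \<cdot>\<^sub>v a + \<alpha> \<cdot>\<^sub>v b) i = 0"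
    unfolding 1 2 using i by simp_all
  then have e: "\<alpha> * ?x - \<beta> * ?y = 0" "\<beta> * ?x + \<alpha> * ?y = 0" using i ab by simp_all
  have "(\<alpha>\<^sup>2 + \<beta>\<^sup>2) * (?x\<^sup>2 + ?y\<^sup>2) = (\<alpha> * ?x - \<beta> * ?y)\<^sup>2 + (\<beta> * ?x + \<alpha> * ?y)\<^sup>2"
    by (simp add: power2_eq_square algebra_simps)
  also have "\<dots> = 0" unfolding e by simp
  finally have "\<alpha>\<^sup>2 + \<beta>\<^sup>2 = 0" using nz by (auto simp: sum_power2_eq_zero_iff)
  then show ?thesis by (simp add: sum_power2_eq_zero_iff)
qed

text \<open>On the range of \<open>P\<close> the operator P H A is symmetric for the
  \<open>A\<close>-inner product. Evaluating its form on (p, q) and on (q, p) leaves \<beta> times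
  the total energy of the pair, which forces \<beta> = 0; then \<alpha> is the quotient of the two
  forms at whichever of the two vectors is nonzero.\<close>

lemma projected_pair:
  fixes A H P :: "real mat"
  assumes A: "spd n A" and H: "H \<in> carrier_mat n n" "transpose_mat H = H" and P: "P \<in> carrier_mat n n"
    and PA: "\<And>x y. x \<in> carrier_vec n \<Longrightarrow> y \<in> carrier_vec n \<Longrightarrow> (P *\<^sub>v x) \<bullet> (A *\<^sub>v y) = x \<bullet> (A *\<^sub>v (P *\<^sub>v y))"
    and bound: "\<And>v. v \<in> carrier_vec n \<Longrightarrow> P *\<^sub>v v = v \<Longrightarrow> v \<bullet> (A *\<^sub>v v) \<le> (A *\<^sub>v v) \<bullet> (H *\<^sub>v (A *\<^sub>v v)) \<and>
      (A *\<^sub>v v) \<bullet> (H *\<^sub>v (A *\<^sub>v v)) \<le> \<kappa> * (v \<bullet> (A *\<^sub>v v))"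
    and p: "p \<in> carrier_vec n" "P *\<^sub>v p = p" and q: "q \<in> carrier_vec n" "P *\<^sub>v q = q"
    and ne: "p \<noteq> 0\<^sub>v n \<or> q \<noteq> 0\<^sub>v n"
    and ep: "P *\<^sub>v (H *\<^sub>v (A *\<^sub>v p)) = \<alpha> \<cdot>\<^sub>v p + (- \<beta>) \<cdot>\<^sub>v q"
    and eq: "P *\<^sub>v (H *\<^sub>v (A *\<^sub>v q)) = \<beta> \<cdot>\<^sub>v p + \<alpha> \<cdot>\<^sub>v q"
  shows "\<beta> = 0 \<and> 1 \<le> \<alpha> \<and> \<alpha> \<le> \<kappa>"
proof -
  note Ac = spdD(1,2)[OF A]
  define s where "s x y = (A *\<^sub>v x) \<bullet> (H *\<^sub>v (A *\<^sub>v y))" for x y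
  define a where "a x y = x \<bullet> (A *\<^sub>v y)" for x y
  have s: "s x y = a (P *\<^sub>v (H *\<^sub>v (A *\<^sub>v y))) x" if x: "x \<in> carrier_vec n" "P *\<^sub>v x = x" and y: "y \<in> carrier_vec n" for x y
  proof -
    have c: "H *\<^sub>v (A *\<^sub>v y) \<in> carrier_vec n" "A *\<^sub>v x \<in> carrier_vec n" using H Ac x y by auto
    have "s x y = (H *\<^sub>v (A *\<^sub>v y)) \<bullet> (A *\<^sub>v (P *\<^sub>v x))" unfolding s_def x(2) by (rule comm_scalar_prod[OF c(2,1)])
    also have "\<dots> = a (P *\<^sub>v (H *\<^sub>v (A *\<^sub>v y))) x" unfolding a_def by (rule PA[OF c(1) x(1), symmetric])
    finally show ?thesis .
  qed
  have ssym: "s x y = s y x" if "x \<in> carrier_vec n" "y \<in> carrier_vec n" for x y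
    unfolding s_def by (rule symmetric_form[OF H]) (use Ac that in auto)
  have asym: "a x y = a y x" if "x \<in> carrier_vec n" "y \<in> carrier_vec n" for x y
    unfolding a_def by (rule symmetric_form[OF Ac that])
  have alin: "a (c \<cdot>\<^sub>v x + e \<cdot>\<^sub>v y) z = c * a x z + e * a y z"
    if "x \<in> carrier_vec n" "y \<in> carrier_vec n" "z \<in> carrier_vec n" for c e x y z
    unfolding a_def using that Ac by (simp add: add_scalar_prod_distrib[of _ n])
  have sp: "s x p = \<alpha> * a p x - \<beta> * a q x" if "x \<in> carrier_vec n" "P *\<^sub>v x = x" for x
    unfolding s[OF that p(1)] ep alin[OF p(1) q(1) that(1)] by simp
  have sq: "s x q = \<beta> * a p x + \<alpha> * a q x" if "x \<in> carrier_vec n" "P *\<^sub>v x = x" for x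
    unfolding s[OF that q(1)] eq alin[OF p(1) q(1) that(1)] by simp
  have apos: "0 < a x x" if "x \<in> carrier_vec n" "x \<noteq> 0\<^sub>v n" for x
    unfolding a_def by (rule spdD(3)[OF A that])
  have a0: "0 \<le> a x x" if "x \<in> carrier_vec n" for x
    using apos[OF that] Ac that by (cases "x = 0\<^sub>v n") (auto simp: a_def less_imp_le)
  have "\<beta> * (a p p + a q q) = 0"
    using ssym[OF q(1) p(1)] sp[OF q] sq[OF p] asym[OF p(1) q(1)] by (simp add: algebra_simps)
  moreover have "a p p + a q q > 0" using ne apos a0 p q by (metis add_nonneg_pos add_pos_nonneg)
  ultimately have \<beta>: "\<beta> = 0" by simp
  obtain x where x: "x \<in> carrier_vec n" "P *\<^sub>v x = x" "x \<noteq> 0\<^sub>v n" "s x x = \<alpha> * a x x"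
  proof (cases "p = 0\<^sub>v n")
    case False then show thesis using that[OF p(1,2)] sp[OF p] \<beta> by simp
  next
    case True then show thesis using that[OF q(1,2)] sq[OF q] \<beta> ne by simp
  qed
  have "a x x \<le> \<alpha> * a x x" "\<alpha> * a x x \<le> \<kappa> * a x x"
    using bound[OF x(1,2)] x(4) by (auto simp: a_def s_def)
  then show ?thesis using apos[OF x(1,3)] \<beta> by simp
qed

section \<open>The \<open>A\<close>-orthogonal projection along the coarse space\<close>

locale coarse_space_correction =
  fixes n k :: nat and A R\<^sub>0 :: "real mat"
  assumes A: "spd n A" and R0: "R\<^sub>0 \<in> carrier_mat k n"
    and inj: "\<And>c. c \<in> carrier_vec k \<Longrightarrow> R\<^sub>0\<^sup>T *\<^sub>v c = 0\<^sub>v n \<Longrightarrow> c = 0\<^sub>v k"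
begin

abbreviation "P \<equiv> coarse_proj A R\<^sub>0"
abbreviation "Q \<equiv> coarse_solve A R\<^sub>0"

lemma R0T: "R\<^sub>0\<^sup>T \<in> carrier_mat n k"
  using R0 by simp

lemma coarse_matrix_vec:
  assumes c: "c \<in> carrier_vec k"
  shows "(R\<^sub>0 * A * R\<^sub>0\<^sup>T) *\<^sub>v c = R\<^sub>0 *\<^sub>v (A *\<^sub>v (R\<^sub>0\<^sup>T *\<^sub>v c))"
proof -
  have "R\<^sub>0 * A \<in> carrier_mat k n" using R0 spdD(1)[OF A] by auto
  moreover have "R\<^sub>0\<^sup>T *\<^sub>v c \<in> carrier_vec n" using R0T c by auto
  ultimately show ?thesis
    by (simp only: assoc_mult_mat_vec[OF _ R0T c] assoc_mult_mat_vec[OF R0 spdD(1)[OF A]])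
qed

lemma coarse_matrix_spd: "spd k (R\<^sub>0 * A * R\<^sub>0\<^sup>T)"
  unfolding spd_def
proof (intro conjI ballI impI)
  note Ac = spdD(1,2)[OF A]
  have RA: "R\<^sub>0 * A \<in> carrier_mat k n" using R0 Ac by auto
  show "R\<^sub>0 * A * R\<^sub>0\<^sup>T \<in> carrier_mat k k" using RA R0T by auto
  have "transpose_mat (R\<^sub>0 * A * R\<^sub>0\<^sup>T) = R\<^sub>0 * transpose_mat (R\<^sub>0 * A)"
    using transpose_mult[OF RA R0T] by simp
  also have "transpose_mat (R\<^sub>0 * A) = A * R\<^sub>0\<^sup>T" using transpose_mult[OF R0 Ac(1)] Ac(2) by simp
  also have "R\<^sub>0 * (A * R\<^sub>0\<^sup>T) = R\<^sub>0 * A * R\<^sub>0\<^sup>T"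
    by (rule assoc_mult_mat[OF R0 Ac(1) R0T, symmetric])
  finally show "transpose_mat (R\<^sub>0 * A * R\<^sub>0\<^sup>T) = R\<^sub>0 * A * R\<^sub>0\<^sup>T" .
  fix c :: "real Matrix.vec" assume c: "c \<in> carrier_vec k" "c \<noteq> 0\<^sub>v k"
  have Rc: "R\<^sub>0\<^sup>T *\<^sub>v c \<in> carrier_vec n" using R0T c by auto
  have ARc: "A *\<^sub>v (R\<^sub>0\<^sup>T *\<^sub>v c) \<in> carrier_vec n" using Ac Rc by auto
  have "c \<bullet> ((R\<^sub>0 * A * R\<^sub>0\<^sup>T) *\<^sub>v c) = (R\<^sub>0\<^sup>T *\<^sub>v c) \<bullet> (A *\<^sub>v (R\<^sub>0\<^sup>T *\<^sub>v c))"
    unfolding coarse_matrix_vec[OF c(1)] using transpose_form[OF R0T c(1) ARc] by simp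
  also have "\<dots> > 0" by (rule spdD(3)[OF A Rc]) (use inj c in blast)
  finally show "0 < c \<bullet> ((R\<^sub>0 * A * R\<^sub>0\<^sup>T) *\<^sub>v c)" .
qed

abbreviation "G \<equiv> inv_mat (R\<^sub>0 * A * R\<^sub>0\<^sup>T)"

lemmas G = spd_inverse[OF coarse_matrix_spd]

lemma G_symmetric: "transpose_mat G = G"
proof -
  let ?E = "R\<^sub>0 * A * R\<^sub>0\<^sup>T"
  note E = spdD(1,2)[OF coarse_matrix_spd]
  have t: "transpose_mat G \<in> carrier_mat k k" using G(1) by simp
  have "transpose_mat G * ?E = 1\<^sub>m k"
    using arg_cong[OF G(2), of transpose_mat] transpose_mult[OF E(1) G(1)] E(2) by simp
  then have "G = (transpose_mat G * ?E) * G" using G(1) by simp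
  also have "\<dots> = transpose_mat G * (?E * G)" by (rule assoc_mult_mat[OF t E(1) G(1)])
  also have "\<dots> = transpose_mat G" unfolding G(2) by (rule right_mult_one_mat[OF t])
  finally show ?thesis ..
qed

lemma Q_carrier: "Q \<in> carrier_mat n n"
  unfolding coarse_solve_def using R0 R0T G(1) by auto

lemma Q_vec: "x \<in> carrier_vec n \<Longrightarrow> Q *\<^sub>v x = R\<^sub>0\<^sup>T *\<^sub>v (G *\<^sub>v (R\<^sub>0 *\<^sub>v x))"
  unfolding coarse_solve_def
  using assoc_mult_mat_vec[OF mult_carrier_mat[OF R0T G(1)] R0, of x] assoc_mult_mat_vec[OF R0T G(1), of "R\<^sub>0 *\<^sub>v x"] R0
  by simp

lemma Q_form_symmetric:
  assumes x: "x \<in> carrier_vec n" and y: "y \<in> carrier_vec n"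
  shows "(Q *\<^sub>v x) \<bullet> y = x \<bullet> (Q *\<^sub>v y)"
proof -
  have c: "R\<^sub>0 *\<^sub>v x \<in> carrier_vec k" "R\<^sub>0 *\<^sub>v y \<in> carrier_vec k" using R0 x y by auto
  have d: "G *\<^sub>v (R\<^sub>0 *\<^sub>v x) \<in> carrier_vec k" "G *\<^sub>v (R\<^sub>0 *\<^sub>v y) \<in> carrier_vec k" using G(1) c by auto
  have "(Q *\<^sub>v x) \<bullet> y = (G *\<^sub>v (R\<^sub>0 *\<^sub>v x)) \<bullet> (R\<^sub>0 *\<^sub>v y)"
    unfolding Q_vec[OF x] using transpose_form[OF R0T d(1) y] by simp
  also have "\<dots> = (R\<^sub>0 *\<^sub>v x) \<bullet> (G *\<^sub>v (R\<^sub>0 *\<^sub>v y))"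
    using transpose_form[OF G(1) c(1) c(2)] G_symmetric by simp
  also have "\<dots> = x \<bullet> (Q *\<^sub>v y)"
    unfolding Q_vec[OF y] using transpose_form[OF R0 x d(2)] by simp
  finally show ?thesis .
qed

lemma P_carrier: "P \<in> carrier_mat n n"
  unfolding coarse_proj_def using Q_carrier spdD(1)[OF A] by auto

lemma P_vec:
  assumes x: "x \<in> carrier_vec n"
  shows "P *\<^sub>v x = x - Q *\<^sub>v (A *\<^sub>v x)"
proof -
  have QA: "Q * A \<in> carrier_mat n n" using Q_carrier spdD(1)[OF A] by auto
  have "P *\<^sub>v x = 1\<^sub>m n *\<^sub>v x - (Q * A) *\<^sub>v x"
    unfolding coarse_proj_def using minus_mult_distrib_mat_vec[OF one_carrier_mat QA x] spdD(1)[OF A] by simp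
  then show ?thesis using x assoc_mult_mat_vec[OF Q_carrier spdD(1)[OF A] x] by simp
qed

lemma P_vec_carrier [intro]: "x \<in> carrier_vec n \<Longrightarrow> P *\<^sub>v x \<in> carrier_vec n"
  using P_carrier by auto

text \<open>The coarse solve inverts the Galerkin matrix, so it reproduces vectors that already lie
  in the coarse space.\<close>

lemma P_kernel:
  assumes c: "c \<in> carrier_vec k"
  shows "P *\<^sub>v (R\<^sub>0\<^sup>T *\<^sub>v c) = 0\<^sub>v n"
proof -
  let ?x = "R\<^sub>0\<^sup>T *\<^sub>v c"
  have x: "?x \<in> carrier_vec n" using R0T c by auto
  have "Q *\<^sub>v (A *\<^sub>v ?x) = R\<^sub>0\<^sup>T *\<^sub>v (G *\<^sub>v ((R\<^sub>0 * A * R\<^sub>0\<^sup>T) *\<^sub>v c))"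
    unfolding coarse_matrix_vec[OF c] by (rule Q_vec) (use spdD(1)[OF A] x in auto)
  also have "G *\<^sub>v ((R\<^sub>0 * A * R\<^sub>0\<^sup>T) *\<^sub>v c) = c"
    using assoc_mult_mat_vec[OF G(1) spdD(1)[OF coarse_matrix_spd] c] G(3) c by simp
  finally show ?thesis unfolding P_vec[OF x] using x by simp
qed

lemma P_Q: "x \<in> carrier_vec n \<Longrightarrow> P *\<^sub>v (Q *\<^sub>v x) = 0\<^sub>v n"
  unfolding Q_vec by (rule P_kernel) (use R0 G(1) in auto)

lemma P_diff:
  assumes "x \<in> carrier_vec n" "y \<in> carrier_vec n"
  shows "P *\<^sub>v (x - y) = P *\<^sub>v x - P *\<^sub>v y"
  by (rule mult_minus_distrib_mat_vec[OF P_carrier assms])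

lemma P_idem:
  assumes x: "x \<in> carrier_vec n"
  shows "P *\<^sub>v (P *\<^sub>v x) = P *\<^sub>v x"
proof -
  have Ax: "A *\<^sub>v x \<in> carrier_vec n" using spdD(1)[OF A] x by auto
  have "P *\<^sub>v (P *\<^sub>v x) = P *\<^sub>v (x - Q *\<^sub>v (A *\<^sub>v x))" by (simp only: P_vec[OF x])
  also have "\<dots> = P *\<^sub>v x - P *\<^sub>v (Q *\<^sub>v (A *\<^sub>v x))"
    by (rule P_diff[OF x]) (use Q_carrier Ax in auto)
  finally have "P *\<^sub>v (P *\<^sub>v x) = P *\<^sub>v x - P *\<^sub>v (Q *\<^sub>v (A *\<^sub>v x))" .
  then show ?thesis using P_Q[OF Ax] P_vec_carrier[OF x] by simp
qed

lemma P_selfadjoint: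
  assumes x: "x \<in> carrier_vec n" and y: "y \<in> carrier_vec n"
  shows "(P *\<^sub>v x) \<bullet> (A *\<^sub>v y) = x \<bullet> (A *\<^sub>v (P *\<^sub>v y))"
proof -
  note Ac = spdD(1,2)[OF A]
  have Axy: "A *\<^sub>v x \<in> carrier_vec n" "A *\<^sub>v y \<in> carrier_vec n" using Ac x y by auto
  have Qxy: "Q *\<^sub>v (A *\<^sub>v x) \<in> carrier_vec n" "Q *\<^sub>v (A *\<^sub>v y) \<in> carrier_vec n" using Q_carrier Axy by auto
  have "(P *\<^sub>v x) \<bullet> (A *\<^sub>v y) = x \<bullet> (A *\<^sub>v y) - (Q *\<^sub>v (A *\<^sub>v x)) \<bullet> (A *\<^sub>v y)"
    unfolding P_vec[OF x] by (rule minus_scalar_prod_distrib[OF x Qxy(1) Axy(2)])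
  also have "(Q *\<^sub>v (A *\<^sub>v x)) \<bullet> (A *\<^sub>v y) = (A *\<^sub>v x) \<bullet> (Q *\<^sub>v (A *\<^sub>v y))"
    by (rule Q_form_symmetric[OF Axy])
  also have "\<dots> = x \<bullet> (A *\<^sub>v (Q *\<^sub>v (A *\<^sub>v y)))"
    using transpose_form[OF Ac(1) x Qxy(2)] Ac(2) by simp
  also have "x \<bullet> (A *\<^sub>v y) - x \<bullet> (A *\<^sub>v (Q *\<^sub>v (A *\<^sub>v y))) = x \<bullet> (A *\<^sub>v y - A *\<^sub>v (Q *\<^sub>v (A *\<^sub>v y)))"
    by (rule scalar_prod_minus_distrib[symmetric, OF x]) (use Ac Qxy Axy in auto)
  also have "A *\<^sub>v y - A *\<^sub>v (Q *\<^sub>v (A *\<^sub>v y)) = A *\<^sub>v (P *\<^sub>v y)"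
    unfolding P_vec[OF y] by (rule mult_minus_distrib_mat_vec[symmetric, OF Ac(1) y Qxy(2)])
  finally show ?thesis .
qed

text \<open>Turns P H P^T A into P H A P, so that the hybrid operator can be compared with the
  projected one.\<close>

lemma PT_A:
  assumes x: "x \<in> carrier_vec n"
  shows "transpose_mat P *\<^sub>v (A *\<^sub>v x) = A *\<^sub>v (P *\<^sub>v x)"
proof (rule vec_eq_by_forms)
  note Ac = spdD(1)[OF A]
  have Ax: "A *\<^sub>v x \<in> carrier_vec n" using Ac x by auto
  then show "transpose_mat P *\<^sub>v (A *\<^sub>v x) \<in> carrier_vec n" using P_carrier by auto
  show "A *\<^sub>v (P *\<^sub>v x) \<in> carrier_vec n" using Ac P_vec_carrier[OF x] by auto
  fix y :: "real Matrix.vec" assume y: "y \<in> carrier_vec n"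
  show "y \<bullet> (transpose_mat P *\<^sub>v (A *\<^sub>v x)) = y \<bullet> (A *\<^sub>v (P *\<^sub>v x))"
    using transpose_form[OF P_carrier y Ax] P_selfadjoint[OF y x] by simp
qed

text \<open>Applying \<open>P\<close> to either eigenvalue equation gives P H A acting on the
  projected pair: \<open>P\<close> is idempotent, and the hybrid operator differs from P H A P by I
  - P, which \<open>P\<close> annihilates. The projected pair can be zero. Then
  \<open>H * A * P\<close> has eigenvalue 0 and the hybrid operator eigenvalue 1, which is why
  \<kappa> has to be at least 1.\<close>

theorem two_level_spectrum:
  assumes H: "H \<in> carrier_mat n n" "transpose_mat H = H" and \<kappa>: "1 \<le> \<kappa>"
    and bound: "\<And>v. v \<in> carrier_vec n \<Longrightarrow> (\<And>c. c \<in> carrier_vec k \<Longrightarrow> (R\<^sub>0\<^sup>T *\<^sub>v c) \<bullet> (A *\<^sub>v v) = 0) \<Longrightarrow>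
      v \<bullet> (A *\<^sub>v v) \<le> (A *\<^sub>v v) \<bullet> (H *\<^sub>v (A *\<^sub>v v)) \<and> (A *\<^sub>v v) \<bullet> (H *\<^sub>v (A *\<^sub>v v)) \<le> \<kappa> * (v \<bullet> (A *\<^sub>v v))"
  shows "cx_eigenvalue (H * A * P) ev \<Longrightarrow> ev \<noteq> 0 \<Longrightarrow> ev \<in> \<real> \<and> 1 \<le> Re ev \<and> Re ev \<le> \<kappa>"
    and "cx_eigenvalue (hybrid A R\<^sub>0 H * A) ev \<Longrightarrow> ev \<in> \<real> \<and> 1 \<le> Re ev \<and> Re ev \<le> \<kappa>"
proof -
  note Ac = spdD(1)[OF A]
  have bound': "v \<bullet> (A *\<^sub>v v) \<le> (A *\<^sub>v v) \<bullet> (H *\<^sub>v (A *\<^sub>v v)) \<and> (A *\<^sub>v v) \<bullet> (H *\<^sub>v (A *\<^sub>v v)) \<le> \<kappa> * (v \<bullet> (A *\<^sub>v v))"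
    if v: "v \<in> carrier_vec n" "P *\<^sub>v v = v" for v
  proof (rule bound[OF v(1)])
    fix c :: "real Matrix.vec" assume c: "c \<in> carrier_vec k"
    have Rc: "R\<^sub>0\<^sup>T *\<^sub>v c \<in> carrier_vec n" using R0T c by auto
    have "(R\<^sub>0\<^sup>T *\<^sub>v c) \<bullet> (A *\<^sub>v v) = (P *\<^sub>v (R\<^sub>0\<^sup>T *\<^sub>v c)) \<bullet> (A *\<^sub>v v)"
      using P_selfadjoint[OF Rc v(1)] v(2) by simp
    also have "\<dots> = 0" unfolding P_kernel[OF c] using Ac v by (intro scalar_prod_left_zero) auto
    finally show "(R\<^sub>0\<^sup>T *\<^sub>v c) \<bullet> (A *\<^sub>v v) = 0" .
  qed
  have P_lin: "P *\<^sub>v (c \<cdot>\<^sub>v a + e \<cdot>\<^sub>v b) = c \<cdot>\<^sub>v (P *\<^sub>v a) + e \<cdot>\<^sub>v (P *\<^sub>v b)"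
    if "a \<in> carrier_vec n" "b \<in> carrier_vec n" for a b c e
    using that mult_add_distrib_mat_vec[OF P_carrier, of "c \<cdot>\<^sub>v a" "e \<cdot>\<^sub>v b"]
      mult_mat_vec[OF P_carrier that(1)] mult_mat_vec[OF P_carrier that(2)] by simp
  have P0: "P *\<^sub>v 0\<^sub>v n = 0\<^sub>v n" and A0: "A *\<^sub>v 0\<^sub>v n = 0\<^sub>v n" and H0: "H *\<^sub>v 0\<^sub>v n = 0\<^sub>v n"
    using P_carrier Ac H by (auto simp: scalar_prod_def)
  have main: "ev \<in> \<real> \<and> 1 \<le> Re ev \<and> Re ev \<le> \<kappa>"
    if ab: "a \<in> carrier_vec n" "b \<in> carrier_vec n" and ne: "P *\<^sub>v a \<noteq> 0\<^sub>v n \<or> P *\<^sub>v b \<noteq> 0\<^sub>v n"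
      and e: "P *\<^sub>v (H *\<^sub>v (A *\<^sub>v (P *\<^sub>v a))) = P *\<^sub>v (Re ev \<cdot>\<^sub>v a + (- Im ev) \<cdot>\<^sub>v b)"
        "P *\<^sub>v (H *\<^sub>v (A *\<^sub>v (P *\<^sub>v b))) = P *\<^sub>v (Im ev \<cdot>\<^sub>v a + Re ev \<cdot>\<^sub>v b)" for a b
  proof -
    have "Im ev = 0 \<and> 1 \<le> Re ev \<and> Re ev \<le> \<kappa>"
      by (rule projected_pair[OF A H P_carrier P_selfadjoint bound' P_vec_carrier[OF ab(1)] P_idem[OF ab(1)]
          P_vec_carrier[OF ab(2)] P_idem[OF ab(2)] ne e[unfolded P_lin[OF ab]]])
    then show ?thesis by (simp add: complex_is_Real_iff)
  qed
  {
    assume ev: "cx_eigenvalue (H * A * P) ev" and ev0: "ev \<noteq> 0"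
    have HA: "H * A \<in> carrier_mat n n" using H Ac by auto
    have HAP: "(H * A * P) *\<^sub>v x = H *\<^sub>v (A *\<^sub>v (P *\<^sub>v x))" if x: "x \<in> carrier_vec n" for x
      by (simp only: assoc_mult_mat_vec[OF HA P_carrier x] assoc_mult_mat_vec[OF H(1) Ac P_vec_carrier[OF x]])
    obtain a b where ab: "a \<in> carrier_vec n" "b \<in> carrier_vec n" and ne: "a \<noteq> 0\<^sub>v n \<or> b \<noteq> 0\<^sub>v n"
      and e: "(H * A * P) *\<^sub>v a = Re ev \<cdot>\<^sub>v a + (- Im ev) \<cdot>\<^sub>v b" "(H * A * P) *\<^sub>v b = Im ev \<cdot>\<^sub>v a + Re ev \<cdot>\<^sub>v b"
      using cx_eigenvalue_real_parts[OF mult_carrier_mat[OF HA P_carrier] ev] by blast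
    note e = e[unfolded HAP[OF ab(1)] HAP[OF ab(2)]]
    show "ev \<in> \<real> \<and> 1 \<le> Re ev \<and> Re ev \<le> \<kappa>"
    proof (cases "P *\<^sub>v a \<noteq> 0\<^sub>v n \<or> P *\<^sub>v b \<noteq> 0\<^sub>v n")
      case True
      then show ?thesis by (rule main[OF ab]) (simp_all only: e)
    next
      case False
      then have z: "P *\<^sub>v a = 0\<^sub>v n" "P *\<^sub>v b = 0\<^sub>v n" by auto
      have "Re ev \<cdot>\<^sub>v a + (- Im ev) \<cdot>\<^sub>v b = 0\<^sub>v n" "Im ev \<cdot>\<^sub>v a + Re ev \<cdot>\<^sub>v b = 0\<^sub>v n"
        unfolding e[symmetric] z A0 H0 by (rule refl)+
      then have "Re ev = 0 \<and> Im ev = 0" by (rule rotation_zero[OF ab _ _ ne])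
      then show ?thesis using ev0 by (simp add: complex_eq_iff)
    qed
  }
  {
    assume ev: "cx_eigenvalue (hybrid A R\<^sub>0 H * A) ev"
    have PT: "transpose_mat P \<in> carrier_mat n n" using P_carrier by simp
    have PH: "P * H \<in> carrier_mat n n" using P_carrier H by auto
    have PHP: "P * H * transpose_mat P \<in> carrier_mat n n" using PH PT by auto
    have hyb: "hybrid A R\<^sub>0 H \<in> carrier_mat n n" unfolding hybrid_def using PHP Q_carrier by auto
    have hv: "(hybrid A R\<^sub>0 H * A) *\<^sub>v x = P *\<^sub>v (H *\<^sub>v (A *\<^sub>v (P *\<^sub>v x))) + (x - P *\<^sub>v x)" if x: "x \<in> carrier_vec n" for x
    proof -
      have Ax: "A *\<^sub>v x \<in> carrier_vec n" using Ac x by auto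
      have PAx: "transpose_mat P *\<^sub>v (A *\<^sub>v x) \<in> carrier_vec n" using PT Ax by auto
      have QA: "Q *\<^sub>v (A *\<^sub>v x) \<in> carrier_vec n" using Q_carrier Ax by auto
      have "(hybrid A R\<^sub>0 H * A) *\<^sub>v x = hybrid A R\<^sub>0 H *\<^sub>v (A *\<^sub>v x)" by (rule assoc_mult_mat_vec[OF hyb Ac x])
      also have "\<dots> = (P * H * transpose_mat P) *\<^sub>v (A *\<^sub>v x) + Q *\<^sub>v (A *\<^sub>v x)"
        unfolding hybrid_def by (rule add_mult_distrib_mat_vec[OF PHP Q_carrier Ax])
      also have "(P * H * transpose_mat P) *\<^sub>v (A *\<^sub>v x) = P *\<^sub>v (H *\<^sub>v (transpose_mat P *\<^sub>v (A *\<^sub>v x)))"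
        by (simp only: assoc_mult_mat_vec[OF PH PT Ax] assoc_mult_mat_vec[OF P_carrier H(1) PAx])
      also have "transpose_mat P *\<^sub>v (A *\<^sub>v x) = A *\<^sub>v (P *\<^sub>v x)" by (rule PT_A[OF x])
      also have "Q *\<^sub>v (A *\<^sub>v x) = x - P *\<^sub>v x"
        unfolding P_vec[OF x] by (rule eq_vecI) (use x QA in auto)
      finally show ?thesis .
    qed
    obtain a b where ab: "a \<in> carrier_vec n" "b \<in> carrier_vec n" and ne: "a \<noteq> 0\<^sub>v n \<or> b \<noteq> 0\<^sub>v n"
      and e: "(hybrid A R\<^sub>0 H * A) *\<^sub>v a = Re ev \<cdot>\<^sub>v a + (- Im ev) \<cdot>\<^sub>v b" "(hybrid A R\<^sub>0 H * A) *\<^sub>v b = Im ev \<cdot>\<^sub>v a + Re ev \<cdot>\<^sub>v b"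
      using cx_eigenvalue_real_parts[OF mult_carrier_mat[OF hyb Ac] ev] by blast
    have Phv: "P *\<^sub>v ((hybrid A R\<^sub>0 H * A) *\<^sub>v x) = P *\<^sub>v (H *\<^sub>v (A *\<^sub>v (P *\<^sub>v x)))" if x: "x \<in> carrier_vec n" for x
    proof -
      let ?y = "H *\<^sub>v (A *\<^sub>v (P *\<^sub>v x))"
      have y: "?y \<in> carrier_vec n" using H Ac P_vec_carrier[OF x] by auto
      note Px = P_vec_carrier[OF x] and Py = P_vec_carrier[OF y]
      have "P *\<^sub>v (P *\<^sub>v ?y + (x - P *\<^sub>v x)) = P *\<^sub>v (P *\<^sub>v ?y) + P *\<^sub>v (x - P *\<^sub>v x)"
        by (rule mult_add_distrib_mat_vec[OF P_carrier Py]) (use x Px in auto)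
      also have "P *\<^sub>v (x - P *\<^sub>v x) = 0\<^sub>v n"
        unfolding P_diff[OF x Px] P_idem[OF x] using Px by simp
      finally show ?thesis unfolding hv[OF x] P_idem[OF y] using Py by simp
    qed
    show "ev \<in> \<real> \<and> 1 \<le> Re ev \<and> Re ev \<le> \<kappa>"
    proof (cases "P *\<^sub>v a \<noteq> 0\<^sub>v n \<or> P *\<^sub>v b \<noteq> 0\<^sub>v n")
      case True
      then show ?thesis by (rule main[OF ab]) (simp_all only: Phv[OF ab(1), symmetric] Phv[OF ab(2), symmetric] e)
    next
      case False
      then have z: "P *\<^sub>v a = 0\<^sub>v n" "P *\<^sub>v b = 0\<^sub>v n" by auto
      \<comment> \<open>On the kernel of \<open>P\<close> the hybrid operator is the
        identity.\<close>
      have E: "a = Re ev \<cdot>\<^sub>v a + (- Im ev) \<cdot>\<^sub>v b" "b = Im ev \<cdot>\<^sub>v a + Re ev \<cdot>\<^sub>v b"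
        using e unfolding hv[OF ab(1)] hv[OF ab(2)] z A0 H0 P0 using ab by simp_all
      have i: "Re ev * vec_index a i - Im ev * vec_index b i = vec_index a i"
        "Im ev * vec_index a i + Re ev * vec_index b i = vec_index b i" if "i < n" for i
      proof -
        have l: "vec_index a i = vec_index (Re ev \<cdot>\<^sub>v a + (- Im ev) \<cdot>\<^sub>v b) i"
          "vec_index b i = vec_index (Im ev \<cdot>\<^sub>v a + Re ev \<cdot>\<^sub>v b) i"
          using arg_cong[where f = "\<lambda>v. vec_index v i", OF E(1)] arg_cong[where f = "\<lambda>v. vec_index v i", OF E(2)] .
        have r: "vec_index (Re ev \<cdot>\<^sub>v a + (- Im ev) \<cdot>\<^sub>v b) i = Re ev * vec_index a i - Im ev * vec_index b i"
          "vec_index (Im ev \<cdot>\<^sub>v a + Re ev \<cdot>\<^sub>v b) i = Im ev * vec_index a i + Re ev * vec_index b i"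
          using ab that by simp_all
        show "Re ev * vec_index a i - Im ev * vec_index b i = vec_index a i"
          "Im ev * vec_index a i + Re ev * vec_index b i = vec_index b i"
          by (rule trans[OF l(1) r(1), symmetric], rule trans[OF l(2) r(2), symmetric])
      qed
      have "(Re ev - 1) \<cdot>\<^sub>v a + (- Im ev) \<cdot>\<^sub>v b = 0\<^sub>v n"
      proof (rule eq_vecI)
        fix j assume "j < dim_vec (0\<^sub>v n :: real Matrix.vec)"
        then have j: "j < n" by simp
        have "vec_index ((Re ev - 1) \<cdot>\<^sub>v a + (- Im ev) \<cdot>\<^sub>v b) j = (Re ev - 1) * vec_index a j - Im ev * vec_index b j" using ab j by simp
        also have "\<dots> = 0" using i(1)[OF j] unfolding left_diff_distrib by linarith
        finally show "vec_index ((Re ev - 1) \<cdot>\<^sub>v a + (- Im ev) \<cdot>\<^sub>v b) j = vec_index (0\<^sub>v n) j" using j by simp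
      qed (use ab in simp)
      moreover have "Im ev \<cdot>\<^sub>v a + (Re ev - 1) \<cdot>\<^sub>v b = 0\<^sub>v n"
      proof (rule eq_vecI)
        fix j assume "j < dim_vec (0\<^sub>v n :: real Matrix.vec)"
        then have j: "j < n" by simp
        have "vec_index (Im ev \<cdot>\<^sub>v a + (Re ev - 1) \<cdot>\<^sub>v b) j = Im ev * vec_index a j + (Re ev - 1) * vec_index b j" using ab j by simp
        also have "\<dots> = 0" using i(2)[OF j] unfolding left_diff_distrib by linarith
        finally show "vec_index (Im ev \<cdot>\<^sub>v a + (Re ev - 1) \<cdot>\<^sub>v b) j = vec_index (0\<^sub>v n) j" using j by simp
      qed (use ab in simp)
      ultimately have "Re ev - 1 = 0 \<and> Im ev = 0" by (rule rotation_zero[OF ab _ _ ne])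
      then show ?thesis using \<kappa> by (simp add: complex_is_Real_iff)
    qed
  }
qed

end

section \<open>Mesh geometry\<close>

lemma node_nth [simp]: "node i j $ 1 = real i / 42" "node i j $ 2 = real j / 42"
  by (simp_all add: node_def)

definition corners :: "bool \<Rightarrow> bool \<Rightarrow> nat \<Rightarrow> nat \<Rightarrow> (real^2) list" where
  "corners diag upper i j =
     (if diag then [node i j, if upper then node i (j+1) else node (i+1) j, node (i+1) (j+1)]
      else [node (i+1) j, node i (j+1), if upper then node (i+1) (j+1) else node i j])"

text \<open>The diagonal of the cell with lower left corner \<open>node i j\<close> lies on the line
  \<open>cell_side diag x = cell_level diag i j\<close>.\<close>

definition cell_side :: "bool \<Rightarrow> real^2 \<Rightarrow> real" where
  "cell_side diag x = (if diag then 42 * x $ 2 - 42 * x $ 1 else 42 * x $ 2 + 42 * x $ 1)"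

definition cell_level :: "bool \<Rightarrow> nat \<Rightarrow> nat \<Rightarrow> int" where
  "cell_level diag i j = (if diag then int j - int i else int j + int i + 1)"

text \<open>Half-plane description of a mesh triangle. After scaling by 42 all bounds are integers,
  so that questions about interiors and overlaps become questions about floors.\<close>

definition tri :: "bool \<Rightarrow> bool \<Rightarrow> nat \<Rightarrow> nat \<Rightarrow> (real^2) set" where
  "tri diag upper i j = {x. real i \<le> 42 * x $ 1 \<and> 42 * x $ 1 \<le> real i + 1 \<and>
     real j \<le> 42 * x $ 2 \<and> 42 * x $ 2 \<le> real j + 1 \<and>
     (if upper then cell_level diag i j \<le> cell_side diag x else cell_side diag x \<le> cell_level diag i j)}"

text \<open>The inequalities cut out a convex set that contains the corners; conversely the
  barycentric coordinates of a point are explicit in its offsets \<open>a\<close>, \<open>b\<close>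
  within the cell.\<close>

lemma convex_hull_corners: "convex hull set (corners diag upper i j) = tri diag upper i j"
proof -
  have comb: "x \<in> convex hull {p, q, r}"
    if "0 \<le> u" "0 \<le> v" "0 \<le> w" "u + v + w = 1" "x $ 1 = u * p $ 1 + v * q $ 1 + w * r $ 1" "x $ 2 = u * p $ 2 + v * q $ 2 + w * r $ 2"
    for x p q r :: "real^2" and u v w
  proof -
    have "x = u *\<^sub>R p + v *\<^sub>R q + w *\<^sub>R r" using that by (simp add: Finite_Cartesian_Product.vec_eq_iff forall_2)
    then show ?thesis using that unfolding convex_hull_3 by blast
  qed
  have sub: "convex hull set (corners diag upper i j) \<subseteq> tri diag upper i j"
  proof (rule hull_minimal)
    show "set (corners diag upper i j) \<subseteq> tri diag upper i j"
      by (auto simp: corners_def tri_def cell_side_def cell_level_def add_divide_distrib)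
    have "tri diag upper i j = {x. real i \<le> 42 * x $ 1} \<inter> {x. 42 * x $ 1 \<le> real i + 1} \<inter>
      {x. real j \<le> 42 * x $ 2} \<inter> {x. 42 * x $ 2 \<le> real j + 1} \<inter>
      {x. if upper then cell_level diag i j \<le> cell_side diag x else cell_side diag x \<le> cell_level diag i j}"
      by (auto simp: tri_def)
    moreover have "convex {x :: real^2. f x \<le> c}" "convex {x :: real^2. c \<le> f x}" if "linear f" for f :: "real^2 \<Rightarrow> real" and c
      using convex_linear_vimage[OF that convex_real_interval(2), of c] convex_linear_vimage[OF that convex_real_interval(1), of c]
      by (auto simp: vimage_def)
    moreover have "linear (\<lambda>x :: real^2. 42 * x $ 1)" "linear (\<lambda>x :: real^2. 42 * x $ 2)" "linear (cell_side diag)"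
      by (auto intro!: linearI simp: cell_side_def algebra_simps)
    ultimately show "convex (tri diag upper i j)"
      by (cases upper) (auto intro!: convex_Int)
  qed
  have "tri diag upper i j \<subseteq> convex hull set (corners diag upper i j)"
  proof
    fix x assume x: "x \<in> tri diag upper i j"
    define a b where "a = 42 * x $ 1 - real i" and "b = 42 * x $ 2 - real j"
    have x12: "x $ 1 = (real i + a) / 42" "x $ 2 = (real j + b) / 42" by (auto simp: a_def b_def)
    have x42: "42 * x $ 1 = real i + a" "42 * x $ 2 = real j + b" by (auto simp: a_def b_def)
    have ab: "0 \<le> a" "a \<le> 1" "0 \<le> b" "b \<le> 1" using x by (auto simp: tri_def a_def b_def)
    have side: "if upper then cell_level diag i j \<le> cell_side diag x else cell_side diag x \<le> cell_level diag i j"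
      using x by (auto simp: tri_def)
    \<comment> \<open>In each case two of the weights are nonnegative because the point lies in the
      cell; the third is nonnegative exactly by the side inequality.\<close>
    consider "diag" "upper" | "diag" "\<not> upper" | "\<not> diag" "upper" | "\<not> diag" "\<not> upper" by blast
    then show "x \<in> convex hull set (corners diag upper i j)"
    proof cases
      case 1
      then have "a \<le> b" using side by (simp add: cell_level_def cell_side_def x42)
      then show ?thesis using 1 ab
        by (simp add: corners_def, intro comb[of "1 - b" "b - a" a]) (auto simp: x12 field_simps)
    next
      case 2
      then have "b \<le> a" using side by (simp add: cell_level_def cell_side_def x42)
      then show ?thesis using 2 ab
        by (simp add: corners_def, intro comb[of "1 - a" "a - b" b]) (auto simp: x12 field_simps)
    next
      case 3
      then have "1 \<le> a + b" using side by (simp add: cell_level_def cell_side_def x42)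
      then show ?thesis using 3 ab
        by (simp add: corners_def, intro comb[of "1 - b" "1 - a" "a + b - 1"]) (auto simp: x12 field_simps)
    next
      case 4
      then have "a + b \<le> 1" using side by (simp add: cell_level_def cell_side_def x42)
      then show ?thesis using 4 ab
        by (simp add: corners_def, intro comb[of a b "1 - a - b"]) (auto simp: x12 field_simps)
    qed
  qed
  with sub show ?thesis by blast
qed

lemma mesh_eq: "mesh diag = (\<lambda>(u, i, j). tri diag u i j) ` (UNIV \<times> {..<84} \<times> {..<42})"
proof -
  have "cell_triangles diag i j = {tri diag False i j, tri diag True i j}" for i j
    unfolding convex_hull_corners[symmetric]
    by (auto simp: cell_triangles_def corners_def insert_commute)
  then show ?thesis by (auto simp: mesh_def UNIV_bool)
qed

lemma finite_mesh: "finite (mesh diag)"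
  unfolding mesh_eq by (intro finite_imageI finite_cartesian_product) auto

lemma meshE:
  assumes "T \<in> mesh diag"
  obtains u i j where "T = tri diag u i j" "i < 84" "j < 42"
  using assms by (auto simp: mesh_eq)

lemma corners_in_mesh_nodes: "i < 84 \<Longrightarrow> j < 42 \<Longrightarrow> set (corners diag u i j) \<subseteq> mesh_nodes"
proof -
  assume "i < 84" "j < 42"
  then have "node i j \<in> mesh_nodes" "node (i+1) j \<in> mesh_nodes" "node i (j+1) \<in> mesh_nodes" "node (i+1) (j+1) \<in> mesh_nodes"
    unfolding mesh_nodes_def by (fastforce simp: less_eq_Suc_le)+
  then show ?thesis by (simp add: corners_def)
qed

lemma node_inject: "node i j = node k l \<longleftrightarrow> i = k \<and> j = l"
  by (auto simp: Finite_Cartesian_Product.vec_eq_iff forall_2)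

lemma mesh_corners:
  assumes "T \<in> mesh diag"
  obtains p q r where "T = convex hull {p, q, r}" "p \<in> mesh_nodes" "q \<in> mesh_nodes" "r \<in> mesh_nodes"
    "p \<noteq> q" "q \<noteq> r" "p \<noteq> r"
proof -
  obtain u i j where T: "T = tri diag u i j" "i < 84" "j < 42" using assms by (rule meshE)
  obtain p q r where c: "corners diag u i j = [p, q, r]" "p \<noteq> q" "q \<noteq> r" "p \<noteq> r"
    by (cases diag; cases u) (auto simp: corners_def node_inject)
  then show thesis using that[of p q r] T corners_in_mesh_nodes[OF T(2,3), of diag u]
    by (simp add: convex_hull_corners[symmetric])
qed

lemma compact_mesh: "T \<in> mesh diag \<Longrightarrow> compact T"
  by (elim mesh_corners) (simp add: finite_imp_compact_convex_hull)

lemma Union_mesh: "\<Union>(mesh diag) = Omega"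
proof
  show "\<Union>(mesh diag) \<subseteq> Omega"
  proof clarify
    fix x T assume "x \<in> T" "T \<in> mesh diag"
    then obtain u i j where "x \<in> tri diag u i j" and ij: "i < 84" "j < 42" by (metis meshE)
    moreover have "real i + 1 \<le> 84" "real j + 1 \<le> 42" using ij by linarith+
    ultimately show "x \<in> Omega" by (auto simp: tri_def Omega_def)
  qed
  have cell: "\<exists>i<N. real i \<le> y \<and> y \<le> real i + 1" if "0 \<le> y" "y \<le> real N" "0 < N" for y N
  \<comment> \<open>At the right end the floor would name a cell beyond the last one, so the last
    cell is taken instead.\<close>
  proof (cases "y = real N")
    case True
    then show ?thesis using that by (intro exI[of _ "N - 1"]) (auto simp: of_nat_diff)
  next
    case False
    then show ?thesis using that
      by (intro exI[of _ "nat \<lfloor>y\<rfloor>"]) (auto simp: nat_less_iff floor_less_iff le_nat_iff)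
  qed
  show "Omega \<subseteq> \<Union>(mesh diag)"
  proof
    fix x :: "real^2" assume x: "x \<in> Omega"
    obtain i where i: "i < 84" "real i \<le> 42 * x $ 1" "42 * x $ 1 \<le> real i + 1"
      using cell[of "42 * x $ 1" 84] x by (auto simp: Omega_def)
    obtain j where j: "j < 42" "real j \<le> 42 * x $ 2" "42 * x $ 2 \<le> real j + 1"
      using cell[of "42 * x $ 2" 42] x by (auto simp: Omega_def)
    have "x \<in> tri diag (cell_level diag i j \<le> cell_side diag x) i j" using i j by (auto simp: tri_def)
    then show "x \<in> \<Union>(mesh diag)" using i(1) j(1) by (auto simp: mesh_eq)
  qed
qed

text \<open>Off these lines, every point of the domain lies in the interior of exactly one triangle.\<close>

definition grid_lines :: "(real^2) set" where
  "grid_lines = {x. 42 * x $ 1 \<in> \<int> \<or> 42 * x $ 2 \<in> \<int> \<or> cell_side True x \<in> \<int> \<or> cell_side False x \<in> \<int>}"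

text \<open>Each condition gives a nonzero linear form an integer value, so the set is a countable
  union of hyperplanes. Both diagonal directions are included, which makes the set independent of
  the cut.\<close>

lemma negligible_grid_lines: "negligible grid_lines"
proof -
  have line: "negligible {x :: real^2. a * x $ 1 + b * x $ 2 \<in> \<int>}" if "a \<noteq> 0 \<or> b \<noteq> 0" for a b
  proof -
    have "{x :: real^2. a * x $ 1 + b * x $ 2 \<in> \<int>} = (\<Union>k. {x. inner (vector [a, b]) x = of_int k})"
      by (auto simp: inner_vec_def sum_2 Ints_def)
    moreover have "vector [a, b] \<noteq> (0 :: real^2)" using that by (auto simp: Finite_Cartesian_Product.vec_eq_iff forall_2)
    moreover have "negligible (\<Union> (range (\<lambda>k. {x :: real^2. inner (vector [a, b]) x = of_int k})))"
      if "vector [a, b] \<noteq> (0 :: real^2)"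
      by (rule negligible_countable_Union) (use that in \<open>auto intro: negligible_hyperplane\<close>)
    ultimately show ?thesis by simp
  qed
  have eq: "grid_lines = {x. 42 * x $ 1 + 0 * x $ 2 \<in> \<int>} \<union> {x. 0 * x $ 1 + 42 * x $ 2 \<in> \<int>} \<union>
     {x. (-42) * x $ 1 + 42 * x $ 2 \<in> \<int>} \<union> {x. 42 * x $ 1 + 42 * x $ 2 \<in> \<int>}"
    by (auto simp: grid_lines_def cell_side_def add.commute)
  show ?thesis unfolding eq by (intro negligible_Un line) simp_all
qed

definition open_tri :: "bool \<Rightarrow> bool \<Rightarrow> nat \<Rightarrow> nat \<Rightarrow> (real^2) set" where
  "open_tri diag upper i j = {x. real i < 42 * x $ 1 \<and> 42 * x $ 1 < real i + 1 \<and>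
     real j < 42 * x $ 2 \<and> 42 * x $ 2 < real j + 1 \<and>
     (if upper then cell_level diag i j < cell_side diag x else cell_side diag x < cell_level diag i j)}"

lemma open_open_tri: "open (open_tri diag upper i j)"
  unfolding open_tri_def cell_side_def
  by (cases upper; cases diag) (simp; intro open_Collect_conj open_Collect_less continuous_intros)+

lemma open_tri_subset: "open_tri diag upper i j \<subseteq> tri diag upper i j"
  by (auto simp: open_tri_def tri_def)

lemma open_tri_nonempty: "open_tri diag upper i j \<noteq> {}"
proof -
  \<comment> \<open>Offsets of an interior point. For \<open>diag\<close> they belong to the
    centroid; otherwise the point lies on the other diagonal of the cell, a quarter or three
    quarters of the way.\<close>
  define a where "a = (if diag then if upper then 1/3 else 2/3 else if upper then 3/4 else (1/4::real))"
  define b where "b = (if diag then if upper then 2/3 else 1/3 else if upper then 3/4 else (1/4::real))"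
  have "vector [(real i + a) / 42, (real j + b) / 42] \<in> open_tri diag upper i j"
    by (auto simp: open_tri_def cell_side_def cell_level_def a_def b_def add_divide_distrib)
  then show ?thesis by blast
qed

text \<open>Equality in one of the bounds of \<open>tri\<close> would give a coordinate form or the
  diagonal form an integer value, hence a point of a grid line.\<close>

lemma tri_off_lines: "tri diag upper i j - grid_lines \<subseteq> open_tri diag upper i j"
proof
  fix x assume x: "x \<in> tri diag upper i j - grid_lines"
  have ne: "y \<noteq> z" if "y \<notin> \<int>" "z \<in> \<int>" for y z :: real using that by blast
  have z: "real k \<in> \<int>" "real k + 1 \<in> \<int>" for k by (simp_all add: Ints_add)
  have "42 * x $ 1 \<notin> \<int>" "42 * x $ 2 \<notin> \<int>" and s: "cell_side diag x \<notin> \<int>"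
    using x by (cases diag; simp add: grid_lines_def)+
  from this(1,2)[THEN ne] z
  have "42 * x $ 1 \<noteq> real i" "42 * x $ 1 \<noteq> real i + 1" "42 * x $ 2 \<noteq> real j" "42 * x $ 2 \<noteq> real j + 1"
    by blast+
  moreover have "cell_side diag x \<noteq> cell_level diag i j" by (rule ne[OF s]) simp
  ultimately show "x \<in> open_tri diag upper i j" using x by (auto simp: tri_def open_tri_def)
qed

text \<open>The floors of the scaled coordinates recover the cell, and the strict side of the
  diagonal recovers the half.\<close>

lemma mesh_disjoint_off_lines:
  assumes "T \<in> mesh diag" "T' \<in> mesh diag" "x \<in> T" "x \<in> T'" "x \<notin> grid_lines"
  shows "T = T'"
proof -
  obtain u i j where T: "T = tri diag u i j" using assms(1) by (rule meshE)
  obtain u' i' j' where T': "T' = tri diag u' i' j'" using assms(2) by (rule meshE)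
  have x: "x \<in> open_tri diag u i j" "x \<in> open_tri diag u' i' j'"
    using assms tri_off_lines T T' by blast+
  then have "int i = \<lfloor>42 * x $ 1\<rfloor>" "int i' = \<lfloor>42 * x $ 1\<rfloor>" "int j = \<lfloor>42 * x $ 2\<rfloor>" "int j' = \<lfloor>42 * x $ 2\<rfloor>"
    by (auto simp: open_tri_def floor_eq_iff intro!: floor_unique[symmetric])
  then have ij: "i = i'" "j = j'" by linarith+
  then have "u = u'" using x by (auto simp: open_tri_def split: if_splits)
  then show ?thesis using ij T T' by simp
qed

lemma mesh_interior:
  assumes "T \<in> mesh diag"
  obtains U where "open U" "U \<noteq> {}" "U \<subseteq> T" "T - grid_lines \<subseteq> U"
proof -
  obtain u i j where "T = tri diag u i j" using assms by (rule meshE)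
  then show thesis
    by (intro that[of "open_tri diag u i j"]) (simp_all add: open_open_tri open_tri_nonempty open_tri_subset tri_off_lines)
qed

lemma mesh_not_negligible:
  assumes "T \<in> mesh diag"
  shows "\<not> negligible T"
proof -
  obtain U where "open U" "U \<noteq> {}" "U \<subseteq> T" "T - grid_lines \<subseteq> U" using assms by (rule mesh_interior)
  then have "\<not> negligible U" by (intro open_not_negligible)
  then show ?thesis by (rule contrapos_nn) (rule negligible_subset[OF _ \<open>U \<subseteq> T\<close>])
qed

lemma mesh_off_lines_nonempty:
  assumes "T \<in> mesh diag"
  shows "T - grid_lines \<noteq> {}"
proof
  assume "T - grid_lines = {}"
  then have "T \<subseteq> grid_lines" by blast
  then have "negligible T" by (rule negligible_subset[OF negligible_grid_lines])
  then show False using mesh_not_negligible[OF assms] by contradiction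
qed

section \<open>Elastic energy of piecewise linear functions\<close>

text \<open>The point has an open neighborhood inside \<open>T\<close>, on which the function agrees
  with a single affine map.\<close>

lemma pderiv_on_triangle:
  assumes T: "T \<in> mesh diag" and x: "x \<in> T" "x \<notin> grid_lines"
    and f: "linear f" "\<And>y. y \<in> T \<Longrightarrow> u y = f y + c"
  shows "pderiv_at j u x = f (axis j 1)"
proof -
  obtain U where U: "open U" "U \<noteq> {}" "U \<subseteq> T" "T - grid_lines \<subseteq> U" using T by (rule mesh_interior)
  have "(f has_derivative f) (at x)" using f(1) by (rule linear_imp_has_derivative)
  then have "((\<lambda>y. f y + c) has_derivative f) (at x)" by (auto intro!: derivative_eq_intros)
  then have "(u has_derivative f) (at x)"
    by (rule has_derivative_transform_within_open[OF _ U(1)]) (use U x f(2) in auto)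
  then show ?thesis unfolding pderiv_at_def by (simp add: frechet_derivative_at[symmetric])
qed

text \<open>The gradient of a piecewise affine function is constant on a triangle, so one sample off
  the lines determines it and no affine representation has to be chosen.\<close>

definition tri_grad :: "(real^2 \<Rightarrow> real^2) \<Rightarrow> (real^2) set \<Rightarrow> 2 \<Rightarrow> real^2" where
  "tri_grad u T j = pderiv_at j u (SOME x. x \<in> T - grid_lines)"

lemma tri_grad_eq:
  assumes T: "T \<in> mesh diag" and f: "linear f" "\<And>y. y \<in> T \<Longrightarrow> u y = f y + c"
  shows "tri_grad u T j = f (axis j 1)"
proof -
  have "(SOME x. x \<in> T - grid_lines) \<in> T - grid_lines"
    using mesh_off_lines_nonempty[OF T] by (simp add: some_in_eq del: Diff_iff)
  then show ?thesis unfolding tri_grad_def using pderiv_on_triangle[OF T _ _ f] by blast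
qed

lemma P1_on_triangle:
  assumes "u \<in> P1_space diag" "T \<in> mesh diag"
  obtains f c where "linear f" "\<And>x. x \<in> T \<Longrightarrow> u x = f x + c"
proof -
  have "\<exists>f c. linear f \<and> (\<forall>x\<in>T. u x = f x + c)" using assms by (simp add: P1_space_def)
  then obtain f c where f: "linear f" "\<forall>x\<in>T. u x = f x + c" by (elim exE conjE)
  show thesis by (rule that[OF f(1) f(2)[rule_format]])
qed

lemma pderiv_at_tri_grad:
  assumes "u \<in> P1_space diag" "T \<in> mesh diag" "x \<in> T" "x \<notin> grid_lines"
  shows "pderiv_at j u x = tri_grad u T j"
proof -
  obtain f c where f: "linear f" "\<And>x. x \<in> T \<Longrightarrow> u x = f x + c" using assms(1,2) by (rule P1_on_triangle) (rule that; assumption)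
  show ?thesis using pderiv_on_triangle[OF assms(2-4) f] tri_grad_eq[OF assms(2) f] by simp
qed

text \<open>The energy density is linear in Young's modulus, so it suffices to treat the modulus one.\<close>

definition unit_density :: "(2 \<Rightarrow> real^2) \<Rightarrow> (2 \<Rightarrow> real^2) \<Rightarrow> real" where
  "unit_density G G' = 2 * lame_mu 1 *
     (\<Sum>i\<in>UNIV. \<Sum>j\<in>UNIV. ((G j $ i + G i $ j) / 2) * ((G' j $ i + G' i $ j) / 2))
     + lame_L 1 * (\<Sum>i\<in>UNIV. G i $ i) * (\<Sum>i\<in>UNIV. G' i $ i)"

lemma lame_pos: "0 < lame_mu 1" "0 < lame_L 1"
  by (simp_all add: lame_mu_def lame_L_def poisson_ratio_def)

lemma unit_density_commute: "unit_density G G' = unit_density G' G"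
  by (simp add: unit_density_def sum_2 algebra_simps)

lemma unit_density_linear:
  "unit_density (\<lambda>j. a *\<^sub>R G j + F j) G' = a * unit_density G G' + unit_density F G'"
  by (simp add: unit_density_def sum_2 field_simps)

lemma unit_density_sum_left:
  assumes "finite K"
  shows "unit_density (\<lambda>j. \<Sum>k\<in>K. a k *\<^sub>R G k j) G' = (\<Sum>k\<in>K. a k * unit_density (G k) G')"
  using assms
proof (induction K)
  case empty show ?case by (simp add: unit_density_def)
next
  case (insert k K)
  then show ?case using unit_density_linear[of "a k" "G k" "\<lambda>j. \<Sum>k\<in>K. a k *\<^sub>R G k j"] by simp
qed

lemma unit_density_sum:
  assumes "finite K" "finite L"
  shows "unit_density (\<lambda>j. \<Sum>k\<in>K. a k *\<^sub>R G k j) (\<lambda>j. \<Sum>l\<in>L. b l *\<^sub>R F l j) =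
    (\<Sum>k\<in>K. \<Sum>l\<in>L. a k * unit_density (G k) (F l) * b l)"
proof -
  have "unit_density (G k) (\<lambda>j. \<Sum>l\<in>L. b l *\<^sub>R F l j) = (\<Sum>l\<in>L. unit_density (G k) (F l) * b l)" for k
    unfolding unit_density_commute[of "G k"] unit_density_sum_left[OF assms(2)] by (simp add: mult.commute)
  then show ?thesis unfolding unit_density_sum_left[OF assms(1)] by (simp add: sum_distrib_left mult.assoc)
qed

text \<open>The off-diagonal strain is half the sum of the cross derivatives and occurs twice, which
  accounts for the factor one half on its square.\<close>

lemma unit_density_square:
  "unit_density G G = 2 * lame_mu 1 * ((G 1 $ 1)\<^sup>2 + (G 2 $ 2)\<^sup>2 + (G 1 $ 2 + G 2 $ 1)\<^sup>2 / 2) + lame_L 1 * (G 1 $ 1 + G 2 $ 2)\<^sup>2"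
  by (simp add: unit_density_def sum_2 power2_eq_square field_simps)

lemma unit_density_nonneg: "0 \<le> unit_density G G"
  unfolding unit_density_square using lame_pos by simp

lemma unit_density_zero:
  assumes "unit_density G G = 0"
  shows "G 1 $ 1 = 0" "G 2 $ 2 = 0" "G 1 $ 2 + G 2 $ 1 = 0"
proof -
  let ?a = "(G 1 $ 1)\<^sup>2 + (G 2 $ 2)\<^sup>2 + (G 1 $ 2 + G 2 $ 1)\<^sup>2 / 2"
  have "0 \<le> lame_L 1 * (G 1 $ 1 + G 2 $ 2)\<^sup>2" using lame_pos by simp
  moreover have a: "0 \<le> ?a" by simp
  then have "0 \<le> 2 * lame_mu 1 * ?a" using lame_pos by simp
  ultimately have "2 * lame_mu 1 * ?a = 0" using assms unfolding unit_density_square by linarith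
  then have "?a = 0" using lame_pos by simp
  moreover have "0 \<le> (G 1 $ 1)\<^sup>2" "0 \<le> (G 2 $ 2)\<^sup>2" "0 \<le> (G 1 $ 2 + G 2 $ 1)\<^sup>2 / 2" by simp_all
  ultimately have "(G 1 $ 1)\<^sup>2 = 0" "(G 2 $ 2)\<^sup>2 = 0" "(G 1 $ 2 + G 2 $ 1)\<^sup>2 / 2 = 0" by linarith+
  then show "G 1 $ 1 = 0" "G 2 $ 2 = 0" "G 1 $ 2 + G 2 $ 1 = 0" by simp_all
qed

lemma elast_form_density:
  "elast_form E \<omega> u v =
    (LINT x:\<omega>|lebesgue. E x * unit_density (\<lambda>j. pderiv_at j u x) (\<lambda>j. pderiv_at j v x))"
proof -
  have l: "lame_mu e = e * lame_mu 1" "lame_L e = e * lame_L 1" for e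
    by (simp_all add: lame_mu_def lame_L_def)
  have e: "2 * lame_mu e * s + lame_L e * d * d' = e * (2 * lame_mu 1 * s + lame_L 1 * d * d')" for e s d d'
    unfolding l(1)[of e] l(2)[of e] by (simp add: algebra_simps)
  show ?thesis
    unfolding elast_form_def unit_density_def strain_def divergence_def by (simp only: vec_lambda_beta e[symmetric])
qed

definition tri_weight :: "(real^2 \<Rightarrow> real) \<Rightarrow> (real^2) set \<Rightarrow> real" where
  "tri_weight E T = (LINT x:T|lebesgue. E x)"

lemma AE_off_lines: "AE x in lebesgue. x \<notin> grid_lines"
  using negligible_grid_lines by (intro AE_not_in) (simp add: negligible_iff_null_sets)

lemma sets_mesh: "T \<in> mesh diag \<Longrightarrow> T \<in> sets lebesgue"
  using compact_mesh by (auto intro: lmeasurable_compact fmeasurableD)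

text \<open>Covers the coefficient with and without the stiff layers at once; the lower bound gives
  positive triangle weights, the upper one integrability.\<close>

locale young_modulus =
  fixes E :: "real^2 \<Rightarrow> real" and b B :: real
  assumes E_measurable: "E \<in> borel_measurable lebesgue"
    and b: "0 < b" and E_bounds: "\<And>x. b \<le> E x" "\<And>x. E x \<le> B"
begin

lemma integrable_on_triangle:
  assumes "T \<in> mesh diag"
  shows "integrable lebesgue (\<lambda>x. indicator T x *\<^sub>R E x)"
proof (rule integrableI_bounded_set_indicator[OF sets_mesh[OF assms] E_measurable])
  have "T \<in> lmeasurable" using compact_mesh[OF assms] by (rule lmeasurable_compact)
  then show "emeasure lebesgue T < \<infinity>"
    unfolding infinity_ennreal_def less_top[symmetric] by (rule fmeasurableD2)
  have "norm (E x) \<le> B" for x using E_bounds[of x] b by simp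
  then show "AE x in lebesgue. x \<in> T \<longrightarrow> norm (E x) \<le> B" by simp
qed

lemma tri_weight_pos:
  assumes T: "T \<in> mesh diag"
  shows "0 < tri_weight E T"
proof -
  have lm: "T \<in> lmeasurable" using compact_mesh[OF T] by (rule lmeasurable_compact)
  have "0 < measure lebesgue T"
    using mesh_not_negligible[OF T] lm measure_nonneg[of lebesgue T] by (metis less_eq_real_def negligible_iff_measure0)
  then have "0 < b * measure lebesgue T" using b by simp
  also have "\<dots> = (\<integral>x. indicator T x *\<^sub>R b \<partial>lebesgue)"
    by simp
  also have "\<dots> \<le> (\<integral>x. indicator T x *\<^sub>R E x \<partial>lebesgue)"
  proof (rule integral_mono[OF _ integrable_on_triangle[OF T]])
    show "integrable lebesgue (\<lambda>x. indicator T x *\<^sub>R b)"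
      using fmeasurableD2[OF lm]
      by (intro integrableI_bounded_set_indicator[where B = "\<bar>b\<bar>"] sets_mesh[OF T] borel_measurable_const)
        (simp_all only: infinity_ennreal_def less_top[symmetric], simp_all)
  qed (use E_bounds in \<open>simp add: indicator_def\<close>)
  finally show ?thesis by (simp add: tri_weight_def set_lebesgue_integral_def)
qed

text \<open>Outside the null set of grid lines each point of the union lies in a single triangle,
  where the integrand is \<open>E\<close> times a constant.\<close>

lemma elast_form_triangles:
  assumes TT: "TT \<subseteq> mesh diag" and u: "u \<in> P1_space diag" and v: "v \<in> P1_space diag"
  shows "elast_form E (\<Union>TT) u v = (\<Sum>T\<in>TT. tri_weight E T * unit_density (tri_grad u T) (tri_grad v T))"
proof -
  have fin: "finite TT" using TT finite_mesh finite_subset by blast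
  define c where "c T = unit_density (tri_grad u T) (tri_grad v T)" for T
  define g where "g x = indicator (\<Union>TT) x *\<^sub>R (E x * unit_density (\<lambda>j. pderiv_at j u x) (\<lambda>j. pderiv_at j v x))" for x
  define h where "h x = (\<Sum>T\<in>TT. indicator T x *\<^sub>R E x * c T)" for x
  have int: "integrable lebesgue (\<lambda>x. indicator T x *\<^sub>R E x * c T)" if "T \<in> TT" for T
    using integrable_on_triangle[of T diag] TT that by (intro integrable_mult_left) auto
  have eq: "h x = g x" if x: "x \<notin> grid_lines" for x
  proof (cases "x \<in> \<Union>TT")
    case True
    then obtain S where S: "S \<in> TT" "x \<in> S" by blast
    have "h x = (\<Sum>T\<in>TT. if T = S then E x * c S else 0)"
      unfolding h_def
    proof (rule sum.cong[OF refl])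
      fix T assume "T \<in> TT"
      then show "indicator T x *\<^sub>R E x * c T = (if T = S then E x * c S else 0)"
        using S TT x mesh_disjoint_off_lines[of T diag S x] by (auto simp: indicator_def)
    qed
    also have "\<dots> = E x * c S" using S fin by simp
    also have "\<dots> = g x"
      using True S TT x pderiv_at_tri_grad[OF u, of S x] pderiv_at_tri_grad[OF v, of S x]
      by (auto simp: g_def c_def fun_eq_iff subset_eq)
    finally show ?thesis .
  next
    case False
    then have "h x = 0" unfolding h_def by (intro sum.neutral) auto
    then show ?thesis using False by (simp add: g_def)
  qed
  have hm: "h \<in> borel_measurable lebesgue"
    unfolding h_def using int by (intro borel_measurable_sum) (rule borel_measurable_integrable)
  have ae: "AE x in lebesgue. h x = g x" using AE_off_lines eq by (auto elim: eventually_mono)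
  \<comment> \<open>On the lines the Frechet derivative may be an unspecified value, so
    measurability of \<open>g\<close> is inherited from \<open>h\<close> through almost everywhere
    equality and completeness of Lebesgue measure.\<close>
  have gm: "g \<in> borel_measurable lebesgue" by (rule borel_measurable_AE[OF hm ae])
  have "elast_form E (\<Union>TT) u v = integral\<^sup>L lebesgue g"
    unfolding elast_form_density set_lebesgue_integral_def g_def ..
  also have "\<dots> = integral\<^sup>L lebesgue h" by (rule integral_cong_AE[OF hm gm ae, symmetric])
  also have "\<dots> = (\<Sum>T\<in>TT. \<integral>x. indicator T x *\<^sub>R E x * c T \<partial>lebesgue)"
    unfolding h_def by (rule Bochner_Integration.integral_sum[OF int])
  also have "\<dots> = (\<Sum>T\<in>TT. tri_weight E T * c T)"
    by (simp add: tri_weight_def set_lebesgue_integral_def)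
  finally show ?thesis unfolding c_def .
qed

end

text \<open>Subdomains are finite unions of closed triangles and the layers are closed strips, so
  the piecewise constant coefficient is Borel.\<close>

lemma young_modulus_young: "young_modulus (young layers (subdomain diag lab)) (10^5) (10^9)"
proof
  let ?L = "{x :: real^2. layers \<and> x $ 2 \<in> {1/7..2/7} \<union> {3/7..4/7} \<union> {5/7..6/7}}"
  let ?O = "{x. \<exists>s\<in>{1..8}. odd s \<and> x \<in> subdomain diag lab s}"
  have "closed (subdomain diag lab s)" for s
    unfolding subdomain_def
    by (rule closed_Union) (auto simp: finite_mesh intro: compact_imp_closed compact_mesh)
  then have "closed (\<Union>s\<in>{s\<in>{1..8}. odd s}. subdomain diag lab s)" by (intro closed_UN) auto
  moreover have "?O = (\<Union>s\<in>{s\<in>{1..8}. odd s}. subdomain diag lab s)" by auto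
  ultimately have O: "?O \<in> sets borel" by (simp only: borel_closed)
  have "closed {x :: real^2. x $ 2 \<in> {a..b}}" for a b
    unfolding atLeastAtMost_iff
    by (intro closed_Collect_conj closed_Collect_le continuous_on_const continuous_on_component continuous_on_id)
  then have "closed ({x :: real^2. x $ 2 \<in> {1/7..2/7}} \<union> {x. x $ 2 \<in> {3/7..4/7}} \<union> {x. x $ 2 \<in> {5/7..6/7}})"
    by (intro closed_Un)
  moreover have "?L = (if layers then {x :: real^2. x $ 2 \<in> {1/7..2/7}} \<union> {x. x $ 2 \<in> {3/7..4/7}} \<union> {x. x $ 2 \<in> {5/7..6/7}} else {})"
    by auto
  ultimately have L: "?L \<in> sets borel" by (simp add: borel_closed)
  have "young layers (subdomain diag lab) = (\<lambda>x. if x \<in> ?L then 10^9 else if x \<in> ?O then 10^5 else 10^8)"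
    by (auto simp: young_def fun_eq_iff)
  moreover have "(\<lambda>x. if x \<in> ?L then 10^9 else if x \<in> ?O then 10^5 else (10^8::real)) \<in> borel_measurable borel"
    using O L by (intro measurable_If_set borel_measurable_const) simp_all
  ultimately have "young layers (subdomain diag lab) \<in> borel_measurable borel" by simp
  then show "young layers (subdomain diag lab) \<in> borel_measurable lebesgue"
    by (intro measurable_completion) simp
  show "10^5 \<le> young layers (subdomain diag lab) x" "young layers (subdomain diag lab) x \<le> 10^9" for x
    by (simp_all add: young_def)
qed simp

text \<open>Zero strain makes the linear part skew-symmetric, that is a multiple \<open>t\<close> of
  the quarter turn. This is injective unless \<open>t = 0\<close>.\<close>

lemma rigid_motion_zero:
  fixes f :: "real^2 \<Rightarrow> real^2"
  assumes f: "linear f" and d: "unit_density (\<lambda>j. f (axis j 1)) (\<lambda>j. f (axis j 1)) = 0"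
    and pq: "f p = f q" "p \<noteq> q"
  shows "f x = 0"
proof -
  note s = unit_density_zero[OF d]
  define t where "t = f (axis 1 1) $ 2"
  have f_eq: "f x = vector [- t * x $ 2, t * x $ 1]" for x
  proof -
    have "x = x $ 1 *\<^sub>R axis 1 1 + x $ 2 *\<^sub>R axis 2 1"
      by (simp add: Finite_Cartesian_Product.vec_eq_iff forall_2 axis_def)
    then have "f x = f (x $ 1 *\<^sub>R axis 1 1 + x $ 2 *\<^sub>R axis 2 1)" by (rule arg_cong)
    also have "\<dots> = x $ 1 *\<^sub>R f (axis 1 1) + x $ 2 *\<^sub>R f (axis 2 1)"
      by (simp only: linear_add[OF f] linear_scale[OF f])
    finally have "f x = x $ 1 *\<^sub>R f (axis 1 1) + x $ 2 *\<^sub>R f (axis 2 1)" .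
    moreover have "f (axis 2 1) $ 1 = - t" using s(3) by (simp add: t_def)
    ultimately show ?thesis using s(1,2)
      by (simp add: Finite_Cartesian_Product.vec_eq_iff forall_2 t_def)
  qed
  have "t * (p $ 1 - q $ 1) = 0" "t * (p $ 2 - q $ 2) = 0"
    using pq(1) unfolding f_eq by (simp_all add: Finite_Cartesian_Product.vec_eq_iff forall_2 algebra_simps)
  then have "t = 0" using pq(2) by (auto simp: Finite_Cartesian_Product.vec_eq_iff forall_2)
  then show ?thesis unfolding f_eq by (simp add: Finite_Cartesian_Product.vec_eq_iff forall_2)
qed

text \<open>Keeps the trianglewise structure of \<open>P1_space\<close>; the boundary condition
  enters later through nodal values, and common nodes carry information from one triangle to the
  next.\<close>

definition affine_on_mesh :: "bool \<Rightarrow> (real^2 \<Rightarrow> real^2) \<Rightarrow> bool" where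
  "affine_on_mesh diag u \<longleftrightarrow> (\<forall>T\<in>mesh diag. \<exists>f c. linear f \<and> (\<forall>x\<in>T. u x = f x + c))"

lemma affine_on_meshE:
  assumes "affine_on_mesh diag u" "T \<in> mesh diag"
  obtains f c where "linear f" "\<forall>x\<in>T. u x = f x + c"
  using assms unfolding affine_on_mesh_def by blast

lemma P1_affine: "u \<in> P1_space diag \<Longrightarrow> affine_on_mesh diag u"
  by (simp add: P1_space_def affine_on_mesh_def)

lemma affine_sum:
  assumes "\<And>k. k \<in> I \<Longrightarrow> affine_on_mesh diag (u k)"
  shows "affine_on_mesh diag (\<lambda>x. \<Sum>k\<in>I. a k *\<^sub>R u k x)"
    and "T \<in> mesh diag \<Longrightarrow> tri_grad (\<lambda>x. \<Sum>k\<in>I. a k *\<^sub>R u k x) T j = (\<Sum>k\<in>I. a k *\<^sub>R tri_grad (u k) T j)"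
proof -
  have main: "\<exists>f c. linear f \<and> (\<forall>x\<in>T. (\<Sum>k\<in>I. a k *\<^sub>R u k x) = f x + c) \<and>
      (\<forall>j. f (axis j 1) = (\<Sum>k\<in>I. a k *\<^sub>R tri_grad (u k) T j))" if T: "T \<in> mesh diag" for T
  proof -
    have "\<forall>k\<in>I. \<exists>f c. linear f \<and> (\<forall>x\<in>T. u k x = f x + c)"
      using assms T unfolding affine_on_mesh_def by blast
    then obtain f where "\<forall>k\<in>I. \<exists>c. linear (f k) \<and> (\<forall>x\<in>T. u k x = f k x + c)" by metis
    then obtain c where fc: "\<forall>k\<in>I. linear (f k) \<and> (\<forall>x\<in>T. u k x = f k x + c k)" by metis
    show ?thesis
    proof (intro exI conjI ballI allI)
      show "linear (\<lambda>x. \<Sum>k\<in>I. a k *\<^sub>R f k x)"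
        using fc by (intro linear_compose_sum ballI linear_compose_scale_right) auto
      show "(\<Sum>k\<in>I. a k *\<^sub>R u k x) = (\<Sum>k\<in>I. a k *\<^sub>R f k x) + (\<Sum>k\<in>I. a k *\<^sub>R c k)" if "x \<in> T" for x
        using fc that by (simp add: scaleR_add_right sum.distrib)
      show "(\<Sum>k\<in>I. a k *\<^sub>R f k (axis j 1)) = (\<Sum>k\<in>I. a k *\<^sub>R tri_grad (u k) T j)" for j
        by (intro sum.cong refl) (use fc tri_grad_eq[OF T] in \<open>auto\<close>)
    qed
  qed
  show "affine_on_mesh diag (\<lambda>x. \<Sum>k\<in>I. a k *\<^sub>R u k x)"
    unfolding affine_on_mesh_def using main by blast
  assume T: "T \<in> mesh diag"
  from main[OF T] obtain f c where f: "linear f" "\<forall>x\<in>T. (\<Sum>k\<in>I. a k *\<^sub>R u k x) = f x + c"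
    and g: "\<forall>j. f (axis j 1) = (\<Sum>k\<in>I. a k *\<^sub>R tri_grad (u k) T j)" by (elim exE conjE)
  show "tri_grad (\<lambda>x. \<Sum>k\<in>I. a k *\<^sub>R u k x) T j = (\<Sum>k\<in>I. a k *\<^sub>R tri_grad (u k) T j)"
    using tri_grad_eq[OF T f(1) f(2)[rule_format], of j] g by simp
qed

text \<open>A strain-free linear part that takes equal values at two distinct points is zero, so the
  function is constant on the triangle.\<close>

lemma zero_energy_triangle:
  assumes u: "affine_on_mesh diag u" and T: "T \<in> mesh diag"
    and e: "unit_density (tri_grad u T) (tri_grad u T) = 0"
    and pq: "p \<in> T" "q \<in> T" "p \<noteq> q" "u p = 0" "u q = 0" and r: "r \<in> T"
  shows "u r = 0"
proof -
  obtain f c where f: "linear f" "\<forall>x\<in>T. u x = f x + c" using u T by (rule affine_on_meshE)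
  have G: "tri_grad u T = (\<lambda>j. f (axis j 1))" using tri_grad_eq[OF T f(1) f(2)[rule_format]] by auto
  have fp: "f p + c = 0" "f q + c = 0" using f pq by auto
  then have "f p = f q" by (metis add_right_cancel)
  then have "f x = 0" for x using rigid_motion_zero[OF f(1) e[unfolded G] _ pq(3)] by blast
  then show ?thesis using f(2) r fp by simp
qed

text \<open>The preimage of a point under a linear map is convex, hence contains the triangle as
  soon as it contains the corners. This removes nodal functions from triangles that do not have
  their node as a corner.\<close>

lemma zero_at_corners:
  assumes u: "affine_on_mesh diag u" and T: "T \<in> mesh diag" and pqr: "T = convex hull {p, q, r}"
    and z: "u p = 0" "u q = 0" "u r = 0"
  shows "tri_grad u T j = 0"
proof -
  obtain f c where f: "linear f" "\<forall>x\<in>T. u x = f x + c" using u T by (rule affine_on_meshE)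
  have "{p, q, r} \<subseteq> T" unfolding pqr by (rule hull_subset)
  then have "{p, q, r} \<subseteq> f -` {- c}" using f z by (auto simp: eq_neg_iff_add_eq_0)
  moreover have "convex (f -` {- c})" by (rule convex_linear_vimage[OF f(1)]) simp
  ultimately have "T \<subseteq> f -` {- c}" unfolding pqr by (rule hull_minimal)
  then have "u x = 0 + 0" if "x \<in> T" for x using f that by auto
  then show ?thesis using tri_grad_eq[OF T linear_zero, of u 0 j] by simp
qed

text \<open>A strain-free displacement that vanishes at two corners of a triangle vanishes on it;
  this propagates the boundary condition from one column of nodes to the next.\<close>

lemma zero_energy_nodes:
  assumes u: "affine_on_mesh diag u"
    and e: "\<And>T. T \<in> mesh diag \<Longrightarrow> unit_density (tri_grad u T) (tri_grad u T) = 0"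
    and bd: "\<And>j. j \<le> 42 \<Longrightarrow> u (node 0 j) = 0"
  shows "i \<le> 84 \<Longrightarrow> j \<le> 42 \<Longrightarrow> u (node i j) = 0"
proof (induction i arbitrary: j)
  case 0 then show ?case using bd by simp
next
  case (Suc i)
  then have i: "i < 84" by simp
  have IH: "u (node i j) = 0" if "j \<le> 42" for j using Suc that by simp
  have Z: "u r = 0" if "j < 42" "{p, q, r} \<subseteq> set (corners diag up i j)" "p \<noteq> q" "u p = 0" "u q = 0" for p q r up j
  proof -
    have T: "tri diag up i j \<in> mesh diag" using i that(1) by (auto simp: mesh_eq)
    have "{p, q, r} \<subseteq> tri diag up i j"
      using that(2) hull_subset[of "set (corners diag up i j)" convex] unfolding convex_hull_corners by blast
    then show ?thesis using zero_energy_triangle[OF u T e[OF T], of p q r] that(3-5) by simp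
  qed
  show ?case
  proof (cases diag)
    case True
    \<comment> \<open>With this cut the upper triangle has an edge in the known column. It yields
      the opposite node, after which both ends of the diagonal are known for the lower
      triangle.\<close>
    have up: "u (node (i+1) (j+1)) = 0" if "j < 42" for j
      by (rule Z[OF that, of "node i j" "node i (j+1)" _ True]) (use True that IH in \<open>auto simp: corners_def node_inject\<close>)
    have low: "u (node (i+1) j) = 0" if "j < 42" for j
      by (rule Z[OF that, of "node i j" "node (i+1) (j+1)" _ False]) (use True that IH up in \<open>auto simp: corners_def node_inject\<close>)
    \<comment> \<open>The top row is reached only by \<open>up\<close>, at \<open>j - 1\<close>; the
      rows below it are covered by \<open>low\<close>.\<close>
    show ?thesis using up[of "j - 1"] low[of j] Suc.prems by (cases "j < 42") auto
  next
    case False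
    \<comment> \<open>With the other cut it is the lower triangle that has an edge in the known
      column.\<close>
    have low: "u (node (i+1) j) = 0" if "j < 42" for j
      by (rule Z[OF that, of "node i j" "node i (j+1)" _ False]) (use False that IH in \<open>auto simp: corners_def node_inject\<close>)
    have up: "u (node (i+1) (j+1)) = 0" if "j < 42" for j
      by (rule Z[OF that, of "node (i+1) j" "node i (j+1)" _ True]) (use False that IH low in \<open>auto simp: corners_def node_inject\<close>)
    show ?thesis using up[of "j - 1"] low[of j] Suc.prems by (cases "j < 42") auto
  qed
qed

section \<open>Assembled and local stiffness matrices\<close>

locale elasticity = young_modulus E b B
  for E :: "real^2 \<Rightarrow> real" and b B :: real +
  fixes diag :: bool and lab :: "(real^2) set \<Rightarrow> nat" and n :: nat
    and \<phi> :: "nat \<Rightarrow> real^2 \<Rightarrow> real^2" and dof :: "nat \<Rightarrow> (real^2) \<times> 2"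
    and ns :: "nat \<Rightarrow> nat" and S :: "nat \<Rightarrow> nat \<Rightarrow> nat"
  assumes partition: "lab ` mesh diag = {1..8}"
    and basis: "nodal_basis diag n \<phi> dof"
    and local_dofs: "\<And>s. s \<in> {1..8} \<Longrightarrow> bij_betw (S s) {..<ns s} {k. k < n \<and> fst (dof k) \<in> subdomain diag lab s}"
begin

abbreviation "tri_form k l T \<equiv> tri_weight E T * unit_density (tri_grad (\<phi> k) T) (tri_grad (\<phi> l) T)"

definition A :: "real mat" where
  "A = Matrix.mat n n (\<lambda>(i, j). elast_form E Omega (\<phi> i) (\<phi> j))"

definition R :: "nat \<Rightarrow> real mat" where
  "R s = boolean_restriction (ns s) n (S s)"

definition K :: "nat \<Rightarrow> real mat" where
  "K s = Matrix.mat (ns s) (ns s) (\<lambda>(i, j). elast_form E (subdomain diag lab s) (\<phi> (S s i)) (\<phi> (S s j)))"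

definition dofs :: "nat \<Rightarrow> nat set" where
  "dofs s = {k. k < n \<and> fst (dof k) \<in> subdomain diag lab s}"

definition tris :: "nat \<Rightarrow> (real^2) set set" where
  "tris s = {T \<in> mesh diag. lab T = s}"

text \<open>Coefficients are functions of the global number and \<open>I\<close> lists the active
  ones, so passing to a subdomain needs no renumbering.\<close>

definition energy :: "(real^2) set set \<Rightarrow> (nat \<Rightarrow> real) \<Rightarrow> (nat \<Rightarrow> real) \<Rightarrow> nat set \<Rightarrow> real" where
  "energy TT x y I = (\<Sum>T\<in>TT. tri_weight E T *
     unit_density (\<lambda>j. \<Sum>k\<in>I. x k *\<^sub>R tri_grad (\<phi> k) T j) (\<lambda>j. \<Sum>k\<in>I. y k *\<^sub>R tri_grad (\<phi> k) T j))"

lemma A_carrier: "A \<in> carrier_mat n n" and R_carrier: "R s \<in> carrier_mat (ns s) n"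
  and K_carrier: "K s \<in> carrier_mat (ns s) (ns s)"
  by (simp_all add: A_def R_def K_def boolean_restriction_def)

lemma S_bij: "s \<in> {1..8} \<Longrightarrow> bij_betw (S s) {..<ns s} (dofs s)"
  using local_dofs by (simp add: dofs_def)

lemma S_less: "s \<in> {1..8} \<Longrightarrow> i < ns s \<Longrightarrow> S s i < n"
  using S_bij[of s] by (auto simp: bij_betw_def dofs_def)

lemma S_inj: "s \<in> {1..8} \<Longrightarrow> i < ns s \<Longrightarrow> j < ns s \<Longrightarrow> S s i = S s j \<longleftrightarrow> i = j"
  using S_bij[of s] by (auto simp: bij_betw_def inj_on_def)

lemma finite_dofs: "finite (dofs s)" by (simp add: dofs_def)

lemma P1: "k < n \<Longrightarrow> \<phi> k \<in> P1_space diag"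
  using basis by (simp add: nodal_basis_def)

lemma nodal: "k < n \<Longrightarrow> p \<in> mesh_nodes \<Longrightarrow> \<phi> k p = (if p = fst (dof k) then axis (snd (dof k)) 1 else 0)"
  using basis by (simp add: nodal_basis_def)

lemma dof_bij: "bij_betw dof {..<n} ((mesh_nodes - dirichlet_bd) \<times> UNIV)"
  using basis by (simp add: nodal_basis_def)

lemma dof_node:
  assumes "k < n"
  shows "fst (dof k) \<in> mesh_nodes" "fst (dof k) \<notin> dirichlet_bd"
proof -
  note assms
  then have "dof k \<in> (mesh_nodes - dirichlet_bd) \<times> UNIV" using bij_betwE[OF dof_bij] by blast
  then show "fst (dof k) \<in> mesh_nodes" "fst (dof k) \<notin> dirichlet_bd" by (auto simp: mem_Times_iff)
qed

lemma dof_inject: "k < n \<Longrightarrow> l < n \<Longrightarrow> dof k = dof l \<Longrightarrow> k = l"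
  using dof_bij by (auto simp: bij_betw_def inj_on_def)

lemma affine: "k < n \<Longrightarrow> affine_on_mesh diag (\<phi> k)"
  using P1 P1_affine by blast

lemma tris_mesh: "tris s \<subseteq> mesh diag" "finite (tris s)"
  using finite_mesh by (auto simp: tris_def)

lemma tri_weight_nonneg: "T \<in> tris s \<Longrightarrow> 0 \<le> tri_weight E T"
  using tri_weight_pos[of T diag] by (simp add: tris_def less_imp_le)

lemma sum_over_mesh: "(\<Sum>T\<in>mesh diag. h T) = (\<Sum>s\<in>{1..8}. \<Sum>T\<in>tris s. h T)" for h :: "(real^2) set \<Rightarrow> real"
  unfolding tris_def by (rule sum.group[symmetric]) (use partition finite_mesh in auto)

lemma form_mesh: "k < n \<Longrightarrow> l < n \<Longrightarrow> elast_form E Omega (\<phi> k) (\<phi> l) =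
    (\<Sum>T\<in>mesh diag. tri_form k l T)"
  using elast_form_triangles[OF order_refl P1 P1] Union_mesh[of diag] by metis

lemma form_subdomain: "k < n \<Longrightarrow> l < n \<Longrightarrow> elast_form E (subdomain diag lab s) (\<phi> k) (\<phi> l) =
    (\<Sum>T\<in>tris s. tri_form k l T)"
  unfolding subdomain_def tris_def by (rule elast_form_triangles) (auto simp: P1)

lemma energy_expand:
  assumes "finite I"
  shows "energy TT x y I = (\<Sum>k\<in>I. \<Sum>l\<in>I. x k *
     (\<Sum>T\<in>TT. tri_form k l T) * y l)"
proof -
  have "energy TT x y I = (\<Sum>T\<in>TT. \<Sum>k\<in>I. \<Sum>l\<in>I. tri_weight E T *
      (x k * unit_density (tri_grad (\<phi> k) T) (tri_grad (\<phi> l) T) * y l))"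
    unfolding energy_def unit_density_sum[OF assms assms] by (simp add: sum_distrib_left)
  also have "\<dots> = (\<Sum>k\<in>I. \<Sum>T\<in>TT. \<Sum>l\<in>I. tri_weight E T *
      (x k * unit_density (tri_grad (\<phi> k) T) (tri_grad (\<phi> l) T) * y l))" by (rule sum.swap)
  also have "\<dots> = (\<Sum>k\<in>I. \<Sum>l\<in>I. \<Sum>T\<in>TT. tri_weight E T *
      (x k * unit_density (tri_grad (\<phi> k) T) (tri_grad (\<phi> l) T) * y l))" by (rule sum.cong[OF refl], rule sum.swap)
  finally show ?thesis by (simp add: sum_distrib_left sum_distrib_right mult_ac)
qed

lemma energy_nonneg: "TT \<subseteq> mesh diag \<Longrightarrow> 0 \<le> energy TT x x I"
  unfolding energy_def using tri_weight_pos by (intro sum_nonneg mult_nonneg_nonneg unit_density_nonneg) (auto simp: less_imp_le)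

lemma A_form:
  assumes "x \<in> carrier_vec n" "y \<in> carrier_vec n"
  shows "x \<bullet> (A *\<^sub>v y) = energy (mesh diag) (vec_index x) (vec_index y) {..<n}"
  unfolding form_double_sum[OF A_carrier assms] energy_expand[OF finite_lessThan]
  by (intro sum.cong refl) (simp add: A_def form_mesh)

lemma K_form:
  assumes s: "s \<in> {1..8}" and "x \<in> carrier_vec (ns s)" "y \<in> carrier_vec (ns s)"
  shows "x \<bullet> (K s *\<^sub>v y) = (\<Sum>i<ns s. \<Sum>j<ns s. vec_index x i *
     (\<Sum>T\<in>tris s. tri_form (S s i) (S s j) T) * vec_index y j)"
  unfolding form_double_sum[OF K_carrier assms(2,3)]
  by (intro sum.cong refl) (simp add: K_def form_subdomain S_less[OF s])

lemma A_symmetric: "transpose_mat A = A"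
  by (rule eq_matI) (auto simp: A_def form_mesh unit_density_commute)

lemma K_symmetric: "s \<in> {1..8} \<Longrightarrow> transpose_mat (K s) = K s"
  by (rule eq_matI) (auto simp: K_def form_subdomain S_less unit_density_commute)

text \<open>Moves from local to global numbering along the bijection \<open>S s\<close>; any
  extension of the local coefficients will do, since the energy looks only at
  \<open>dofs s\<close>.\<close>

lemma K_form_energy:
  assumes s: "s \<in> {1..8}" and x: "x \<in> carrier_vec (ns s)" and y: "y \<in> carrier_vec (ns s)"
    and x': "\<And>i. i < ns s \<Longrightarrow> x' (S s i) = vec_index x i" and y': "\<And>i. i < ns s \<Longrightarrow> y' (S s i) = vec_index y i"
  shows "x \<bullet> (K s *\<^sub>v y) = energy (tris s) x' y' (dofs s)"
proof -
  let ?c = "\<lambda>k l. \<Sum>T\<in>tris s. tri_form k l T"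
  have "x \<bullet> (K s *\<^sub>v y) = (\<Sum>i<ns s. \<Sum>j<ns s. x' (S s i) * ?c (S s i) (S s j) * y' (S s j))"
    unfolding K_form[OF s x y] by (intro sum.cong refl) (simp add: x' y')
  also have "\<dots> = (\<Sum>i<ns s. \<Sum>l\<in>dofs s. x' (S s i) * ?c (S s i) l * y' l)"
    by (rule sum.cong[OF refl], rule sum.reindex_bij_betw[OF S_bij[OF s]])
  also have "\<dots> = (\<Sum>k\<in>dofs s. \<Sum>l\<in>dofs s. x' k * ?c k l * y' l)"
    by (rule sum.reindex_bij_betw[OF S_bij[OF s]])
  finally show ?thesis by (simp only: energy_expand[OF finite_dofs])
qed

lemma K_psd:
  assumes s: "s \<in> {1..8}" and x: "x \<in> carrier_vec (ns s)"
  shows "0 \<le> x \<bullet> (K s *\<^sub>v x)"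
proof -
  define x' where "x' k = vec_index x (inv_into {..<ns s} (S s) k)" for k
  have x': "x' (S s i) = vec_index x i" if "i < ns s" for i
    using bij_betw_inv_into_left[OF S_bij[OF s], of i] that by (simp add: x'_def)
  have "x \<bullet> (K s *\<^sub>v x) = energy (tris s) x' x' (dofs s)" by (rule K_form_energy[OF s x x]) (rule x', assumption)+
  then show ?thesis using energy_nonneg[OF tris_mesh(1)] by simp
qed

text \<open>A subdomain contains all corners of its triangles. A node outside it is therefore no
  corner of \<open>T\<close>, and its nodal functions vanish at all three.\<close>

lemma tri_grad_outside:
  assumes k: "k < n" "k \<notin> dofs s" and T: "T \<in> tris s"
  shows "tri_grad (\<phi> k) T j = 0"
proof -
  have Tm: "T \<in> mesh diag" and Ts: "T \<subseteq> subdomain diag lab s" using T by (auto simp: tris_def subdomain_def)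
  obtain p q r where c: "T = convex hull {p, q, r}" "p \<in> mesh_nodes" "q \<in> mesh_nodes" "r \<in> mesh_nodes"
    "p \<noteq> q" "q \<noteq> r" "p \<noteq> r" using Tm by (rule mesh_corners)
  have "{p, q, r} \<subseteq> T" unfolding c(1) by (rule hull_subset)
  moreover have "fst (dof k) \<notin> T" using k Ts by (auto simp: dofs_def)
  ultimately have "\<phi> k p = 0" "\<phi> k q = 0" "\<phi> k r = 0" using nodal[OF k(1)] c(2-4) by auto
  then show ?thesis by (rule zero_at_corners[OF affine[OF k(1)] Tm c(1)])
qed

lemma energy_restrict: "energy (tris s) x y {..<n} = energy (tris s) x y (dofs s)"
proof -
  have "(\<Sum>k<n. x k *\<^sub>R tri_grad (\<phi> k) T j) = (\<Sum>k\<in>dofs s. x k *\<^sub>R tri_grad (\<phi> k) T j)" if "T \<in> tris s" for x T j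
    by (rule sum.mono_neutral_right) (use tri_grad_outside[OF _ _ that] in \<open>auto simp: dofs_def\<close>)
  then show ?thesis unfolding energy_def by (intro sum.cong refl) simp
qed

lemma R_vec:
  assumes s: "s \<in> {1..8}" and x: "x \<in> carrier_vec n" and i: "i < ns s"
  shows "vec_index (R s *\<^sub>v x) i = vec_index x (S s i)"
proof -
  have "vec_index (R s *\<^sub>v x) i = (\<Sum>j<n. (if j = S s i then 1 else 0) * vec_index x j)"
    using x i by (simp add: R_def boolean_restriction_def scalar_prod_def atLeast0LessThan)
  also have "\<dots> = (\<Sum>j<n. if j = S s i then vec_index x j else 0)" by (intro sum.cong) auto
  finally show ?thesis using S_less[OF s i] by simp
qed

text \<open>Each triangle carries exactly one label, so the energy is additive over subdomains, and
  in each of them only its own degrees of freedom contribute.\<close>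

lemma splitting:
  assumes x: "x \<in> carrier_vec n" and y: "y \<in> carrier_vec n"
  shows "x \<bullet> (A *\<^sub>v y) = (\<Sum>s\<in>{1..8}. (R s *\<^sub>v x) \<bullet> (K s *\<^sub>v (R s *\<^sub>v y)))"
proof -
  have "x \<bullet> (A *\<^sub>v y) = (\<Sum>s\<in>{1..8}. energy (tris s) (vec_index x) (vec_index y) {..<n})"
    unfolding A_form[OF x y] energy_def by (rule sum_over_mesh)
  also have "\<dots> = (\<Sum>s\<in>{1..8}. (R s *\<^sub>v x) \<bullet> (K s *\<^sub>v (R s *\<^sub>v y)))"
  proof (rule sum.cong[OF refl])
    fix s assume s: "s \<in> {1..8::nat}"
    have c: "R s *\<^sub>v x \<in> carrier_vec (ns s)" "R s *\<^sub>v y \<in> carrier_vec (ns s)" using R_carrier[of s] x y by auto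
    show "energy (tris s) (vec_index x) (vec_index y) {..<n} = (R s *\<^sub>v x) \<bullet> (K s *\<^sub>v (R s *\<^sub>v y))"
      unfolding energy_restrict
      by (rule K_form_energy[OF s c, symmetric]) (simp_all add: R_vec[OF s x] R_vec[OF s y])
  qed
  finally show ?thesis .
qed

text \<open>Triangle weights are positive, so zero energy means zero strain on each triangle.
  Starting from the clamped column of nodes, all nodal values vanish, and these are the
  coefficients.\<close>

lemma A_spd: "spd n A"
  unfolding spd_def
proof (intro conjI ballI impI A_carrier A_symmetric)
  fix x :: "real Matrix.vec" assume x: "x \<in> carrier_vec n" "x \<noteq> 0\<^sub>v n"
  let ?U = "\<lambda>p. \<Sum>k<n. vec_index x k *\<^sub>R \<phi> k p"
  have U: "affine_on_mesh diag ?U" by (rule affine_sum(1)) (simp add: affine)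
  have Ug: "tri_grad ?U T = (\<lambda>j. \<Sum>k<n. vec_index x k *\<^sub>R tri_grad (\<phi> k) T j)" if "T \<in> mesh diag" for T
    by (rule ext, rule affine_sum(2)[OF _ that]) (simp add: affine)
  have nn: "0 \<le> tri_weight E T * unit_density (tri_grad ?U T) (tri_grad ?U T)" if "T \<in> mesh diag" for T
    using tri_weight_pos[OF that] unit_density_nonneg by (simp add: less_imp_le)
  have form: "x \<bullet> (A *\<^sub>v x) = (\<Sum>T\<in>mesh diag. tri_weight E T * unit_density (tri_grad ?U T) (tri_grad ?U T))"
    unfolding A_form[OF x(1) x(1)] energy_def by (intro sum.cong refl) (simp only: Ug)
  show "0 < x \<bullet> (A *\<^sub>v x)"
  proof (rule ccontr)
    assume "\<not> 0 < x \<bullet> (A *\<^sub>v x)"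
    moreover have "0 \<le> x \<bullet> (A *\<^sub>v x)" unfolding form by (rule sum_nonneg[OF nn])
    ultimately have "(\<Sum>T\<in>mesh diag. tri_weight E T * unit_density (tri_grad ?U T) (tri_grad ?U T)) = 0"
      unfolding form by linarith
    moreover have "(\<Sum>T\<in>mesh diag. tri_weight E T * unit_density (tri_grad ?U T) (tri_grad ?U T)) = 0 \<longleftrightarrow>
      (\<forall>T\<in>mesh diag. tri_weight E T * unit_density (tri_grad ?U T) (tri_grad ?U T) = 0)"
      by (intro sum_nonneg_eq_0_iff finite_mesh nn)
    ultimately have "\<forall>T\<in>mesh diag. tri_weight E T * unit_density (tri_grad ?U T) (tri_grad ?U T) = 0" by blast
    then have e: "unit_density (tri_grad ?U T) (tri_grad ?U T) = 0" if "T \<in> mesh diag" for T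
      using tri_weight_pos[OF that] that by fastforce
    have bd: "?U (node 0 j) = 0" if "j \<le> 42" for j
    proof (rule sum.neutral, rule ballI)
      fix k assume "k \<in> {..<n}"
      then have k: "k < n" by simp
      have "node 0 j \<in> mesh_nodes" using that by (auto simp: mesh_nodes_def)
      moreover have "node 0 j \<in> dirichlet_bd" using that by (simp add: dirichlet_bd_def Omega_def)
      ultimately have "\<phi> k (node 0 j) = 0" using nodal[OF k] dof_node[OF k] by auto
      then show "vec_index x k *\<^sub>R \<phi> k (node 0 j) = 0" by simp
    qed
    have "x = 0\<^sub>v n"
    proof (rule eq_vecI)
      fix k assume "k < dim_vec (0\<^sub>v n :: real Matrix.vec)"
      then have k: "k < n" by simp
      obtain p c where pc: "dof k = (p, c)" by (cases "dof k")
      then have p: "p \<in> mesh_nodes" using dof_node(1)[OF k] by simp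
      then obtain i j where ij: "p = node i j" "i \<le> 84" "j \<le> 42" by (auto simp: mesh_nodes_def)
      have "?U p = 0" unfolding ij(1) by (rule zero_energy_nodes[OF U e bd ij(2,3)])
      \<comment> \<open>The component \<open>c\<close> of the value at the node \<open>p\<close> is
        the coefficient of degree of freedom \<open>k\<close>.\<close>
      then have "0 = ?U p $ c" by simp
      also have "\<dots> = (\<Sum>l<n. vec_index x l * \<phi> l p $ c)" by simp
      also have "\<dots> = (\<Sum>l<n. if l = k then vec_index x k else 0)"
      proof (rule sum.cong[OF refl])
        fix l assume "l \<in> {..<n}"
        then have l: "l < n" by simp
        show "vec_index x l * \<phi> l p $ c = (if l = k then vec_index x k else 0)"
          using nodal[OF l p] dof_inject[OF l k] pc by (cases "dof l") (auto simp: axis_def)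
      qed
      also have "\<dots> = vec_index x k" using k by simp
      finally show "vec_index x k = vec_index (0\<^sub>v n) k" using k by simp
    qed (use x in simp)
    then show False using x(2) by contradiction
  qed
qed

section \<open>Scaling weights and the partition of unity\<close>

lemma form_diag_nonneg: "k < n \<Longrightarrow> 0 \<le> elast_form E (subdomain diag lab s) (\<phi> k) (\<phi> k)"
  unfolding form_subdomain by (intro sum_nonneg mult_nonneg_nonneg unit_density_nonneg tri_weight_nonneg)

text \<open>Take a triangle of the subdomain that contains the node. Two of its corners are other
  nodes, where the nodal function is zero; zero strain would force it to vanish at its own node too.
  This makes the k-scaling invertible.\<close>

lemma form_diag_pos:
  assumes "k \<in> dofs s"
  shows "0 < elast_form E (subdomain diag lab s) (\<phi> k) (\<phi> k)"
proof -
  from assms obtain T where k: "k < n" and T: "T \<in> tris s" "fst (dof k) \<in> T"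
    by (auto simp: dofs_def subdomain_def tris_def)
  have Tm: "T \<in> mesh diag" using T tris_mesh by blast
  obtain p q r where c: "T = convex hull {p, q, r}" "p \<in> mesh_nodes" "q \<in> mesh_nodes" "r \<in> mesh_nodes"
    "p \<noteq> q" "q \<noteq> r" "p \<noteq> r" using Tm by (rule mesh_corners)
  have cT: "p \<in> T" "q \<in> T" "r \<in> T" unfolding c(1) by (auto intro: hull_inc)
  obtain p' q' where pq: "p' \<in> {p, q, r}" "q' \<in> {p, q, r}" "p' \<noteq> q'" "p' \<noteq> fst (dof k)" "q' \<noteq> fst (dof k)"
    using c(5-7) by (cases "fst (dof k) = p"; cases "fst (dof k) = q") auto
  then have z: "\<phi> k p' = 0" "\<phi> k q' = 0" "p' \<in> T" "q' \<in> T" using nodal[OF k] c(2-4) cT by auto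
  have "\<phi> k (fst (dof k)) \<noteq> 0" using nodal[OF k dof_node(1)[OF k]] by (simp add: axis_eq_0_iff)
  then have "unit_density (tri_grad (\<phi> k) T) (tri_grad (\<phi> k) T) \<noteq> 0"
    using zero_energy_triangle[OF affine[OF k] Tm _ z(3,4) pq(3) z(1,2) T(2)] by blast
  then have "0 < tri_form k k T"
    using unit_density_nonneg[of "tri_grad (\<phi> k) T"] tri_weight_pos[OF Tm] by simp
  then show ?thesis
    unfolding form_subdomain[OF k k]
    by (intro sum_pos2[OF tris_mesh(2) T(1)] mult_nonneg_nonneg unit_density_nonneg tri_weight_nonneg)
qed

lemma form_diag_outside:
  assumes "k < n" "k \<notin> dofs s"
  shows "elast_form E (subdomain diag lab s) (\<phi> k) (\<phi> k) = 0"
proof -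
  have "tri_grad (\<phi> k) T = (\<lambda>_. 0)" if "T \<in> tris s" for T using tri_grad_outside[OF assms that] by auto
  then show ?thesis unfolding form_subdomain[OF assms(1) assms(1)] by (intro sum.neutral) (simp add: unit_density_def)
qed

lemma form_diag_sum: "k < n \<Longrightarrow> elast_form E Omega (\<phi> k) (\<phi> k) = (\<Sum>s\<in>{1..8}. elast_form E (subdomain diag lab s) (\<phi> k) (\<phi> k))"
  by (simp add: form_mesh form_subdomain sum_over_mesh)

lemma dof_covered:
  assumes "k < n"
  obtains s where "s \<in> {1..8}" "k \<in> dofs s"
proof -
  have "fst (dof k) \<in> Omega" using dof_node(1)[OF assms] by (auto simp: mesh_nodes_def Omega_def)
  then obtain T where T: "T \<in> mesh diag" "fst (dof k) \<in> T" using Union_mesh[of diag] by blast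
  then have "lab T \<in> {1..8}" "k \<in> dofs (lab T)" using partition assms by (auto simp: dofs_def subdomain_def)
  then show thesis by (rule that)
qed

lemma RXR_entry:
  assumes X: "X \<in> carrier_mat n n" and s: "s \<in> {1..8}" and i: "i < ns s" and t: "t \<in> {1..8}" and j: "j < ns t"
  shows "(R s * X * (R t)\<^sup>T) $$ (i, j) = X $$ (S s i, S t j)"
proof -
  have RX: "(R s * X) $$ (i, k) = X $$ (S s i, k)" if k: "k < n" for k
  proof -
    have "(R s * X) $$ (i, k) = vec_index (R s *\<^sub>v col X k) i" using R_carrier[of s] X i k by simp
    also have "\<dots> = X $$ (S s i, k)" using R_vec[OF s _ i, of "col X k"] X k S_less[OF s i] by simp
    finally show ?thesis .
  qed
  define v where "v = Matrix.row (R s * X) i"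
  have v: "v \<in> carrier_vec n" "\<And>k. k < n \<Longrightarrow> vec_index v k = X $$ (S s i, k)"
    using R_carrier[of s] X i RX by (auto simp: v_def Matrix.row_def simp del: index_mult_mat(1))
  have "(R s * X * (R t)\<^sup>T) $$ (i, j) = v \<bullet> col ((R t)\<^sup>T) j"
    unfolding v_def by (rule index_mult_mat(1)) (use R_carrier[of s] R_carrier[of t] i j in simp_all)
  also have "\<dots> = v \<bullet> Matrix.row (R t) j" using R_carrier[of t] j by simp
  also have "\<dots> = Matrix.row (R t) j \<bullet> v"
    by (rule comm_scalar_prod[OF v(1)]) (use R_carrier[of t] j in auto)
  also have "\<dots> = vec_index (R t *\<^sub>v v) j" using R_carrier[of t] j by simp
  also have "\<dots> = X $$ (S s i, S t j)" using R_vec[OF t v(1) j] v(2)[OF S_less[OF t j]] by simp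
  finally show ?thesis .
qed

text \<open>Extension by zero from a subdomain is injective because \<open>S s\<close> is, so
  definiteness is inherited from \<open>A\<close>.\<close>

lemma RAR_spd:
  assumes s: "s \<in> {1..8}"
  shows "spd (ns s) (R s * A * (R s)\<^sup>T)"
  unfolding spd_def
proof (intro conjI ballI impI)
  have RA: "R s * A \<in> carrier_mat (ns s) n" using R_carrier[of s] A_carrier by auto
  have RT: "(R s)\<^sup>T \<in> carrier_mat n (ns s)" using R_carrier by simp
  show L: "R s * A * (R s)\<^sup>T \<in> carrier_mat (ns s) (ns s)" using RA RT by auto
  have Asym: "A $$ (k, l) = A $$ (l, k)" if "k < n" "l < n" for k l
    using arg_cong[OF A_symmetric, of "\<lambda>X. X $$ (l, k)"] that A_carrier by simp
  show "transpose_mat (R s * A * (R s)\<^sup>T) = R s * A * (R s)\<^sup>T"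
    by (rule eq_matI) (use L in \<open>auto simp: RXR_entry[OF A_carrier s _ s] Asym S_less[OF s] simp del: index_mult_mat(1)\<close>)
  fix x :: "real Matrix.vec" assume x: "x \<in> carrier_vec (ns s)" "x \<noteq> 0\<^sub>v (ns s)"
  let ?y = "(R s)\<^sup>T *\<^sub>v x"
  have y: "?y \<in> carrier_vec n" using RT x by auto
  have "vec_index ?y (S s i) = vec_index x i" if i: "i < ns s" for i
  proof -
    have "vec_index ?y (S s i) = (\<Sum>j<ns s. (if S s i = S s j then 1 else 0) * vec_index x j)"
      using x S_less[OF s i] by (simp add: R_def boolean_restriction_def scalar_prod_def atLeast0LessThan)
    also have "\<dots> = (\<Sum>j<ns s. if j = i then vec_index x j else 0)"
      using i by (intro sum.cong) (auto simp: S_inj[OF s])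
    finally show ?thesis using i by simp
  qed
  moreover obtain i where "i < ns s" "vec_index x i \<noteq> 0" using x by (metis carrier_vecD eq_vecI index_zero_vec)
  ultimately have "?y \<noteq> 0\<^sub>v n" using S_less[OF s] by (metis index_zero_vec(1))
  then have "0 < ?y \<bullet> (A *\<^sub>v ?y)" by (rule spdD(3)[OF A_spd y])
  also have "?y \<bullet> (A *\<^sub>v ?y) = x \<bullet> (R s *\<^sub>v (A *\<^sub>v ?y))"
    using transpose_form[OF RT x(1), of "A *\<^sub>v ?y"] A_carrier y by simp
  also have "R s *\<^sub>v (A *\<^sub>v ?y) = (R s * A * (R s)\<^sup>T) *\<^sub>v x"
    by (simp only: assoc_mult_mat_vec[OF RA RT x(1)] assoc_mult_mat_vec[OF R_carrier A_carrier y])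
  finally show "0 < x \<bullet> ((R s * A * (R s)\<^sup>T) *\<^sub>v x)" .
qed

text \<open>Indexing the weights by global degrees of freedom allows the sums over subdomains and
  over unknowns to be exchanged; both scalings have this form.\<close>

lemma partition_of_unity:
  assumes D: "\<And>s. s \<in> {1..8} \<Longrightarrow> D s = mat_diag (ns s) (\<lambda>i. e s (S s i))"
    and e: "\<And>k. k < n \<Longrightarrow> (\<Sum>s\<in>{s\<in>{1..8}. k \<in> dofs s}. e s k) = 1"
    and x: "x \<in> carrier_vec n" and y: "y \<in> carrier_vec n"
  shows "x \<bullet> y = (\<Sum>s\<in>{1..8}. (R s *\<^sub>v x) \<bullet> (D s *\<^sub>v (R s *\<^sub>v y)))"
proof -
  let ?h = "\<lambda>s k. vec_index x k * (e s k * vec_index y k)"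
  have loc: "(R s *\<^sub>v x) \<bullet> (D s *\<^sub>v (R s *\<^sub>v y)) = (\<Sum>k<n. if k \<in> dofs s then ?h s k else 0)" if s: "s \<in> {1..8}" for s
  proof -
    have Ry: "R s *\<^sub>v y \<in> carrier_vec (ns s)" using R_carrier[of s] y by auto
    have "(R s *\<^sub>v x) \<bullet> (D s *\<^sub>v (R s *\<^sub>v y)) = (\<Sum>i<ns s. ?h s (S s i))"
      unfolding D[OF s] mat_diag_mult_vec[OF Ry]
      by (simp add: scalar_prod_def atLeast0LessThan R_vec[OF s x] R_vec[OF s y])
    also have "\<dots> = (\<Sum>k\<in>dofs s. ?h s k)" by (rule sum.reindex_bij_betw[OF S_bij[OF s]])
    also have "\<dots> = (\<Sum>k\<in>{..<n} \<inter> dofs s. ?h s k)" by (rule sum.cong) (auto simp: dofs_def)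
    also have "\<dots> = (\<Sum>k<n. if k \<in> dofs s then ?h s k else 0)" by (rule sum.inter_restrict) simp
    finally show ?thesis .
  qed
  have "(\<Sum>s\<in>{1..8}. (R s *\<^sub>v x) \<bullet> (D s *\<^sub>v (R s *\<^sub>v y))) = (\<Sum>s\<in>{1..8}. \<Sum>k<n. if k \<in> dofs s then ?h s k else 0)"
    by (rule sum.cong[OF refl loc])
  also have "\<dots> = (\<Sum>k<n. \<Sum>s\<in>{1..8}. if k \<in> dofs s then ?h s k else 0)" by (rule sum.swap)
  also have "\<dots> = (\<Sum>k<n. vec_index x k * vec_index y k)"
  proof (rule sum.cong[OF refl])
    fix k assume "k \<in> {..<n}"
    then have k: "k < n" by simp
    have "(\<Sum>s\<in>{1..8}. if k \<in> dofs s then ?h s k else 0) = (\<Sum>s\<in>{s\<in>{1..8}. k \<in> dofs s}. ?h s k)"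
      by (rule sum.inter_filter[symmetric]) simp
    also have "\<dots> = (\<Sum>s\<in>{s\<in>{1..8}. k \<in> dofs s}. vec_index x k * vec_index y k * e s k)" by (simp add: mult_ac)
    also have "\<dots> = vec_index x k * vec_index y k" using e[OF k] by (simp add: sum_distrib_left[symmetric])
    finally show "(\<Sum>s\<in>{1..8}. if k \<in> dofs s then ?h s k else 0) = vec_index x k * vec_index y k" .
  qed
  also have "\<dots> = x \<bullet> y" using y by (simp add: scalar_prod_def atLeast0LessThan)
  finally show ?thesis ..
qed

text \<open>The diagonal of \<open>A\<close> is the sum of the local diagonals, and the local entry
  is zero in subdomains that do not contain the node, so the quotients over the remaining ones add
  up to 1.\<close>

lemma k_scaling_weights:
  defines "e \<equiv> \<lambda>s k. elast_form E (subdomain diag lab s) (\<phi> k) (\<phi> k) / elast_form E Omega (\<phi> k) (\<phi> k)"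
  shows "\<And>s. s \<in> {1..8} \<Longrightarrow> k_scaling A K R s = mat_diag (ns s) (\<lambda>i. e s (S s i))"
    and "\<And>s k. k \<in> dofs s \<Longrightarrow> s \<in> {1..8} \<Longrightarrow> e s k \<noteq> 0"
    and "\<And>k. k < n \<Longrightarrow> (\<Sum>s\<in>{s\<in>{1..8}. k \<in> dofs s}. e s k) = 1"
proof -
  have pos: "0 < elast_form E Omega (\<phi> k) (\<phi> k)" if k: "k < n" for k
  proof -
    obtain s where s: "s \<in> {1..8}" "k \<in> dofs s" using k by (rule dof_covered)
    show ?thesis unfolding form_diag_sum[OF k]
      by (rule sum_pos2[of "{1..8}" s]) (use s form_diag_pos[OF s(2)] form_diag_nonneg[OF k] in auto)
  qed
  show "k_scaling A K R s = mat_diag (ns s) (\<lambda>i. e s (S s i))" if s: "s \<in> {1..8}" for s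
  proof (rule eq_matI)
    have Akk: "A $$ (k, k) = elast_form E Omega (\<phi> k) (\<phi> k)" if "k < n" for k using that by (simp add: A_def)
    fix i j assume "i < dim_row (mat_diag (ns s) (\<lambda>i. e s (S s i)))" "j < dim_col (mat_diag (ns s) (\<lambda>i. e s (S s i)))"
    then have ij: "i < ns s" "j < ns s" by (simp_all add: mat_diag_def)
    have "(R s * A * (R s)\<^sup>T) $$ (i, i) = elast_form E Omega (\<phi> (S s i)) (\<phi> (S s i))"
      unfolding RXR_entry[OF A_carrier s ij(1) s ij(1)] by (rule Akk[OF S_less[OF s ij(1)]])
    then show "k_scaling A K R s $$ (i, j) = mat_diag (ns s) (\<lambda>i. e s (S s i)) $$ (i, j)"
      using ij by (auto simp: k_scaling_def mat_diag_def e_def K_def simp del: index_mult_mat(1))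
  qed (simp_all add: k_scaling_def mat_diag_def K_def)
  show "e s k \<noteq> 0" if "k \<in> dofs s" "s \<in> {1..8}" for s k
  proof -
    have "k < n" using that by (simp add: dofs_def)
    then show ?thesis using form_diag_pos[OF that(1)] pos[of k] by (simp add: e_def)
  qed
  show "(\<Sum>s\<in>{s\<in>{1..8}. k \<in> dofs s}. e s k) = 1" if k: "k < n" for k
  proof -
    have "(\<Sum>s\<in>{s\<in>{1..8}. k \<in> dofs s}. elast_form E (subdomain diag lab s) (\<phi> k) (\<phi> k)) = elast_form E Omega (\<phi> k) (\<phi> k)"
      unfolding form_diag_sum[OF k] by (rule sum.mono_neutral_left) (auto simp: form_diag_outside[OF k])
    then show ?thesis using pos[OF k] by (simp add: e_def sum_divide_distrib[symmetric])
  qed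
qed

end

context elasticity
begin

text \<open>The sum of the \<open>R t\<close> Gram matrices is diagonal and counts the subdomains
  sharing each degree of freedom. Every node lies in some subdomain, so the counts are nonzero and
  the inverse is genuine.\<close>

lemma multiplicity_weights:
  defines "e \<equiv> \<lambda>k. inverse (real (card {t\<in>{1..8}. k \<in> dofs t}))"
  shows "\<And>s. s \<in> {1..8} \<Longrightarrow> multiplicity_scaling n R s = mat_diag (ns s) (\<lambda>i. e (S s i))"
    and "\<And>k. k < n \<Longrightarrow> e k \<noteq> 0"
    and "\<And>k. k < n \<Longrightarrow> (\<Sum>s\<in>{s\<in>{1..8}. k \<in> dofs s}. e k) = 1"
proof -
  let ?c = "\<lambda>k. real (card {t\<in>{1..8}. k \<in> dofs t})"
  have c: "?c k \<noteq> 0" if k: "k < n" for k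
  proof -
    obtain s where "s \<in> {1..8}" "k \<in> dofs s" using k by (rule dof_covered)
    then have "{t\<in>{1..8}. k \<in> dofs t} \<noteq> {}" by blast
    then show ?thesis by simp
  qed
  show e0: "e k \<noteq> 0" if "k < n" for k using c[OF that] by (simp add: e_def)
  show "(\<Sum>s\<in>{s\<in>{1..8}. k \<in> dofs s}. e k) = 1" if "k < n" for k using c[OF that] by (simp add: e_def)
  have RtR: "(R t)\<^sup>T * R t \<in> carrier_mat n n" for t using R_carrier[of t] by auto
  have ent: "((R t)\<^sup>T * R t) $$ (k, l) = (if k = l \<and> k \<in> dofs t then 1 else 0)"
    if t: "t \<in> {1..8}" and kl: "k < n" "l < n" for t k l
  proof -
    have "((R t)\<^sup>T * R t) $$ (k, l) = (\<Sum>i<ns t. (if k = S t i then 1 else 0) * (if l = S t i then 1 else 0))"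
      using R_carrier[of t] kl by (simp add: R_def boolean_restriction_def scalar_prod_def atLeast0LessThan)
    also have "\<dots> = (\<Sum>j\<in>dofs t. (if k = j then 1 else 0) * (if l = j then 1 else 0))"
      by (rule sum.reindex_bij_betw[OF S_bij[OF t]])
    also have "\<dots> = (\<Sum>j\<in>dofs t. if k = j then (if k = l then 1 else 0) else 0)" by (intro sum.cong) auto
    also have "\<dots> = (if k = l \<and> k \<in> dofs t then 1 else 0)" using finite_dofs by simp
    finally show ?thesis .
  qed
  have "msum n (\<lambda>t. (R t)\<^sup>T * R t) {1..8} = mat_diag n ?c"
  proof (rule eq_matI)
    fix k l assume "k < dim_row (mat_diag n ?c)" "l < dim_col (mat_diag n ?c)"
    then have kl: "k < n" "l < n" by (simp_all add: mat_diag_def)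
    have "msum n (\<lambda>t. (R t)\<^sup>T * R t) {1..8} $$ (k, l) = (\<Sum>t\<in>{1..8}. ((R t)\<^sup>T * R t) $$ (k, l))"
      using msum_entries[of "{1..8}" "\<lambda>t. (R t)\<^sup>T * R t" n] RtR kl by blast
    also have "\<dots> = (\<Sum>t\<in>{1..8}. if k = l \<and> k \<in> dofs t then 1 else 0)" by (intro sum.cong refl) (rule ent[OF _ kl])
    also have "\<dots> = (if k = l then ?c l else 0)" by (auto simp: sum.If_cases Int_def)
    finally show "msum n (\<lambda>t. (R t)\<^sup>T * R t) {1..8} $$ (k, l) = mat_diag n ?c $$ (k, l)"
      using kl by (simp add: mat_diag_def)
  qed (use msum_entries[of "{1..8}" "\<lambda>t. (R t)\<^sup>T * R t" n] RtR in \<open>auto simp: mat_diag_def\<close>)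
  then have inv: "inv_mat (msum n (\<lambda>t. (R t)\<^sup>T * R t) {1..8}) = mat_diag n e"
    using inv_mat_diag[of n ?c] c by (simp add: e_def)
  show "multiplicity_scaling n R s = mat_diag (ns s) (\<lambda>i. e (S s i))" if s: "s \<in> {1..8}" for s
  proof (rule eq_matI)
    fix i j assume "i < dim_row (mat_diag (ns s) (\<lambda>i. e (S s i)))" "j < dim_col (mat_diag (ns s) (\<lambda>i. e (S s i)))"
    then have ij: "i < ns s" "j < ns s" by (simp_all add: mat_diag_def)
    show "multiplicity_scaling n R s $$ (i, j) = mat_diag (ns s) (\<lambda>i. e (S s i)) $$ (i, j)"
      unfolding multiplicity_scaling_def inv RXR_entry[OF mat_diag_dim s ij(1) s ij(2)]
      using ij S_less[OF s ij(1)] S_less[OF s ij(2)] S_inj[OF s ij] by (simp add: mat_diag_def)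
  qed (use R_carrier[of s] in \<open>auto simp: multiplicity_scaling_def mat_diag_def\<close>)
qed

lemma scaling_weights:
  assumes "(\<forall>s\<in>{1..8}. D s = multiplicity_scaling n R s) \<or> (\<forall>s\<in>{1..8}. D s = k_scaling A K R s)"
  obtains e where "\<And>s. s \<in> {1..8} \<Longrightarrow> D s = mat_diag (ns s) (\<lambda>i. e s (S s i))"
    "\<And>s k. s \<in> {1..8} \<Longrightarrow> k \<in> dofs s \<Longrightarrow> e s k \<noteq> 0"
    "\<And>k. k < n \<Longrightarrow> (\<Sum>s\<in>{s\<in>{1..8}. k \<in> dofs s}. e s k) = 1"
  using assms
proof
  assume "\<forall>s\<in>{1..8}. D s = multiplicity_scaling n R s"
  then show thesis
    using that[of "\<lambda>_ k. inverse (real (card {t\<in>{1..8}. k \<in> dofs t}))"] multiplicity_weights by (simp add: dofs_def)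
next
  assume "\<forall>s\<in>{1..8}. D s = k_scaling A K R s"
  then show thesis
    using that[of "\<lambda>s k. elast_form E (subdomain diag lab s) (\<phi> k) (\<phi> k) / elast_form E Omega (\<phi> k) (\<phi> k)"]
      k_scaling_weights by simp
qed

lemma neumann_neumann_scaling:
  assumes D: "\<And>s. s \<in> {1..8} \<Longrightarrow> D s = mat_diag (ns s) (\<lambda>i. e s (S s i))"
    and e0: "\<And>s k. s \<in> {1..8} \<Longrightarrow> k \<in> dofs s \<Longrightarrow> e s k \<noteq> 0"
    and e1: "\<And>k. k < n \<Longrightarrow> (\<Sum>s\<in>{s\<in>{1..8}. k \<in> dofs s}. e s k) = 1"
  shows "neumann_neumann n {1..8} ns A R K D (\<lambda>s i. e s (S s i))"
proof
  show "e s (S s i) \<noteq> 0" if "s \<in> {1..8}" "i < ns s" for s i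
    using e0[OF that(1)] S_bij[OF that(1)] that(2) by (auto simp: bij_betw_def)
  show "x \<bullet> y = (\<Sum>s\<in>{1..8}. (R s *\<^sub>v x) \<bullet> (D s *\<^sub>v (R s *\<^sub>v y)))"
    if "x \<in> carrier_vec n" "y \<in> carrier_vec n" for x y
    by (rule partition_of_unity[of D e, OF D e1 that])
qed (simp_all add: A_spd R_carrier K_carrier K_symmetric K_psd D RAR_spd splitting)

end

section \<open>The coarse space\<close>

context vec_space
begin

text \<open>The set of rows forgets repetitions. The dimension prescribed for
  \<open>R\<^sub>0\<close> restores them: a basis has as many elements as there are rows, so the
  rows are distinct. Only then does independence of the set give injectivity of the
  transpose.\<close>

lemma basis_rows:
  fixes R\<^sub>0 :: "'a mat"
  assumes W: "submodule class_ring W V"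
    and R0: "R\<^sub>0 \<in> carrier_mat (vectorspace.dim class_ring (V\<lparr>carrier := W\<rparr>)) n"
    and basis: "vectorspace.basis class_ring (V\<lparr>carrier := W\<rparr>) (set (rows R\<^sub>0))"
  shows "\<And>y. y \<in> W \<Longrightarrow> \<exists>c\<in>carrier_vec (dim_row R\<^sub>0). y = R\<^sub>0\<^sup>T *\<^sub>v c"
    and "\<And>c. c \<in> carrier_vec (dim_row R\<^sub>0) \<Longrightarrow> R\<^sub>0\<^sup>T *\<^sub>v c = 0\<^sub>v n \<Longrightarrow> c = 0\<^sub>v (dim_row R\<^sub>0)"
proof -
  let ?ws = "rows R\<^sub>0" and ?k = "dim_row R\<^sub>0"
  have vs: "vectorspace class_ring (V\<lparr>carrier := W\<rparr>)"
    by (rule subspace_is_vs) (use W in \<open>auto simp: subspace_def vectorspace_axioms\<close>)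
  interpret W: vectorspace class_ring "V\<lparr>carrier := W\<rparr>" by (rule vs)
  have b: "W.lin_indpt (set ?ws)" "W.span (set ?ws) = W" "set ?ws \<subseteq> W"
    using basis unfolding W.basis_def by auto
  have "length ?ws = card (set ?ws)" using W.dim_basis[OF _ basis] R0 by auto
  then have d: "distinct ?ws" by (simp add: card_distinct)
  have ws: "set ?ws \<subseteq> carrier_vec n" using R0 by (auto simp: rows_def)
  \<comment> \<open>Independence and span, stated relative to \<open>W\<close> as a space of its
    own, agree with those of the surrounding space.\<close>
  have li: "\<not> lin_dep (set ?ws)" and sp: "span (set ?ws) = W"
    using b span_li_not_depend[OF b(3) W] by auto
  have Rt: "R\<^sub>0\<^sup>T = mat_of_cols n ?ws"
    using R0 by (intro eq_matI) (auto simp: mat_of_cols_index)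
  have comb: "lincomb f (set ?ws) = R\<^sub>0\<^sup>T *\<^sub>v Matrix.vec ?k (\<lambda>i. f (Matrix.row R\<^sub>0 i))" for f
  proof -
    have "lincomb f (set ?ws) = mat_of_cols n ?ws *\<^sub>v Matrix.vec (length ?ws) (\<lambda>i. f (?ws ! i))"
      unfolding lincomb_as_lincomb_list_distinct[OF ws d] by (rule lincomb_list_as_mat_mult) (use ws in auto)
    also have "Matrix.vec (length ?ws) (\<lambda>i. f (?ws ! i)) = Matrix.vec ?k (\<lambda>i. f (Matrix.row R\<^sub>0 i))"
      by (rule eq_vecI) auto
    finally show ?thesis unfolding Rt .
  qed
  show "\<exists>c\<in>carrier_vec ?k. y = R\<^sub>0\<^sup>T *\<^sub>v c" if y: "y \<in> W" for y
  proof -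
    have "y \<in> {lincomb a (set ?ws) | a. a \<in> set ?ws \<rightarrow> carrier class_ring}"
      using y finite_span[OF finite_set, of ?ws] ws unfolding sp[symmetric] by simp
    then obtain f where f: "y = lincomb f (set ?ws)" by blast
    show ?thesis by (rule bexI, rule f[unfolded comb]) simp
  qed
  show "c = 0\<^sub>v ?k" if c: "c \<in> carrier_vec ?k" "R\<^sub>0\<^sup>T *\<^sub>v c = 0\<^sub>v n" for c
  proof (rule eq_vecI)
    fix i assume "i < dim_vec (0\<^sub>v ?k :: 'a Matrix.vec)"
    then have i: "i < ?k" by simp
    have inj: "inj_on (Matrix.row R\<^sub>0) {..<?k}"
    proof (rule inj_onI)
      fix i j assume "i \<in> {..<?k}" "j \<in> {..<?k}" "Matrix.row R\<^sub>0 i = Matrix.row R\<^sub>0 j"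
      then show "i = j" using nth_eq_iff_index_eq[OF d, of i j] by simp
    qed
    define f where "f v = vec_index c (inv_into {..<?k} (Matrix.row R\<^sub>0) v)" for v
    have fr: "f (Matrix.row R\<^sub>0 j) = vec_index c j" if "j < ?k" for j
      using inv_into_f_f[OF inj, of j] that by (simp add: f_def)
    have "Matrix.vec ?k (\<lambda>i. f (Matrix.row R\<^sub>0 i)) = c" using c by (intro eq_vecI) (auto simp: fr)
    then have "lincomb f (set ?ws) = 0\<^sub>v n" unfolding comb using c by simp
    moreover have "Matrix.row R\<^sub>0 i \<in> set ?ws" using i by (auto simp: rows_def)
    ultimately have "f (Matrix.row R\<^sub>0 i) = 0"
      using li unfolding lin_dep_def by (auto simp: class_ring_simps)
    then show "vec_index c i = vec_index (0\<^sub>v ?k) i" using fr[OF i] i by simp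
  qed (use c in simp)
qed

end

lemma Y_L_submodule:
  assumes "dim_row X = m"
  shows "submodule class_ring (Y_L \<tau> X B) (module_vec TYPE(real) m)"
proof -
  interpret vec_space "TYPE(real)" m .
  show ?thesis unfolding Y_L_def assms by (rule span_is_submodule) auto
qed

lemma eigenvector_in_Y_L:
  assumes "dim_row X = m" "y \<in> carrier_vec m" "ev < \<tau>" "X *\<^sub>v y = ev \<cdot>\<^sub>v (B *\<^sub>v y)"
  shows "y \<in> Y_L \<tau> X B"
proof -
  interpret vec_space "TYPE(real)" m .
  let ?G = "{y \<in> carrier_vec m. \<exists>ev<\<tau>. X *\<^sub>v y = ev \<cdot>\<^sub>v (B *\<^sub>v y)}"
  have "?G \<subseteq> span ?G" by (rule in_own_span) auto
  then show ?thesis unfolding Y_L_def assms(1) using assms(2-) by blast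
qed

text \<open>A sum of linear images of subspaces. The submodule property is what gives meaning to a
  basis of \<open>V\<^sub>0\<close> as a vector space of its own.\<close>

lemma coarse_space_submodule:
  assumes R: "\<And>s. s \<in> {1..8} \<Longrightarrow> R s \<in> carrier_mat (m s) n"
    and Y: "\<And>s. s \<in> {1..8} \<Longrightarrow> submodule class_ring (Y s) (module_vec TYPE(real) (m s))"
  shows "submodule class_ring (coarse_space n R Y) (module_vec TYPE(real) n)"
    and "\<And>s y. s \<in> {1..8} \<Longrightarrow> y \<in> Y s \<Longrightarrow> (R s)\<^sup>T *\<^sub>v y \<in> coarse_space n R Y"
proof -
  define el where "el y = finsum_vec TYPE(real) n (\<lambda>s. (R s)\<^sup>T *\<^sub>v y s) {1..8}" for y
  have W: "coarse_space n R Y = {el y | y. \<forall>s\<in>{1..8}. y s \<in> Y s}" by (simp add: coarse_space_def el_def)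
  have Yc: "y \<in> carrier_vec (m s)" if "s \<in> {1..8}" "y \<in> Y s" for s y
    using submodule.subset[OF Y[OF that(1)]] that(2) by (auto simp: module_vec_simps)
  have Rc: "(R s)\<^sup>T *\<^sub>v y s \<in> carrier_vec n" if "s \<in> {1..8}" "\<forall>s\<in>{1..8}. y s \<in> Y s" for s y
    using R[OF that(1)] Yc[OF that(1)] that by auto
  have elc: "el y \<in> carrier_vec n" if "\<forall>s\<in>{1..8}. y s \<in> Y s" for y
    unfolding el_def by (rule finsum_vec_closed) (use Rc[OF _ that] in auto)
  have eli: "vec_index (el y) i = (\<Sum>s\<in>{1..8}. vec_index ((R s)\<^sup>T *\<^sub>v y s) i)"
    if "\<forall>s\<in>{1..8}. y s \<in> Y s" "i < n" for y i
    unfolding el_def by (rule index_finsum_vec) (use Rc[OF _ that(1)] that(2) in auto)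
  have Y0: "0\<^sub>v (m s) \<in> Y s" if "s \<in> {1..8}" for s
    using submodule.zero_closed[OF Y[OF that]] by (simp add: module_vec_simps)
  have Yadd: "x + y \<in> Y s" if "s \<in> {1..8}" "x \<in> Y s" "y \<in> Y s" for s x y
    using submodule.m_closed[OF Y[OF that(1)] that(2,3)] by (simp add: module_vec_simps)
  have Ysmult: "c \<cdot>\<^sub>v y \<in> Y s" if "s \<in> {1..8}" "y \<in> Y s" for s c y
    using submodule.smult_closed[OF Y[OF that(1)], of c y] that(2) by (simp add: module_vec_simps class_ring_simps)
  have RT0: "(R t)\<^sup>T *\<^sub>v 0\<^sub>v (m t) = 0\<^sub>v n" if "t \<in> {1..8}" for t
    by (rule eq_vecI) (use R[OF that] in \<open>auto simp: scalar_prod_def\<close>)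
  show gen: "(R s)\<^sup>T *\<^sub>v y \<in> coarse_space n R Y" if s: "s \<in> {1..8}" and y: "y \<in> Y s" for s y
  proof -
    \<comment> \<open>A single local vector is realized as a family that is zero in all other
      subdomains.\<close>
    define z where "z t = (if t = s then y else 0\<^sub>v (m t))" for t
    have z: "\<forall>t\<in>{1..8}. z t \<in> Y t" using s y Y0 by (auto simp: z_def)
    have Ry: "(R s)\<^sup>T *\<^sub>v y \<in> carrier_vec n" using Rc[OF s z] by (simp add: z_def)
    have "el z = (R s)\<^sup>T *\<^sub>v y"
    proof (rule eq_vecI)
      fix i assume "i < dim_vec ((R s)\<^sup>T *\<^sub>v y)"
      then have i: "i < n" using R[OF s] by simp
      have "vec_index (el z) i = (\<Sum>t\<in>{1..8}. if t = s then vec_index ((R s)\<^sup>T *\<^sub>v y) i else 0)"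
        unfolding eli[OF z i]
        by (intro sum.cong refl) (use RT0 i in \<open>auto simp: z_def\<close>)
      then show "vec_index (el z) i = vec_index ((R s)\<^sup>T *\<^sub>v y) i" using s by simp
    qed (use elc[OF z] R[OF s] in auto)
    then show ?thesis unfolding W using z by force
  qed
  have mod: "module class_ring (module_vec TYPE(real) n)"
  proof -
    interpret V: vec_space "TYPE(real)" n .
    show ?thesis by (rule V.module_axioms)
  qed
  show "submodule class_ring (coarse_space n R Y) (module_vec TYPE(real) n)"
  proof (rule submodule.intro)
    show "module class_ring (module_vec TYPE(real) n)" by (rule mod)
    show "coarse_space n R Y \<subseteq> carrier (module_vec TYPE(real) n)" using elc by (auto simp: W module_vec_simps)
    show "\<zero>\<^bsub>module_vec TYPE(real) n\<^esub> \<in> coarse_space n R Y"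
      using gen[OF _ Y0, of 1] RT0[of 1] by (simp add: module_vec_simps)
  next
    fix v w assume "v \<in> coarse_space n R Y" "w \<in> coarse_space n R Y"
    then obtain x y where x: "v = el x" "\<forall>s\<in>{1..8}. x s \<in> Y s" and y: "w = el y" "\<forall>s\<in>{1..8}. y s \<in> Y s"
      unfolding W by blast
    have xy: "\<forall>s\<in>{1..8}. x s + y s \<in> Y s" using x y Yadd by blast
    have "v + w = el (\<lambda>s. x s + y s)"
    proof (rule eq_vecI)
      fix i assume "i < dim_vec (el (\<lambda>s. x s + y s))"
      then have i: "i < n" using elc[OF xy] by simp
      have "vec_index ((R s)\<^sup>T *\<^sub>v (x s + y s)) i =
        vec_index ((R s)\<^sup>T *\<^sub>v x s) i + vec_index ((R s)\<^sup>T *\<^sub>v y s) i" if s: "s \<in> {1..8}" for s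
        using mult_add_distrib_mat_vec[of "(R s)\<^sup>T" n "m s" "x s" "y s"] R[OF s] Yc[OF s] x y s i by simp
      then show "vec_index (v + w) i = vec_index (el (\<lambda>s. x s + y s)) i"
        using eli[OF xy i] eli[OF x(2) i] eli[OF y(2) i] elc[OF y(2)] i by (simp add: x y sum.distrib)
    qed (use elc[OF xy] elc[OF y(2)] in \<open>simp add: y\<close>)
    then show "v \<oplus>\<^bsub>module_vec TYPE(real) n\<^esub> w \<in> coarse_space n R Y"
      unfolding W using xy by (auto simp: module_vec_simps)
  next
    fix c v assume "v \<in> coarse_space n R Y"
    then obtain x where x: "v = el x" "\<forall>s\<in>{1..8}. x s \<in> Y s" unfolding W by blast
    have cx: "\<forall>s\<in>{1..8}. c \<cdot>\<^sub>v x s \<in> Y s" using x Ysmult by blast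
    have "c \<cdot>\<^sub>v v = el (\<lambda>s. c \<cdot>\<^sub>v x s)"
    proof (rule eq_vecI)
      fix i assume "i < dim_vec (el (\<lambda>s. c \<cdot>\<^sub>v x s))"
      then have i: "i < n" using elc[OF cx] by simp
      have "vec_index ((R s)\<^sup>T *\<^sub>v (c \<cdot>\<^sub>v x s)) i = c * vec_index ((R s)\<^sup>T *\<^sub>v x s) i" if s: "s \<in> {1..8}" for s
        using mult_mat_vec[of "(R s)\<^sup>T" n "m s" "x s" c] R[OF s] Yc[OF s] x s i by simp
      then show "vec_index (c \<cdot>\<^sub>v v) i = vec_index (el (\<lambda>s. c \<cdot>\<^sub>v x s)) i"
        using eli[OF cx i] eli[OF x(2) i] elc[OF x(2)] i by (simp add: x sum_distrib_left)
    qed (use elc[OF cx] elc[OF x(2)] in \<open>simp add: x\<close>)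
    then show "c \<odot>\<^bsub>module_vec TYPE(real) n\<^esub> v \<in> coarse_space n R Y"
      unfolding W using cx by (auto simp: module_vec_simps)
  qed
qed

section \<open>Main theorem\<close>

theorem theorem24:
  fixes diag layers :: bool
    and lab :: "(real^2) set \<Rightarrow> nat"
    and \<Omega> :: "nat \<Rightarrow> (real^2) set"
    and E :: "real^2 \<Rightarrow> real"
    and n :: nat
    and \<phi> :: "nat \<Rightarrow> real^2 \<Rightarrow> real^2"
    and dof :: "nat \<Rightarrow> (real^2) \<times> 2"
    and ns :: "nat \<Rightarrow> nat"
    and S :: "nat \<Rightarrow> nat \<Rightarrow> nat"
    and A H R\<^sub>0 P\<^sub>0 H\<^sub>h :: "real mat"
    and R K D M :: "nat \<Rightarrow> real mat"
    and V\<^sub>0 :: "real Matrix.vec set"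
    and \<tau> :: real
    and Nc :: nat
    and C :: "nat \<Rightarrow> nat set"
  assumes partition: "lab ` mesh diag = {1..8}"
    and Omega_s: "\<Omega> = subdomain diag lab"
    and E: "E = young layers \<Omega>"
    and basis: "nodal_basis diag n \<phi> dof"
    and local_dofs: "\<And>s. s \<in> {1..8} \<Longrightarrow> bij_betw (S s) {..<ns s} {k. k < n \<and> fst (dof k) \<in> \<Omega> s}"
    and A: "A = Matrix.mat n n (\<lambda>(i, j). elast_form E Omega (\<phi> i) (\<phi> j))"
    and R: "\<And>s. R s = boolean_restriction (ns s) n (S s)"
    and K: "\<And>s. K s = Matrix.mat (ns s) (ns s)
               (\<lambda>(i, j). elast_form E (\<Omega> s) (\<phi> (S s i)) (\<phi> (S s j)))"
    and D: "(\<forall>s\<in>{1..8}. D s = multiplicity_scaling n R s) \<or>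
            (\<forall>s\<in>{1..8}. D s = k_scaling A K R s)"
    and M: "\<And>s. M s = inv_mat (D s) * K s * inv_mat (D s)"
    and H: "H = msum n (\<lambda>s. transpose_mat (R s) * D s * pinv (K s) * D s * R s) {1..8}"
    and H_nonsingular: "invertible_mat H"
    and tau: "0 < \<tau>" "\<tau> < 1"
    and V0: "V\<^sub>0 = coarse_space n R (\<lambda>s. Y_L \<tau> (M s) (R s * A * transpose_mat (R s)))"
    and R0: "rows_form_basis n R\<^sub>0 V\<^sub>0"
    and P0: "P\<^sub>0 = coarse_proj A R\<^sub>0"
    and H_hyb: "H\<^sub>h = hybrid A R\<^sub>0 H"
    and colors: "coloring Nc C A R"
  shows "(\<forall>ev. cx_eigenvalue (H * A * P\<^sub>0) ev \<and> ev \<noteq> 0 \<longrightarrow>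
             ev \<in> \<real> \<and> 1 \<le> Re ev \<and> Re ev \<le> real Nc / \<tau>)
       \<and> (\<forall>ev. cx_eigenvalue (H\<^sub>h * A) ev \<longrightarrow>
             ev \<in> \<real> \<and> 1 \<le> Re ev \<and> Re ev \<le> real Nc / \<tau>)"
proof -
  have ym: "young_modulus E (10^5) (10^9)" unfolding E Omega_s by (rule young_modulus_young)
  interpret el: elasticity E "10^5" "10^9" diag lab n \<phi> dof ns S
    by (rule elasticity.intro[OF ym], unfold_locales) (use partition basis local_dofs Omega_s in auto)
  have Aeq: "A = el.A" by (simp add: A el.A_def)
  have Req: "R = el.R" by (rule ext) (simp add: R el.R_def)
  have Keq: "K = el.K" by (rule ext) (simp add: K el.K_def Omega_s)
  obtain e where e: "\<And>s. s \<in> {1..8} \<Longrightarrow> D s = mat_diag (ns s) (\<lambda>i. e s (S s i))"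
    "\<And>s k. s \<in> {1..8} \<Longrightarrow> k \<in> el.dofs s \<Longrightarrow> e s k \<noteq> 0"
    "\<And>k. k < n \<Longrightarrow> (\<Sum>s\<in>{s\<in>{1..8}. k \<in> el.dofs s}. e s k) = 1"
    by (rule el.scaling_weights[OF D[unfolded Aeq Req Keq]]) (rule that)
  interpret nn: neumann_neumann n "{1..8}" ns A R K D "\<lambda>s i. e s (S s i)"
    unfolding Aeq Req Keq by (rule el.neumann_neumann_scaling[OF e])
  have Meq: "M s = nn.M s" for s by (rule M)
  have Heq: "H = nn.prec" by (rule H)
  let ?Y = "\<lambda>s. Y_L \<tau> (M s) (R s * A * (R s)\<^sup>T)"
  have Mdim: "dim_row (M s) = ns s" if "s \<in> {1..8}" for s
    using nn.M_symmetric(1)[OF that] unfolding Meq by (rule carrier_matD(1))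
  have Ysub: "submodule class_ring (?Y s) (module_vec TYPE(real) (ns s))" if "s \<in> {1..8}" for s
    by (rule Y_L_submodule[OF Mdim[OF that]])
  have Wsub: "submodule class_ring V\<^sub>0 (module_vec TYPE(real) n)"
    unfolding V0 by (rule coarse_space_submodule(1)[OF nn.R Ysub])
  have Wgen: "(R s)\<^sup>T *\<^sub>v y \<in> V\<^sub>0" if "s \<in> {1..8}" "y \<in> ?Y s" for s y
    unfolding V0 by (rule coarse_space_submodule(2)[where Y = ?Y, OF nn.R Ysub that])
  define k where "k = dim_row R\<^sub>0"
  interpret vs: vec_space "TYPE(real)" n .
  have R0': "R\<^sub>0 \<in> carrier_mat (vectorspace.dim class_ring ((module_vec TYPE(real) n)\<lparr>carrier := V\<^sub>0\<rparr>)) n"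
    "vectorspace.basis class_ring ((module_vec TYPE(real) n)\<lparr>carrier := V\<^sub>0\<rparr>) (set (rows R\<^sub>0))"
    using R0 by (simp_all add: rows_form_basis_def Let_def)
  note rows = vs.basis_rows[OF Wsub R0', folded k_def]
  have R0c: "R\<^sub>0 \<in> carrier_mat k n" using R0'(1) by (auto simp: k_def)
  interpret cs: coarse_space_correction n k A R\<^sub>0
    by unfold_locales (use nn.A R0c rows(2) in auto)
  \<comment> \<open>The color sets may overlap; one color is chosen for each subdomain.\<close>
  have "\<forall>s\<in>{1..8}. \<exists>j\<in>{1..Nc}. s \<in> C j" using colors by (auto simp: coloring_def)
  then obtain c where c: "\<And>s. s \<in> {1..8} \<Longrightarrow> c s \<in> {1..Nc}" "\<And>s. s \<in> {1..8} \<Longrightarrow> s \<in> C (c s)" by metis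
  have c_orth: "R s * A * (R t)\<^sup>T = 0\<^sub>m (ns s) (ns t)"
    if "s \<in> {1..8}" "t \<in> {1..8}" "s \<noteq> t" "c s = c t" for s t
  proof -
    have "s \<in> C (c s)" by (rule c(2)[OF that(1)])
    moreover have "t \<in> C (c s)" unfolding that(4) by (rule c(2)[OF that(2)])
    ultimately have "R s * A * (R t)\<^sup>T = 0\<^sub>m (dim_row (R s)) (dim_row (R t))"
      using colors c(1)[OF that(1)] that(3) unfolding coloring_def by blast
    then show ?thesis using nn.R[OF that(1)] nn.R[OF that(2)] by simp
  qed
  \<comment> \<open>Subdomain 1 has a color, so there is at least one. Together with \<tau> < 1 the
    upper bound is then at least 1, as the identity action of the hybrid operator on the coarse
    space requires.\<close>
  have "1 \<le> Nc" using c(1)[of 1] by simp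
  then have \<kappa>: "1 \<le> real Nc / \<tau>" using tau by (simp add: le_divide_eq)
  have bound: "v \<bullet> (A *\<^sub>v v) \<le> (A *\<^sub>v v) \<bullet> (H *\<^sub>v (A *\<^sub>v v)) \<and>
      (A *\<^sub>v v) \<bullet> (H *\<^sub>v (A *\<^sub>v v)) \<le> real Nc / \<tau> * (v \<bullet> (A *\<^sub>v v))"
    if v: "v \<in> carrier_vec n" and orth: "\<And>c. c \<in> carrier_vec k \<Longrightarrow> (R\<^sub>0\<^sup>T *\<^sub>v c) \<bullet> (A *\<^sub>v v) = 0" for v
  proof -
    have Av: "A *\<^sub>v v \<in> carrier_vec n" using spdD(1)[OF nn.A] v by auto
    have orth': "((R s)\<^sup>T *\<^sub>v y) \<bullet> (A *\<^sub>v v) = 0"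
      if s: "s \<in> {1..8}" and y: "y \<in> carrier_vec (ns s)" "ev < \<tau>"
        "nn.M s *\<^sub>v y = ev \<cdot>\<^sub>v ((R s * A * (R s)\<^sup>T) *\<^sub>v y)" for s y ev
    proof -
      have "y \<in> ?Y s" by (rule eigenvector_in_Y_L[OF Mdim[OF s] y(1,2) y(3)[folded Meq]])
      then have "(R s)\<^sup>T *\<^sub>v y \<in> V\<^sub>0" by (rule Wgen[OF s])
      \<comment> \<open>The rows of \<open>R\<^sub>0\<close> span the coarse space, so orthogonality
        to the range of its transpose reaches every prolongated low eigenvector.\<close>
      then obtain c where "c \<in> carrier_vec k" "(R s)\<^sup>T *\<^sub>v y = R\<^sub>0\<^sup>T *\<^sub>v c" using rows(1) by blast
      then show ?thesis using orth by simp
    qed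
    note form = nn.prec_form[OF Av, folded Heq]
    have "v \<bullet> (A *\<^sub>v v) \<le> (A *\<^sub>v v) \<bullet> (H *\<^sub>v (A *\<^sub>v v))"
      unfolding form by (rule nn.two_sided_bound(1)[where \<tau> = \<tau> and c = c and Nc = Nc])
        (rule tau(1), rule v, rule orth', assumption+, rule c(1), assumption, rule c_orth, assumption+)
    moreover have "\<tau> * ((A *\<^sub>v v) \<bullet> (H *\<^sub>v (A *\<^sub>v v))) \<le> real Nc * (v \<bullet> (A *\<^sub>v v))"
      unfolding form by (rule nn.two_sided_bound(2)[where \<tau> = \<tau> and c = c and Nc = Nc])
        (rule tau(1), rule v, rule orth', assumption+, rule c(1), assumption, rule c_orth, assumption+)
    ultimately show ?thesis using tau by (simp add: le_divide_eq mult.commute)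
  qed
  note Hs = nn.prec_symmetric[folded Heq]
  have "ev \<in> \<real> \<and> 1 \<le> Re ev \<and> Re ev \<le> real Nc / \<tau>" if "cx_eigenvalue (H * A * P\<^sub>0) ev" "ev \<noteq> 0" for ev
    by (rule cs.two_level_spectrum(1)[OF Hs \<kappa> _ that[unfolded P0]]) (rule bound, assumption, blast)
  moreover have "ev \<in> \<real> \<and> 1 \<le> Re ev \<and> Re ev \<le> real Nc / \<tau>" if "cx_eigenvalue (H\<^sub>h * A) ev" for ev
    by (rule cs.two_level_spectrum(2)[OF Hs \<kappa> _ that[unfolded H_hyb]]) (rule bound, assumption, blast)
  ultimately show ?thesis by blast
qed

end
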